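(* Assume $\gamma>0$ and $\int^\infty\frac{\mathrm{d}x}{x\Psi(1/x)R(x)}<\infty$. Suppose there is a map $p:\mathbb{R}_+\to\mathbb{R}_+$ such that $z\mapsto zp(z)$ is non-decreasing, $p(z)\to0$ as $z\to\infty$, and (i) $\varphi(z)-\varphi(z+zp(z))=O\big(\varphi(z)\Delta(zp(z))\big)$ as $z\to\infty$; (ii) there is $c>1$ such that $\int^\infty\frac{\Delta(zp(z))}{\varphi(cz)R(cz)}\,\mathrm{d}z<\infty$; (iii) $V(z,p(z))=O\big(\Delta(zp(z))\big)$ as $z\to\infty$. Then $\frac{T_b}{\mathbb{E}_\infty[T_b]}\to1$ $\mathbb{P}_\infty$-almost surely as $b\to\infty$.
   Context: Let $\Psi(\lambda)=\gamma\lambda+\frac{\sigma^2}{2}\lambda^2+\int_0^\infty(e^{-\lambda z}-1+\lambda z)\,\pi(\mathrm{d}z)$ for $\lambda\ge0$, with $\sigma\ge0$, $\pi$ a measure on $(0,\infty)$ with $\int_0^\infty(z\wedge z^2)\pi(\mathrm{d}z)<\infty$. $Z$ is a spectrally positive Lévy process with $\mathbb{E}[e^{-\lambda Z_1}\mid Z_0=x]=e^{-\lambda x+\Psi(\lambda)}$. $R$ is continuous on $[0,\infty)$, strictly positive on $(0,\infty)$. With $\tau_0^-=\inf\{t:Z_t<0\}$, $\eta(s)=\int_0^{s\wedge\tau_0^-}\frac{\mathrm{d}r}{R(Z_r)}$, $\eta^{-1}(t)=\inf\{s:\eta(s)>t\}$, set $X_t=Z_{\eta^{-1}(t)\wedge\tau_0^-}$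 and $T_b=\inf\{t\ge0:X_t<b\}$. Under the integral condition $\infty$ is an instantaneous entrance boundary and $\mathbb{P}_\infty,\mathbb{E}_\infty$ refer to the càdlàg strong Markov process started at $\infty$, leaving it instantaneously, evolving from finite states as $X$. $W$ is the scale function ($W=0$ on $(-\infty,0)$, continuous strictly increasing on $[0,\infty)$, $\int_0^\infty e^{-qy}W(y)\mathrm{d}y=1/\Psi(q)$ for $q>0$), $W(\infty)=\lim_{y\to\infty}W(y)=1/\gamma$, and $\Delta(z)=W(\infty)-W(z)$. $\varphi(b)=\frac1\gamma\int_b^\infty\frac{\mathrm{d}x}{R(x)}$ and $V(z,\rho)=\sup_{x\ge z}\left(\frac{R(x)}{R(x+\rho z)}-1\right)_+$ with $(y)_+=\max(y,0)$. *)

theory Defs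
  imports "HOL-Probability.Probability" "HOL-Library.Landau_Symbols"
begin

definition Psi :: "real \<Rightarrow> real \<Rightarrow> real measure \<Rightarrow> real \<Rightarrow> real" where
  "Psi \<gamma> \<sigma> \<pi> l = \<gamma> * l + \<sigma>\<^sup>2 / 2 * l\<^sup>2 + (\<integral>z. (exp (- l * z) - 1 + l * z) \<partial>\<pi>)"

definition levy_measure :: "real measure \<Rightarrow> bool" where
  "levy_measure \<pi> \<longleftrightarrow> sets \<pi> = sets borel \<and> emeasure \<pi> {..0} = 0 \<and>
     (\<integral>\<^sup>+ z. ennreal (min z (z\<^sup>2)) \<partial>\<pi>) < \<infinity>"

definition cadlag :: "(real \<Rightarrow> 'c::topological_space) \<Rightarrow> bool" where
  "cadlag f \<longleftrightarrow> (\<forall>t\<ge>0. continuous (at_right t) f) \<and> (\<forall>t>0. \<exists>l. (f \<longlongrightarrow> l) (at_left t))"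

definition spec_pos_levy :: "'a measure \<Rightarrow> (real \<Rightarrow> 'a \<Rightarrow> real) \<Rightarrow> (real \<Rightarrow> real) \<Rightarrow> bool" where
  "spec_pos_levy M Z \<Psi> \<longleftrightarrow> prob_space M \<and> (\<forall>t. Z t \<in> borel_measurable M) \<and>
     (\<forall>\<omega>\<in>space M. Z 0 \<omega> = 0 \<and> cadlag (\<lambda>t. Z t \<omega>)) \<and>
     (\<forall>s t. 0 \<le> s \<longrightarrow> 0 \<le> t \<longrightarrow>
        distr M borel (\<lambda>\<omega>. Z (s + t) \<omega> - Z s \<omega>) = distr M borel (Z t)) \<and>
     (\<forall>(n::nat) (t::nat \<Rightarrow> real). 0 \<le> t 0 \<longrightarrow> mono t \<longrightarrow>
        prob_space.indep_vars M (\<lambda>_. borel) (\<lambda>i \<omega>. Z (t (Suc i)) \<omega> - Z (t i) \<omega>) {..<n}) \<and>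
     (\<forall>l\<ge>0. (\<integral>\<^sup>+ \<omega>. ennreal (exp (- l * Z 1 \<omega>)) \<partial>M) = ennreal (exp (\<Psi> l)))"

definition scale_function :: "(real \<Rightarrow> real) \<Rightarrow> (real \<Rightarrow> real) \<Rightarrow> bool" where
  "scale_function \<Psi> W \<longleftrightarrow> (\<forall>y<0. W y = 0) \<and> continuous_on {0..} W \<and> strict_mono_on {0..} W \<and>
     (\<forall>q>0. ((\<lambda>y. exp (- q * y) * W y) has_integral (1 / \<Psi> q)) {0..})"

definition Delta :: "(real \<Rightarrow> real) \<Rightarrow> real \<Rightarrow> real" where
  "Delta W z = Lim at_top W - W z"

definition phi :: "real \<Rightarrow> (real \<Rightarrow> real) \<Rightarrow> real \<Rightarrow> real" where
  "phi \<gamma> R b = 1 / \<gamma> * (\<integral>x\<in>{b..}. 1 / R x \<partial>lborel)"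

definition V :: "(real \<Rightarrow> real) \<Rightarrow> real \<Rightarrow> real \<Rightarrow> ereal" where
  "V R z \<rho> = (SUP x\<in>{z..}. ereal (max (R x / R (x + \<rho> * z) - 1) 0))"

text \<open>Killing time and Lamperti-type time change of a path z (already started at its initial state).\<close>
definition tau0 :: "(real \<Rightarrow> real) \<Rightarrow> ereal" where
  "tau0 z = Inf (ereal ` {t. 0 \<le> t \<and> z t < 0})"

definition eta :: "(real \<Rightarrow> real) \<Rightarrow> (real \<Rightarrow> real) \<Rightarrow> real \<Rightarrow> ennreal" where
  "eta R z s = (\<integral>\<^sup>+ r \<in> {r. 0 \<le> r \<and> r \<le> s \<and> ereal r \<le> tau0 z}. inverse (ennreal (R (z r))) \<partial>lborel)"

definition eta_inv :: "(real \<Rightarrow> real) \<Rightarrow> (real \<Rightarrow> real) \<Rightarrow> real \<Rightarrow> ereal" where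
  "eta_inv R z t = Inf {ereal s | s. 0 \<le> s \<and> eta R z s > ennreal t}"

definition Xpath :: "(real \<Rightarrow> real) \<Rightarrow> (real \<Rightarrow> real) \<Rightarrow> real \<Rightarrow> real" where
  "Xpath R z t = z (real_of_ereal (min (eta_inv R z t) (tau0 z)))"

definition Xfrom :: "(real \<Rightarrow> real) \<Rightarrow> (real \<Rightarrow> 'a \<Rightarrow> real) \<Rightarrow> real \<Rightarrow> 'a \<Rightarrow> real \<Rightarrow> real" where
  "Xfrom R Z x \<omega> t = Xpath R (\<lambda>r. x + Z r \<omega>) t"

definition stopping_time_ext :: "'b measure \<Rightarrow> (real \<Rightarrow> 'b measure) \<Rightarrow> ('b \<Rightarrow> ereal) \<Rightarrow> bool" where
  "stopping_time_ext N F \<tau> \<longleftrightarrow> (\<forall>\<omega>\<in>space N. 0 \<le> \<tau> \<omega>) \<and>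
     (\<forall>t. {\<omega>\<in>space N. \<tau> \<omega> \<le> ereal t} \<in> sets (F t))"

definition stopped_sets :: "'b measure \<Rightarrow> (real \<Rightarrow> 'b measure) \<Rightarrow> ('b \<Rightarrow> ereal) \<Rightarrow> 'b set set" where
  "stopped_sets N F \<tau> = {A \<in> sets N. \<forall>t. {\<omega>\<in>A. \<tau> \<omega> \<le> ereal t} \<in> sets (F t)}"

text \<open>Y (on probability space N, filtration F) is the cadlag strong Markov process started at
  infinity, leaving it instantaneously, and evolving from finite states x as X started at x.\<close>
definition entrance_process ::
  "'a measure \<Rightarrow> (real \<Rightarrow> 'a \<Rightarrow> real) \<Rightarrow> (real \<Rightarrow> real) \<Rightarrow>
   'b measure \<Rightarrow> (real \<Rightarrow> 'b measure) \<Rightarrow> (real \<Rightarrow> 'b \<Rightarrow> ereal) \<Rightarrow> bool" where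
  "entrance_process M Z R N F Y \<longleftrightarrow> prob_space N \<and>
     (\<forall>t. sets (F t) \<subseteq> sets N \<and> space (F t) = space N) \<and>
     (\<forall>s t. s \<le> t \<longrightarrow> sets (F s) \<subseteq> sets (F t)) \<and>
     (\<forall>t. Y t \<in> borel_measurable (F t)) \<and>
     (\<forall>\<omega>\<in>space N. Y 0 \<omega> = \<infinity> \<and> (\<forall>t>0. Y t \<omega> < \<infinity>) \<and> cadlag (\<lambda>t. Y t \<omega>)) \<and>
     (\<forall>\<tau>. stopping_time_ext N F \<tau> \<longrightarrow>
        (\<forall>A\<in>stopped_sets N F \<tau>. \<forall>(n::nat) (u::nat \<Rightarrow> real) (B::nat \<Rightarrow> real set).
           (\<forall>i. 0 \<le> u i) \<longrightarrow> (\<forall>i. B i \<in> sets borel) \<longrightarrow>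
           emeasure N {\<omega>\<in>A. \<tau> \<omega> < \<infinity> \<and> Y (real_of_ereal (\<tau> \<omega>)) \<omega> < \<infinity> \<and>
               (\<forall>i<n. Y (real_of_ereal (\<tau> \<omega>) + u i) \<omega> \<in> ereal ` B i)}
           = (\<integral>\<^sup>+ \<omega> \<in> {\<omega>\<in>A. \<tau> \<omega> < \<infinity> \<and> Y (real_of_ereal (\<tau> \<omega>)) \<omega> < \<infinity>}.
                emeasure M {\<omega>'\<in>space M. \<forall>i<n.
                   Xfrom R Z (real_of_ereal (Y (real_of_ereal (\<tau> \<omega>)) \<omega>)) \<omega>' (u i) \<in> B i} \<partial>N)))"

definition T_below :: "(real \<Rightarrow> 'b \<Rightarrow> ereal) \<Rightarrow> real \<Rightarrow> 'b \<Rightarrow> real" where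
  "T_below Y b \<omega> = Inf {t. 0 \<le> t \<and> Y t \<omega> < ereal b}"

end

theory Submission
  imports Defs "HOL-Complex_Analysis.Cauchy_Integral_Formula" "HOL-Real_Asymp.Real_Asymp"
begin

text \<open>
  The theorem follows from a second moment computation. The measure \<open>U(x, dy)\<close> of the time that
  \<open>x + Z\<close> spends near \<open>y\<close> has density \<open>\<Delta>(y - x)\<close>: if \<open>\<mu>\<close> is the law of \<open>Z\<^sub>t\<close>, then the occupation
  measure of \<open>Z\<close> on \<open>[0, t]\<close> plus \<open>W(y) dy\<close> and the convolution of \<open>\<mu>\<close> with \<open>W(y) dy\<close> have the same
  Laplace transform \<open>exp(t \<Psi>) / \<Psi>\<close>, and \<open>Z\<^sub>t\<close> tends to \<open>- \<infinity>\<close> in probability. Started from \<open>x\<close>, the time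
  \<open>T\<^sub>b\<close> is the integral of \<open>1/R\<close> along \<open>x + Z\<close> up to the first passage below \<open>b\<close>. It is dominated by the
  integral of \<open>1\<^bsub>[b,\<infinity>)\<^esub>/R\<close> over all times, whose first two moments are iterated potentials, and the part
  after the first passage has mean at most \<open>e\<^sub>b\<close>, the integral of \<open>\<Delta>(y - b)/R(y)\<close> over \<open>y \<ge> b\<close>.
  Condition (i) gives \<open>e\<^sub>b = O(\<phi>(b) \<Delta>(b p(b)))\<close>, and with \<open>x \<rightarrow> \<infinity>\<close> one obtains
  \<open>E (T\<^sub>b/\<phi>(b) - 1)\<^sup>2 = O(\<Delta>(b p(b)))\<close>. Condition (ii) makes these bounds summable along
  \<open>b\<^sub>k\<close> with \<open>\<phi>(b\<^sub>k) = q\<^sup>k \<phi>(b\<^sub>0)\<close>, so \<open>T/\<phi>\<close> tends to 1 almost surely along \<open>b\<^sub>k\<close>; monotonicity of \<open>T\<close> and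
  \<open>\<phi>\<close> fills the gaps up to factors that tend to 1 as \<open>q \<rightarrow> 1\<close>.
\<close>

section \<open>Uniqueness of Laplace transforms on the line\<close>

text \<open>The transforms of \<open>Z\<close> and \<open>W\<close> are used for positive arguments,
  the measures live on the whole line, and W(y) dy has infinite mass. This is why uniqueness is
  proved for two-sided transforms of infinite measures, and why W(y) dy is added to the occupation
  measure: nothing is subtracted before a finite integral can be cancelled. The process from
  infinity enters through the Markov property at fixed times e > 0. No limit theorem for starting
  points tending to infinity is proved: the upper moment bounds are uniform in the starting point,
  the lower bound holds for all starting points beyond a level x0, and then e tends to 0. Only
  countably many marginals can be compared, so passage times are read off at rational times. The
  mean lies between phi(b) (1 - K) and phi(b), and the second moment is at most phi(b)^2 (1 + K),
  with the same K = O(Delta(b p(b))). The leading terms therefore cancel and the squared relative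
  error has mean at most 3 K; this cancellation is what makes the errors summable along the
  geometric levels.\<close>

lemma powser_coeffs_unique:
  fixes a b :: "nat \<Rightarrow> real"
  assumes r: "0 < r"
    and a: "\<And>h. \<bar>h\<bar> < r \<Longrightarrow> (\<lambda>n. a n * h ^ n) sums f h"
    and b: "\<And>h. \<bar>h\<bar> < r \<Longrightarrow> (\<lambda>n. b n * h ^ n) sums f h"
  shows "a = b"
proof (rule ccontr)
  assume "a \<noteq> b"
  then obtain m where m: "a m - b m \<noteq> 0" by auto
  have s: "(\<lambda>n. (a n - b n) * (x - 0) ^ n) sums 0" if "norm (x - 0) < r" for x
    using sums_diff[OF a b, of x x] that by (simp add: algebra_simps)
  have "a 0 - b 0 = 0"
    using s[of 0] r sums_unique2[OF _ powser_sums_zero[of "\<lambda>n. a n - b n"], of 0] by simp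
  then have "m > 0" using m by (cases m) auto
  \<comment> \<open>A power series with a nonzero coefficient has isolated zeros at its centre,
    whereas the difference series sums to the zero function.\<close>
  obtain s' where s': "0 < s'" "\<And>z::real. z \<in> cball 0 s' - {0} \<Longrightarrow> (0::real) \<noteq> 0"
    using powser_0_nonzero[of r 0 "\<lambda>n. a n - b n" "\<lambda>_. 0", OF r s _ m \<open>m > 0\<close>] by auto
  then show False using s'(2)[of s'] by auto
qed

text \<open>The discs \<open>|s - r| < r\<close> with \<open>r > 0\<close> cover the half plane \<open>Re s > 0\<close>, so the values of the transform for
  real arguments near \<open>r\<close> determine it on a whole vertical line.\<close>

lemma laplace_transform_powser:
  fixes P :: "real measure" and s :: complex
  assumes P: "sets P = sets borel"
    and fin: "\<And>l. l > 0 \<Longrightarrow> integrable P (\<lambda>y. exp (- l * y))"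
    and sr: "norm (s - of_real r) < r"
  shows "(\<lambda>n. of_real (\<integral>y. (- y) ^ n / fact n * exp (- r * y) \<partial>P) * (s - of_real r) ^ n)
    sums (\<integral>y. exp (- s * of_real y) \<partial>P)"
    (is ?A) and "integrable P (\<lambda>y. exp (- s * of_real y))"
proof -
  let ?w = "s - of_real r"
  let ?rho = "norm ?w"
  have [measurable_cong]: "sets P = sets borel" by (rule P)
  \<comment> \<open>\<open>g n\<close> is the nth term of the expansion of exp(-s y) in powers of s
    - r.\<close>
  define g where "g n y = (- of_real y * ?w) ^ n /\<^sub>R fact n * exp (- of_real r * of_real y)" for n and y :: real
  define K where "K = (\<integral>y. exp (- (r - ?rho) * y) + exp (- (r + ?rho) * y) \<partial>P)"
  have iK: "integrable P (\<lambda>y. exp (- (r - ?rho) * y) + exp (- (r + ?rho) * y))"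
    by (intro Bochner_Integration.integrable_add fin) (use sr norm_ge_zero[of ?w] in linarith)+
  have ng: "norm (g n y) = (\<bar>y\<bar> * ?rho) ^ n /\<^sub>R fact n * exp (- r * y)" for n y
    by (simp add: g_def norm_mult norm_power norm_divide norm_exp power_mult_distrib)
  have sg: "(\<lambda>n. norm (g n y)) sums (exp (\<bar>y\<bar> * ?rho) * exp (- r * y))" for y
    unfolding ng by (intro sums_mult2 exp_converges)
  \<comment> \<open>The sign of \<open>y\<close> decides which exponential dominates. Both
    \<open>r - ?rho\<close> and \<open>r + ?rho\<close> are positive, so \<open>fin\<close> applies
    to each.\<close>
  have bd: "exp (\<bar>y\<bar> * ?rho) * exp (- r * y) \<le> exp (- (r - ?rho) * y) + exp (- (r + ?rho) * y)" for y
    by (cases "y \<ge> 0") (simp_all add: exp_add[symmetric] algebra_simps)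
  have ps: "(\<Sum>i<n. norm (g i y)) \<le> exp (- (r - ?rho) * y) + exp (- (r + ?rho) * y)" for n y
    using sum_le_suminf[OF sums_summable[OF sg], of "{..<n}" y] sums_unique[OF sg, of y] bd[of y] by auto
  have gm: "g n \<in> borel_measurable P" for n
    unfolding g_def by measurable
  have ig: "integrable P (g n)" for n
  proof (rule Bochner_Integration.integrable_bound[OF iK gm], intro AE_I2)
    fix y show "norm (g n y) \<le> norm (exp (- (r - ?rho) * y) + exp (- (r + ?rho) * y))"
      using ps[where n="Suc n" and y=y] sum_nonneg[of "{..<n}" "\<lambda>i. norm (g i y)"] by simp
  qed
  have "(\<Sum>i<n. \<integral>y. norm (g i y) \<partial>P) \<le> K" for n
  proof -
    have "(\<Sum>i<n. \<integral>y. norm (g i y) \<partial>P) = (\<integral>y. (\<Sum>i<n. norm (g i y)) \<partial>P)"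
      using ig by (intro Bochner_Integration.integral_sum[symmetric]) auto
    also have "\<dots> \<le> K"
      unfolding K_def using ig iK ps by (intro integral_mono) auto
    finally show ?thesis .
  qed
  then have "summable (\<lambda>i. \<integral>y. norm (g i y) \<partial>P)"
    by (intro summableI_nonneg_bounded) auto
  note * = sums_integral[OF ig AE_I2[OF sums_summable[OF sg]] this]
    integrable_suminf[OF ig AE_I2[OF sums_summable[OF sg]] this]
  have gs: "(\<lambda>n. g n y) sums exp (- s * of_real y)" for y
  proof -
    have "(\<lambda>n. g n y) sums (exp (- of_real y * ?w) * exp (- of_real r * of_real y))"
      unfolding g_def by (intro sums_mult2 exp_converges)
    then show ?thesis by (simp add: exp_add[symmetric] algebra_simps)
  qed
  have "(\<integral>y. g n y \<partial>P) = of_real (\<integral>y. (- y) ^ n / fact n * exp (- r * y) \<partial>P) * ?w ^ n" for n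
  proof -
    have "g n y = of_real ((- y) ^ n / fact n * exp (- r * y)) * ?w ^ n" for y
    proof -
      have "exp (- of_real r * of_real y) = complex_of_real (exp (- r * y))"
        by (simp add: exp_of_real[symmetric])
      moreover have "(- complex_of_real y * ?w) ^ n = of_real ((- y) ^ n) * ?w ^ n"
        by (simp only: power_mult_distrib of_real_power of_real_minus)
      ultimately show ?thesis
        by (simp add: g_def scaleR_conv_of_real divide_inverse mult_ac)
    qed
    then have "(\<integral>y. g n y \<partial>P) = (\<integral>y. of_real ((- y) ^ n / fact n * exp (- r * y)) \<partial>P) * ?w ^ n"
      by simp
    then show ?thesis unfolding integral_complex_of_real .
  qed
  with * gs show ?A "integrable P (\<lambda>y. exp (- s * of_real y))"
    by (simp_all add: sums_iff)
qed

text \<open>The measures may have infinite mass. Tilting by exp(-y) / c makes both of them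
  probability measures, and their characteristic functions are the values of the transforms on the
  line Re s = 1. Levy's uniqueness theorem applies there, and the tilt is undone by a second
  density.\<close>

lemma laplace_transform_unique:
  fixes P Q :: "real measure"
  assumes P: "sets P = sets borel" and Q: "sets Q = sets borel"
    and eq: "\<And>l. l > 0 \<Longrightarrow> (\<integral>\<^sup>+ y. ennreal (exp (- l * y)) \<partial>P) = (\<integral>\<^sup>+ y. ennreal (exp (- l * y)) \<partial>Q)"
    and fin: "\<And>l. l > 0 \<Longrightarrow> (\<integral>\<^sup>+ y. ennreal (exp (- l * y)) \<partial>P) < \<infinity>"
  shows "P = Q"
proof -
  have [measurable_cong]: "sets P = sets borel" "sets Q = sets borel" by fact+
  have iP: "integrable P (\<lambda>y. exp (- l * y))" if "l > 0" for l
    using fin[OF that] by (intro integrableI_bounded) auto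
  have iQ: "integrable Q (\<lambda>y. exp (- l * y))" if "l > 0" for l
    using fin[OF that] eq[OF that] by (intro integrableI_bounded) auto
  have eqR: "(\<integral>y. exp (- l * y) \<partial>P) = (\<integral>y. exp (- l * y) \<partial>Q)" if "l > 0" for l
    using eq[OF that] by (simp add: integral_eq_nn_integral)
  have eqC: "(\<integral>y. exp (- s * of_real y) \<partial>P) = (\<integral>y. exp (- s * of_real y) \<partial>Q)" if s: "Re s > 0" for s :: complex
  proof -
    \<comment> \<open>With this centre, |s - r|^2 = r^2 - |s|^2, so \<open>s\<close> lies in the
      disc of radius \<open>r\<close> about \<open>r\<close>.\<close>
    define r where "r = (cmod s)\<^sup>2 / Re s"
    have r: "r > 0" using s by (auto simp: r_def intro!: divide_pos_pos)
    have "(cmod (s - of_real r))\<^sup>2 = (cmod s)\<^sup>2 - 2 * r * Re s + r\<^sup>2"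
      unfolding cmod_power2 by (simp add: power2_eq_square algebra_simps)
    also have "\<dots> = r\<^sup>2 - (cmod s)\<^sup>2" using s by (simp add: r_def)
    also have "\<dots> < r\<^sup>2" using s by auto
    finally have sr: "cmod (s - of_real r) < r" using r by (simp add: power2_less_imp_less)
    let ?a = "\<lambda>P n. (\<integral>y. (- y) ^ n / fact n * exp (- r * y) \<partial>(P :: real measure))"
    \<comment> \<open>For a real shift \<open>h\<close> the expansion has real terms and sums to the
      transform at r + h, where \<open>P\<close> and \<open>Q\<close> are known to agree; this
      identifies the coefficients.\<close>
    have real: "(\<lambda>n. ?a M n * h ^ n) sums (\<integral>y. exp (- (r + h) * y) \<partial>M)"
      if "sets M = sets borel" "\<And>l. l > 0 \<Longrightarrow> integrable M (\<lambda>y. exp (- l * y))" "\<bar>h\<bar> < r" for M h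
    proof -
      have "(\<lambda>n. complex_of_real (?a M n) * (of_real (r + h) - of_real r) ^ n)
          sums (\<integral>y. exp (- of_real (r + h) * of_real y) \<partial>M)"
        using that by (intro laplace_transform_powser(1)) (auto simp: of_real_diff[symmetric] simp del: of_real_add of_real_diff)
      then have "(\<lambda>n. complex_of_real (?a M n * h ^ n))
          sums complex_of_real (\<integral>y. exp (- (r + h) * y) \<partial>M)"
        unfolding of_real_minus[symmetric] of_real_mult[symmetric] exp_of_real integral_complex_of_real
        by simp
      then show ?thesis unfolding sums_of_real_iff .
    qed
    have "?a P = ?a Q"
    proof (rule powser_coeffs_unique[OF r])
      fix h assume h: "\<bar>h\<bar> < r"
      show "(\<lambda>n. ?a P n * h ^ n) sums (\<integral>y. exp (- (r + h) * y) \<partial>P)" by (rule real[OF P iP h])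
      show "(\<lambda>n. ?a Q n * h ^ n) sums (\<integral>y. exp (- (r + h) * y) \<partial>P)"
        using real[OF Q iQ h] eqR[of "r + h"] h by simp
    qed
    then show ?thesis
      using sums_unique2 laplace_transform_powser(1)[OF P iP sr] laplace_transform_powser(1)[OF Q iQ sr]
      by (simp add: fun_eq_iff) blast
  qed
  define c where "c = (\<integral>y. exp (- y) \<partial>P)"
  have cQ: "c = (\<integral>y. exp (- y) \<partial>Q)" using eqR[of 1] by (simp add: c_def)
  show ?thesis
  \<comment> \<open>The tilt divides by \<open>c\<close>. If c = 0, both measures vanish because the
    integrand is positive.\<close>
  proof (cases "c = 0")
    case True
    have "emeasure M (space M) = 0" if "sets M = sets borel" "integrable M (\<lambda>y. exp (- y))" "(\<integral>y. exp (- y) \<partial>M) = 0" for M :: "real measure"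
      using that by (auto simp: integral_nonneg_eq_0_iff_AE AE_iff_null null_setsD1)
    then have "emeasure P (space P) = 0" "emeasure Q (space Q) = 0"
      using P Q iP[of 1] iQ[of 1] True cQ c_def by auto
    then show ?thesis
      by (intro measure_eqI) (metis P Q emeasure_space le_zero_eq)+
  next
    case False
    have "c \<ge> 0" unfolding c_def by (rule Bochner_Integration.integral_nonneg) simp
    with False have c: "c > 0" by simp
    let ?T = "\<lambda>M. density M (\<lambda>y. ennreal (exp (- y) / c))"
    have rd: "real_distribution (?T M)"
      if [measurable_cong]: "sets M = sets borel" and "integrable M (\<lambda>y. exp (- y))" "(\<integral>y. exp (- y) \<partial>M) = c" for M :: "real measure"
    proof -
      have "emeasure (?T M) (space (?T M)) = (\<integral>\<^sup>+ y. ennreal (exp (- y) / c) \<partial>M)"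
        by (simp add: emeasure_density cong: nn_integral_cong)
      also have "\<dots> = ennreal (\<integral>y. exp (- y) / c \<partial>M)"
        using that c by (intro nn_integral_eq_integral) auto
      also have "\<dots> = 1" using that c by simp
      finally have "prob_space (?T M)" by (rule prob_spaceI)
      then show ?thesis
        by (simp add: real_distribution_def real_distribution_axioms_def that sets_eq_imp_space_eq[OF that(1)])
    qed
    have ch: "char (?T M) t = (\<integral>y. exp (- Complex 1 (- t) * of_real y) \<partial>M) / c"
      if [measurable_cong]: "sets M = sets borel" for M and t :: real
    proof -
      have "char (?T M) t = (\<integral>y. (exp (- y) / c) *\<^sub>R iexp (t * y) \<partial>M)"
        unfolding char_def using c by (subst integral_density) (auto simp: )
      also have "\<dots> = (\<integral>y. exp (- Complex 1 (- t) * of_real y) / c \<partial>M)"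
      proof (intro Bochner_Integration.integral_cong refl)
        fix y
        have "exp (- Complex 1 (- t) * of_real y) = exp (of_real (- y)) * iexp (t * y)"
          unfolding exp_add[symmetric] by (simp add: complex_eq_iff exp_eq_polar algebra_simps Complex_eq)
        then show "(exp (- y) / c) *\<^sub>R iexp (t * y) = exp (- Complex 1 (- t) * of_real y) / c"
          by (simp add: scaleR_conv_of_real exp_of_real[symmetric])
      qed
      finally show ?thesis by simp
    qed
    have "?T P = ?T Q"
    proof (rule Levy_uniqueness)
      show "real_distribution (?T P)" "real_distribution (?T Q)"
        using rd[OF P] rd[OF Q] iP[of 1] iQ[of 1] cQ c_def by auto
      show "char (?T P) = char (?T Q)"
        using eqC by (intro ext) (simp add: ch P Q)
    qed
    then have "density (?T P) (\<lambda>y. ennreal (c * exp y)) = density (?T Q) (\<lambda>y. ennreal (c * exp y))"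
      by simp
    moreover have "density (?T M) (\<lambda>y. ennreal (c * exp y)) = M" if [measurable_cong]: "sets M = sets borel" for M
    proof -
      have "density (?T M) (\<lambda>y. ennreal (c * exp y)) = density M (\<lambda>y. ennreal (exp (- y) / c) * ennreal (c * exp y))"
        by (intro density_density_eq) auto
      also have "\<dots> = density M (\<lambda>_. 1)"
        using c by (intro arg_cong[of _ _ "density M"] ext) (simp add: ennreal_mult[symmetric] exp_minus)
      finally show ?thesis by (simp add: density_1)
    qed
    ultimately show ?thesis using P Q by simp
  qed
qed

section \<open>Laplace exponent and scale function\<close>

locale levy_scale =
  fixes \<gamma> \<sigma> :: real and \<pi> :: "real measure"
    and M :: "'a measure" and Z :: "real \<Rightarrow> 'a \<Rightarrow> real" and W :: "real \<Rightarrow> real"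
  assumes gamma_pos: "\<gamma> > 0"
    and levy_pi: "levy_measure \<pi>"
    and levy_Z: "spec_pos_levy M Z (Psi \<gamma> \<sigma> \<pi>)"
    and scale_W: "scale_function (Psi \<gamma> \<sigma> \<pi>) W"
begin

abbreviation \<Psi> :: "real \<Rightarrow> real" where "\<Psi> \<equiv> Psi \<gamma> \<sigma> \<pi>"

lemma sets_pi [measurable_cong]: "sets \<pi> = sets borel"
  using levy_pi by (simp add: levy_measure_def)

lemma AE_pi_pos: "AE z in \<pi>. z > 0"
proof (rule AE_I[of _ _ "{..0}"])
  show "{z \<in> space \<pi>. \<not> z > 0} \<subseteq> {..0}" by auto
qed (use levy_pi in \<open>auto simp: levy_measure_def\<close>)

lemma integrable_min_pi: "integrable \<pi> (\<lambda>z. min z (z\<^sup>2))"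
proof (rule integrableI_nonneg)
  show "AE z in \<pi>. 0 \<le> min z (z\<^sup>2)" using AE_pi_pos by eventually_elim auto
qed (use levy_pi in \<open>auto simp: levy_measure_def\<close>)

text \<open>For x = l z the quadratic bound comes from exp(-x) <= 1 / (1 + x) and (1 - x + x^2) (1 +
  x) = 1 + x^3.\<close>

lemma compensated_exp_bounds:
  fixes l z :: real
  assumes "l > 0" "z > 0"
  shows "0 \<le> exp (- l * z) - 1 + l * z" "exp (- l * z) - 1 + l * z \<le> l * z"
    "exp (- l * z) - 1 + l * z \<le> l\<^sup>2 * z\<^sup>2"
proof -
  have lz: "l * z > 0" using assms by simp
  show "0 \<le> exp (- l * z) - 1 + l * z" using exp_ge_add_one_self[of "- l * z"] by simp
  show "exp (- l * z) - 1 + l * z \<le> l * z" using lz by simp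
  have "exp (- l * z) \<le> 1 - l * z + (l * z)\<^sup>2"
  proof -
    have "exp (- (l * z)) \<le> 1 / (1 + l * z)"
      using exp_ge_add_one_self[of "l * z"] lz by (simp add: exp_minus field_simps)
    also have "\<dots> \<le> 1 - l * z + (l * z)\<^sup>2"
    proof -
      have "(1 - l * z + (l * z)\<^sup>2) * (1 + l * z) = 1 + (l * z) ^ 3"
        by (simp add: algebra_simps power2_eq_square power3_eq_cube)
      then show ?thesis using lz by (simp add: divide_le_eq)
    qed
    finally show ?thesis by simp
  qed
  then show "exp (- l * z) - 1 + l * z \<le> l\<^sup>2 * z\<^sup>2" by (simp add: power_mult_distrib)
qed

text \<open>Pulling out one factor \<open>l\<close> leaves a majorant free of \<open>l\<close> that
  \<open>levy_measure\<close> makes integrable; it serves both the linear bound on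
  \<open>\<Psi>\<close> and dominated convergence.\<close>

lemma compensated_exp_le_min:
  fixes l z :: real
  assumes "l > 0" "z > 0" "l \<le> 1"
  shows "exp (- l * z) - 1 + l * z \<le> l * min z (z\<^sup>2)"
proof -
  have "l * l * z\<^sup>2 \<le> l * 1 * z\<^sup>2"
    using assms by (intro mult_right_mono mult_left_mono) auto
  then have "l\<^sup>2 * z\<^sup>2 \<le> l * z\<^sup>2" by (simp add: power2_eq_square)
  then show ?thesis
    using compensated_exp_bounds[OF assms(1,2)] by (auto simp: min_def)
qed

lemma Psi_ge: "l > 0 \<Longrightarrow> \<gamma> * l \<le> \<Psi> l"
proof -
  assume l: "l > 0"
  have "0 \<le> (\<integral>z. (exp (- l * z) - 1 + l * z) \<partial>\<pi>)"
    by (intro integral_nonneg_AE eventually_mono[OF AE_pi_pos] compensated_exp_bounds(1)[OF l])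
  then show ?thesis unfolding Psi_def by simp
qed

lemma Psi_pos: "l > 0 \<Longrightarrow> 0 < \<Psi> l"
  using Psi_ge[of l] gamma_pos mult_pos_pos[of \<gamma> l] by linarith

text \<open>Gives boundedness of x \<open>\<Psi>\<close> (1/x) for x >= 1, by which the entrance
  condition yields integrability of 1 / R.\<close>

lemma Psi_le: "\<exists>K. \<forall>l. 0 < l \<and> l \<le> 1 \<longrightarrow> \<Psi> l \<le> K * l"
proof (intro exI allI impI)
  fix l :: real assume l: "0 < l \<and> l \<le> 1"
  have "(\<integral>z. (exp (- l * z) - 1 + l * z) \<partial>\<pi>) \<le> (\<integral>z. l * min z (z\<^sup>2) \<partial>\<pi>)"
  proof (rule integral_mono_AE')
    show "AE z in \<pi>. exp (- l * z) - 1 + l * z \<le> l * min z (z\<^sup>2)"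
      using AE_pi_pos by eventually_elim (use l compensated_exp_le_min in blast)
    show "AE z in \<pi>. 0 \<le> l * min z (z\<^sup>2)"
      using AE_pi_pos by eventually_elim (use l in auto)
  qed (use integrable_min_pi in auto)
  moreover have "\<sigma>\<^sup>2 / 2 * l\<^sup>2 \<le> \<sigma>\<^sup>2 / 2 * l"
    using l by (intro mult_left_mono) (auto simp: power2_eq_square mult_left_le)
  ultimately show "\<Psi> l \<le> (\<gamma> + \<sigma>\<^sup>2 / 2 + (\<integral>z. min z (z\<^sup>2) \<partial>\<pi>)) * l"
    unfolding Psi_def by (simp add: algebra_simps)
qed

text \<open>The right derivative of \<open>\<Psi>\<close> at 0, by dominated convergence, hence
  along sequences.\<close>

lemma Psi_over_tendsto:
  fixes X :: "nat \<Rightarrow> real"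
  assumes X: "\<And>n. 0 < X n" "\<And>n. X n \<le> 1" "X \<longlonglongrightarrow> 0"
  shows "(\<lambda>n. \<Psi> (X n) / X n) \<longlonglongrightarrow> \<gamma>"
proof -
  let ?g = "\<lambda>n z. (exp (- X n * z) - 1 + X n * z) / X n"
  have "(\<lambda>n. \<integral>z. ?g n z \<partial>\<pi>) \<longlonglongrightarrow> (\<integral>z. 0 \<partial>\<pi>)"
  proof (rule integral_dominated_convergence[where w="\<lambda>z. min z (z\<^sup>2)"])
    show "AE z in \<pi>. (\<lambda>n. ?g n z) \<longlonglongrightarrow> 0"
      using AE_pi_pos
    proof eventually_elim
      fix z :: real assume z: "z > 0"
      have b: "0 \<le> ?g n z \<and> ?g n z \<le> X n * z\<^sup>2" for n
        using compensated_exp_bounds[OF X(1)[of n] z] X(1)[of n] by (auto simp: field_simps power2_eq_square)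
      have "(\<lambda>n. X n * z\<^sup>2) \<longlonglongrightarrow> 0 * z\<^sup>2" by (intro tendsto_intros X)
      then show "(\<lambda>n. ?g n z) \<longlonglongrightarrow> 0"
        using b by (intro tendsto_sandwich[OF _ _ tendsto_const[of 0 sequentially], of "\<lambda>n. ?g n z" "\<lambda>n. X n * z\<^sup>2"]) auto
    qed
    show "AE z in \<pi>. norm (?g n z) \<le> min z (z\<^sup>2)" for n
      using AE_pi_pos
    proof eventually_elim
      fix z :: real assume z: "z > 0"
      show "norm (?g n z) \<le> min z (z\<^sup>2)"
        using compensated_exp_bounds(1)[OF X(1)[of n] z] compensated_exp_le_min[OF X(1)[of n] z X(2)[of n]] X(1)[of n]
        by (simp add: divide_le_eq mult.commute del: min_less_iff_conj min_le_iff_disj min.bounded_iff)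
    qed
  qed (auto simp: integrable_min_pi)
  then have "(\<lambda>n. \<gamma> + \<sigma>\<^sup>2 / 2 * X n + (\<integral>z. ?g n z \<partial>\<pi>)) \<longlonglongrightarrow> \<gamma> + \<sigma>\<^sup>2 / 2 * 0 + 0"
    by (intro tendsto_intros X) auto
  moreover have "\<gamma> + \<sigma>\<^sup>2 / 2 * X n + (\<integral>z. ?g n z \<partial>\<pi>) = \<Psi> (X n) / X n" for n
    using X(1)[of n] by (simp add: Psi_def add_divide_distrib power2_eq_square integral_divide_zero[symmetric] del: integral_divide_zero)
  ultimately show ?thesis by simp
qed

section \<open>Sign, monotonicity and limit of the scale function\<close>

lemma W_neg: "y < 0 \<Longrightarrow> W y = 0"
  and W_cont: "continuous_on {0..} W"
  and W_strict_mono: "strict_mono_on {0..} W"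
  and W_laplace: "q > 0 \<Longrightarrow> ((\<lambda>y. exp (- q * y) * W y) has_integral (1 / \<Psi> q)) {0..}"
  using scale_W by (auto simp: scale_function_def)

lemma W_mono_on: "0 \<le> x \<Longrightarrow> x \<le> y \<Longrightarrow> W x \<le> W y"
  using W_strict_mono by (cases "x = y") (auto simp: strict_mono_on_def less_imp_le)

lemma exp_has_integral: "q > 0 \<Longrightarrow> ((\<lambda>y::real. exp (- q * y)) has_integral (1 / q)) {0..}"
  using has_integral_exp_minus_to_infinity[of q 0] by simp

text \<open>The sign of W at 0 is hidden in its transform at large arguments. If W 0 < 0, then W <=
  W 0 / 2 near 0, and q times the transform at \<open>q\<close> is at most W 0 / 2 plus a term that
  vanishes as \<open>q\<close> grows, while 1 / \<open>\<Psi>\<close> q is positive.\<close>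

lemma W_0: "0 \<le> W 0"
proof (rule ccontr)
  assume "\<not> 0 \<le> W 0"
  then have W0: "W 0 < 0" by simp
  have "\<exists>d>0. \<forall>y\<in>{0..}. dist y 0 < d \<longrightarrow> dist (W y) (W 0) < - W 0 / 2"
    using W_cont W0 unfolding continuous_on_iff by (metis atLeast_iff divide_pos_pos neg_0_less_iff_less order_refl zero_less_numeral)
  then obtain d where d: "d > 0" "\<And>y. 0 \<le> y \<Longrightarrow> y < d \<Longrightarrow> W y \<le> W 0 / 2"
    by (force simp: dist_real_def abs_if split: if_splits)
  \<comment> \<open>The transform at 1 of the nonnegative function W - W 0. Beyond \<open>d\<close>
    the weight exp(-q y) is at most exp(-(q - 1) d) exp(-y), so \<open>K\<close> controls the tail
    for all q > 1.\<close>
  define K where "K = 1 / \<Psi> 1 - W 0"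
  have K: "((\<lambda>y. exp (- 1 * y) * (W y - W 0)) has_integral K) {0..}"
    using has_integral_diff[OF W_laplace[of 1] has_integral_mult_left[OF exp_has_integral[of 1], of "W 0"]]
    by (simp add: K_def algebra_simps)
  have le: "1 / \<Psi> q \<le> W 0 / 2 * (1 / q) + exp (- (q - 1) * d) * K" if q: "q > 1" for q
  proof (rule has_integral_le)
    show "((\<lambda>y. exp (- q * y) * W y) has_integral (1 / \<Psi> q)) {0..}" using q by (intro W_laplace) auto
    show "((\<lambda>y. W 0 / 2 * exp (- q * y) + exp (- (q - 1) * d) * (exp (- 1 * y) * (W y - W 0)))
        has_integral (W 0 / 2 * (1 / q) + exp (- (q - 1) * d) * K)) {0..}"
      using q by (intro has_integral_add has_integral_mult_right exp_has_integral K) auto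
    fix y :: real assume "y \<in> {0..}"
    then have y: "y \<ge> 0" by simp
    have nn: "0 \<le> exp (- 1 * y) * (W y - W 0)" using W_mono_on[of 0 y] y by simp
    show "exp (- q * y) * W y \<le> W 0 / 2 * exp (- q * y) + exp (- (q - 1) * d) * (exp (- 1 * y) * (W y - W 0))"
    proof (cases "y < d")
      case True
      have "exp (- q * y) * W y \<le> exp (- q * y) * (W 0 / 2)" using d(2)[OF y True] by (intro mult_left_mono) auto
      then show ?thesis using mult_nonneg_nonneg[OF exp_ge_zero[of "- (q - 1) * d"] nn]
        unfolding mult.commute[of "W 0 / 2"] by linarith
    next
      case False
      have "exp (- q * y) * (W y - W 0) \<le> exp (- (q - 1) * d) * exp (- 1 * y) * (W y - W 0)"
        unfolding exp_add[symmetric]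
      proof (intro mult_right_mono)
        have "(q - 1) * d \<le> (q - 1) * y" using False q by (intro mult_left_mono) auto
        then show "exp (- q * y) \<le> exp (- (q - 1) * d + - 1 * y)" by (simp add: algebra_simps)
      qed (use W_mono_on[of 0 y] y in auto)
      moreover have "exp (- q * y) * W 0 \<le> exp (- q * y) * (W 0 / 2)" using W0 by (intro mult_left_mono) auto
      ultimately show ?thesis by (simp add: algebra_simps)
    qed
  qed
  have pos: "0 \<le> W 0 / 2 + q * exp (- (q - 1) * d) * K" if "q > 1" for q
  proof -
    have "0 \<le> q * (1 / \<Psi> q)" using Psi_pos[of q] that by auto
    also have "\<dots> \<le> q * (W 0 / 2 * (1 / q) + exp (- (q - 1) * d) * K)" using le[OF that] that by (intro mult_left_mono) auto
    finally show ?thesis using that by (simp add: algebra_simps)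
  qed
  have "((\<lambda>q. q * exp (- (q - 1) * d)) \<longlongrightarrow> 0) at_top" using d(1) by real_asymp
  then have "((\<lambda>q. W 0 / 2 + q * exp (- (q - 1) * d) * K) \<longlongrightarrow> W 0 / 2 + 0 * K) at_top" by (intro tendsto_intros)
  then have "0 \<le> W 0 / 2 + 0 * K"
    by (rule tendsto_lowerbound) (use pos in \<open>auto intro!: eventually_at_top_linorderI[of 2]\<close>)
  then show False using W0 by simp
qed

lemma mono_W: "mono W"
proof (rule monoI)
  fix x y :: real assume "x \<le> y"
  then show "W x \<le> W y"
    using W_mono_on[of x y] W_mono_on[of 0 y] W_0 W_neg[of x] W_neg[of y]
    by (cases "x < 0"; cases "y < 0") auto
qed

lemma W_nonneg: "0 \<le> W y"
  using monoD[OF mono_W, of 0 y] W_0 W_neg[of y] by (cases "y < 0") auto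

lemma measurable_W [measurable]: "W \<in> borel_measurable borel"
  by (rule borel_measurable_mono[OF mono_W])

lemma inverse_Suc_sequence: "(\<lambda>n. 1 / real (Suc n)) \<longlonglongrightarrow> 0" "\<And>n. 0 < 1 / real (Suc n)" "\<And>n. 1 / real (Suc n) \<le> 1"
  using LIMSEQ_inverse_real_of_nat by (auto simp: inverse_eq_divide)

text \<open>A Tauberian argument: by monotonicity the transform at \<open>q\<close> is at least that
  of W y times a function supported essentially beyond \<open>y\<close>. Multiplying by
  \<open>q\<close> and letting q tend to 0 leaves W y on one side and the limit of q /
  \<open>\<Psi>\<close> q on the other.\<close>

lemma W_le: "W y \<le> 1 / \<gamma>"
proof (cases "y \<ge> 0")
  case False
  then show ?thesis using W_neg gamma_pos by simp
next
  case y: True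
  have "W y * (1 - exp y * q / (q + 1)) \<le> 1 / (\<Psi> q / q)" if q: "q > 0" for q
  proof -
    have "W y * (1 / q - exp y * (1 / (q + 1))) \<le> 1 / \<Psi> q"
    proof (rule has_integral_le)
      show "((\<lambda>u. exp (- q * u) * W u) has_integral (1 / \<Psi> q)) {0..}" by (rule W_laplace[OF q])
      \<comment> \<open>The minorant 1 - exp(y - u) of the indicator of u >= y has an explicit
        transform on the half line.\<close>
      show "((\<lambda>u. W y * (exp (- q * u) - exp y * exp (- (q + 1) * u)))
          has_integral (W y * (1 / q - exp y * (1 / (q + 1))))) {0..}"
        using q by (intro has_integral_mult_right has_integral_diff exp_has_integral) auto
      fix u :: real assume "u \<in> {0..}"
      have "exp y * exp (- (q + 1) * u) = exp (- q * u) * exp (y - u)"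
        unfolding exp_add[symmetric] by (simp add: algebra_simps)
      then have "W y * (exp (- q * u) - exp y * exp (- (q + 1) * u)) = exp (- q * u) * (W y * (1 - exp (y - u)))"
        by (simp add: algebra_simps)
      also have "\<dots> \<le> exp (- q * u) * W u"
      proof (intro mult_left_mono)
        show "W y * (1 - exp (y - u)) \<le> W u"
        proof (cases "y \<le> u")
          case True
          have "W y * (1 - exp (y - u)) \<le> W y * 1" using W_nonneg by (intro mult_left_mono) auto
          then show ?thesis using monoD[OF mono_W True] by simp
        next
          case False
          then have "W y * (1 - exp (y - u)) \<le> 0" using W_nonneg by (intro mult_nonneg_nonpos) auto
          then show ?thesis using W_nonneg[of u] by linarith
        qed
      qed auto
      finally show "W y * (exp (- q * u) - exp y * exp (- (q + 1) * u)) \<le> exp (- q * u) * W u" .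
    qed
    then have "q * (W y * (1 / q - exp y * (1 / (q + 1)))) \<le> q * (1 / \<Psi> q)" using q by (intro mult_left_mono) auto
    moreover have "q * (W y * (1 / q - exp y * (1 / (q + 1)))) = W y * (1 - exp y * q / (q + 1))"
    proof -
      have "q * (1 / q - exp y * (1 / (q + 1))) = 1 - exp y * q / (q + 1)"
        using q by (simp add: right_diff_distrib)
      then show ?thesis by (simp only: mult.left_commute[of q])
    qed
    ultimately have "W y * (1 - exp y * q / (q + 1)) \<le> q * (1 / \<Psi> q)" by (simp only:)
    then show ?thesis by simp
  qed
  from this[OF inverse_Suc_sequence(2)] have "W y * (1 - exp y * (1 / real (Suc n)) / ((1 / real (Suc n)) + 1))
      \<le> 1 / (\<Psi> (1 / real (Suc n)) / (1 / real (Suc n)))" for n .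
  moreover have "(\<lambda>n. W y * (1 - exp y * (1 / real (Suc n)) / ((1 / real (Suc n)) + 1))) \<longlonglongrightarrow> W y * (1 - exp y * 0 / (0 + 1))"
    by (intro tendsto_intros inverse_Suc_sequence) auto
  moreover have "(\<lambda>n. 1 / (\<Psi> (1 / real (Suc n)) / (1 / real (Suc n)))) \<longlonglongrightarrow> 1 / \<gamma>"
    using gamma_pos by (intro tendsto_intros Psi_over_tendsto inverse_Suc_sequence) auto
  ultimately have "W y * (1 - exp y * 0 / (0 + 1)) \<le> 1 / \<gamma>"
    by (intro LIMSEQ_le) blast+
  then show ?thesis by simp
qed

text \<open>A bound W <= a would pass to q / \<open>\<Psi>\<close> q <= a, and q tending to 0 gives
  1 / \<open>\<gamma>\<close> <= a. Monotonicity turns one value above \<open>a\<close> into all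
  later ones.\<close>

lemma W_tendsto: "(W \<longlongrightarrow> 1 / \<gamma>) at_top"
proof (rule order_tendstoI)
  fix a assume a: "a < 1 / \<gamma>"
  have "\<exists>y. a < W y"
  proof (rule ccontr)
    assume "\<not> (\<exists>y. a < W y)"
    then have le: "W y \<le> a" for y by (meson not_le)
    have "1 / (\<Psi> q / q) \<le> a" if q: "q > 0" for q
    proof -
      have "1 / \<Psi> q \<le> (1 / q) * a"
        by (rule has_integral_le[OF W_laplace[OF q] has_integral_mult_left[OF exp_has_integral[OF q]]])
          (auto intro!: mult_left_mono le)
      then have "q * (1 / \<Psi> q) \<le> q * ((1 / q) * a)" using q by (intro mult_left_mono) auto
      then show ?thesis using q by (simp add: field_simps)
    qed
    from this[OF inverse_Suc_sequence(2)] have "1 / (\<Psi> (1 / real (Suc n)) / (1 / real (Suc n))) \<le> a" for n .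
    moreover have "(\<lambda>n. 1 / (\<Psi> (1 / real (Suc n)) / (1 / real (Suc n)))) \<longlonglongrightarrow> 1 / \<gamma>"
      using gamma_pos by (intro tendsto_intros Psi_over_tendsto inverse_Suc_sequence) auto
    ultimately have "1 / \<gamma> \<le> a" by (intro LIMSEQ_le_const2) blast+
    with a show False by simp
  qed
  then obtain y where "a < W y" by blast
  then have "a < W x" if "x \<ge> y" for x using monoD[OF mono_W that] by simp
  then show "\<forall>\<^sub>F x in at_top. a < W x" by (rule eventually_at_top_linorderI)
next
  fix a assume "1 / \<gamma> < a"
  then show "\<forall>\<^sub>F x in at_top. W x < a"
    using W_le by (intro always_eventually allI) (meson le_less_trans)
qed

lemma Delta_eq: "Delta W z = 1 / \<gamma> - W z"
  unfolding Delta_def using W_tendsto by (simp add: tendsto_Lim)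

lemma Delta_nonneg: "0 \<le> Delta W z" and Delta_le: "Delta W z \<le> 1 / \<gamma>"
  and Delta_antimono: "x \<le> y \<Longrightarrow> Delta W y \<le> Delta W x"
  using W_le[of z] W_nonneg[of z] monoD[OF mono_W, of x y] by (auto simp: Delta_eq)

lemma measurable_Delta [measurable]: "Delta W \<in> borel_measurable borel"
  unfolding Delta_eq[abs_def] by measurable

lemma nn_laplace_W:
  assumes q: "q > 0"
  shows "(\<integral>\<^sup>+ y. ennreal (exp (- q * y)) * ennreal (W y) \<partial>lborel) = ennreal (1 / \<Psi> q)"
proof -
  have "(\<integral>\<^sup>+ y. ennreal (exp (- q * y)) * ennreal (W y) \<partial>lborel)
      = (\<integral>\<^sup>+ y. ennreal (indicator {0..} y * (exp (- q * y) * W y)) \<partial>lborel)"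
    by (intro nn_integral_cong) (auto simp: indicator_def W_neg ennreal_mult W_nonneg)
  also have "\<dots> = ennreal (1 / \<Psi> q)"
  proof (rule nn_integral_has_integral_lborel)
    show "((\<lambda>y. indicator {0..} y * (exp (- q * y) * W y)) has_integral (1 / \<Psi> q)) UNIV"
      using W_laplace[OF q] by (subst (asm) has_integral_restrict_UNIV[symmetric])
        (simp add: indicator_def of_bool_def if_distrib[of "\<lambda>x. x * _"] cong: if_cong)
  qed (auto simp: W_nonneg)
  finally show ?thesis .
qed

end

section \<open>Markov property\<close>

lemma (in prob_space) indep_var_nn_integral:
  assumes XY: "indep_var S X T Y" and H [measurable]: "H \<in> borel_measurable (S \<Otimes>\<^sub>M T)"
  shows "(\<integral>\<^sup>+ \<omega>. H (X \<omega>, Y \<omega>) \<partial>M) = (\<integral>\<^sup>+ \<omega>. \<integral>\<^sup>+ \<omega>'. H (X \<omega>, Y \<omega>') \<partial>M \<partial>M)"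
proof -
  have [measurable]: "X \<in> measurable M S" "Y \<in> measurable M T"
    and eq: "distr M S X \<Otimes>\<^sub>M distr M T Y = distr M (S \<Otimes>\<^sub>M T) (\<lambda>x. (X x, Y x))"
    using XY unfolding indep_var_distribution_eq by auto
  interpret Y: prob_space "distr M T Y" by (rule prob_space_distr) measurable
  have "(\<integral>\<^sup>+ \<omega>. H (X \<omega>, Y \<omega>) \<partial>M) = (\<integral>\<^sup>+ z. H z \<partial>distr M (S \<Otimes>\<^sub>M T) (\<lambda>x. (X x, Y x)))"
    by (subst nn_integral_distr) auto
  also have "\<dots> = (\<integral>\<^sup>+ x. \<integral>\<^sup>+ y. H (x, y) \<partial>distr M T Y \<partial>distr M S X)"
    unfolding eq[symmetric] by (subst Y.nn_integral_fst[symmetric]) auto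
  also have "\<dots> = (\<integral>\<^sup>+ \<omega>. \<integral>\<^sup>+ \<omega>'. H (X \<omega>, Y \<omega>') \<partial>M \<partial>M)"
    by (simp add: nn_integral_distr cong: nn_integral_cong)
  finally show ?thesis .
qed

text \<open>Floor plus one, not ceiling: the grid point is strictly to the right of \<open>s\<close>
  even when \<open>s\<close> itself lies on the grid, as a limit along \<open>at_right\<close>
  demands.\<close>

lemma floor_grid_tendsto:
  fixes s :: real
  shows "filterlim (\<lambda>n. real_of_int (\<lfloor>real (Suc n) * s\<rfloor> + 1) / real (Suc n)) (at_right s) sequentially"
proof -
  have b: "s < real_of_int (\<lfloor>real (Suc n) * s\<rfloor> + 1) / real (Suc n)"
    "real_of_int (\<lfloor>real (Suc n) * s\<rfloor> + 1) / real (Suc n) \<le> s + 1 / real (Suc n)" for n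
    using floor_correct[of "real (Suc n) * s"] by (simp_all add: less_divide_eq divide_le_eq distrib_left distrib_right mult.commute del: of_nat_Suc)
  have l: "(\<lambda>n. s + 1 / real (Suc n)) \<longlonglongrightarrow> s + 0"
    using LIMSEQ_inverse_real_of_nat by (intro tendsto_intros) (simp add: inverse_eq_divide)
  have "(\<lambda>n. real_of_int (\<lfloor>real (Suc n) * s\<rfloor> + 1) / real (Suc n)) \<longlonglongrightarrow> s"
    by (rule tendsto_sandwich[OF _ _ tendsto_const[of s] l[simplified add_0_right]])
      (use b less_imp_le in \<open>auto intro!: always_eventually\<close>)
  then show ?thesis
    unfolding filterlim_at using b by (auto intro!: always_eventually simp: less_imp_neq[symmetric])
qed

text \<open>The process frozen at the next grid point depends on time through an integer only, so it
  is jointly measurable; right-continuity gives the pointwise limit. The \<open>max 0\<close>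
  extends it to all real times.\<close>

lemma measurable_right_continuous_process:
  fixes \<zeta> :: "real \<Rightarrow> 'a \<Rightarrow> real"
  assumes m: "\<And>t. 0 \<le> t \<Longrightarrow> \<zeta> t \<in> borel_measurable N"
    and rc: "\<And>\<omega> t. \<omega> \<in> space N \<Longrightarrow> 0 \<le> t \<Longrightarrow> continuous (at_right t) (\<lambda>t. \<zeta> t \<omega>)"
  shows "(\<lambda>x. \<zeta> (max 0 (fst x)) (snd x)) \<in> borel_measurable ((borel :: real measure) \<Otimes>\<^sub>M N)"
proof (rule borel_measurable_LIMSEQ_metric)
  let ?g = "\<lambda>n (s :: real). real_of_int (\<lfloor>real (Suc n) * s\<rfloor> + 1) / real (Suc n)"
  fix n
  have "(\<lambda>x :: real \<times> 'a. \<zeta> (max 0 (real_of_int (\<lfloor>real (Suc n) * max 0 (fst x)\<rfloor> + 1) / real (Suc n))) (snd x))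
      \<in> borel_measurable (borel \<Otimes>\<^sub>M N)"
    by (rule measurable_compose_countable[where f="\<lambda>i x. \<zeta> (max 0 (real_of_int (i + 1) / real (Suc n))) (snd x)"
          and g="\<lambda>x :: real \<times> 'a. \<lfloor>real (Suc n) * max 0 (fst x)\<rfloor>"])
      (auto intro!: measurable_compose[OF measurable_snd m])
  then show "(\<lambda>x. \<zeta> (max 0 (?g n (max 0 (fst x)))) (snd x)) \<in> borel_measurable (borel \<Otimes>\<^sub>M N)" .
next
  fix x assume "x \<in> space ((borel :: real measure) \<Otimes>\<^sub>M N)"
  then have x: "snd x \<in> space N" by (auto simp: space_pair_measure)
  let ?s = "max 0 (fst x)"
  have lim: "filterlim (\<lambda>n. real_of_int (\<lfloor>real (Suc n) * ?s\<rfloor> + 1) / real (Suc n)) (at_right ?s) sequentially"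
    by (rule floor_grid_tendsto)
  have "((\<lambda>t. \<zeta> t (snd x)) \<longlongrightarrow> \<zeta> ?s (snd x)) (at_right ?s)"
    using rc[OF x, of ?s] by (simp add: continuous_within)
  from filterlim_compose[OF this lim]
  show "(\<lambda>n. \<zeta> (max 0 (real_of_int (\<lfloor>real (Suc n) * ?s\<rfloor> + 1) / real (Suc n))) (snd x)) \<longlonglongrightarrow> \<zeta> ?s (snd x)"
    by (simp add: max_def)
qed

text \<open>The uniqueness theorem compares two measures, so the occupation measure and W(y) dy have
  to be merged into one.\<close>

definition plus_measure :: "'a measure \<Rightarrow> 'a measure \<Rightarrow> 'a measure" where
  "plus_measure A B = measure_of (space A) (sets A) (\<lambda>X. emeasure A X + emeasure B X)"

lemma sets_plus_measure [simp]: "sets (plus_measure A B) = sets A"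
  and space_plus_measure [simp]: "space (plus_measure A B) = space A"
  by (simp_all add: plus_measure_def)

lemma emeasure_plus_measure:
  assumes "sets A = sets B" "X \<in> sets A"
  shows "emeasure (plus_measure A B) X = emeasure A X + emeasure B X"
proof (rule emeasure_measure_of[OF plus_measure_def])
  show "countably_additive (sets (plus_measure A B)) (\<lambda>X. emeasure A X + emeasure B X)"
    using assms(1) by (auto simp: countably_additive_def suminf_add[symmetric] suminf_emeasure)
qed (use assms sets.sets_into_space in \<open>auto simp: positive_def\<close>)

lemma nn_integral_plus_measure:
  assumes s: "sets A = sets B" and f: "f \<in> borel_measurable A"
  shows "(\<integral>\<^sup>+ x. f x \<partial>plus_measure A B) = (\<integral>\<^sup>+ x. f x \<partial>A) + (\<integral>\<^sup>+ x. f x \<partial>B)"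
  using f
proof (induction f rule: borel_measurable_induct)
  case (cong f g)
  have "integral\<^sup>N A f = integral\<^sup>N A g" "integral\<^sup>N B f = integral\<^sup>N B g"
    "integral\<^sup>N (plus_measure A B) f = integral\<^sup>N (plus_measure A B) g"
    using sets_eq_imp_space_eq[OF s] cong(3) by (auto intro!: nn_integral_cong)
  with cong(4) show ?case by metis
next
  case (set X)
  then show ?case using s by (simp add: emeasure_plus_measure)
next
  case (mult u c)
  moreover have "u \<in> borel_measurable B" "u \<in> borel_measurable (plus_measure A B)"
    using mult s by (simp_all cong: measurable_cong_sets)
  ultimately show ?case by (simp add: nn_integral_cmult distrib_left)
next
  case (add u v)
  moreover have "u \<in> borel_measurable B" "u \<in> borel_measurable (plus_measure A B)"
    "v \<in> borel_measurable B" "v \<in> borel_measurable (plus_measure A B)"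
    using add s by (simp_all cong: measurable_cong_sets)
  ultimately show ?case by (simp add: nn_integral_add algebra_simps)
next
  case (seq U)
  have m: "U i \<in> borel_measurable B" "U i \<in> borel_measurable (plus_measure A B)" for i
    using seq s by (simp_all cong: measurable_cong_sets)
  have inc: "incseq (\<lambda>i. \<integral>\<^sup>+ x. U i x \<partial>D)" for D
    using seq by (auto simp: incseq_def le_fun_def intro!: nn_integral_mono)
  show ?case
    unfolding SUP_apply
    using seq m inc by (simp add: nn_integral_monotone_convergence_SUP ennreal_SUP_add)
qed

context levy_scale
begin

sublocale prob_space M
  using levy_Z by (simp add: spec_pos_levy_def)

lemma measurable_Z [measurable]: "Z t \<in> borel_measurable M"
  and Z_0: "\<omega> \<in> space M \<Longrightarrow> Z 0 \<omega> = 0"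
  and Z_right_cont: "\<omega> \<in> space M \<Longrightarrow> t \<ge> 0 \<Longrightarrow> continuous (at_right t) (\<lambda>t. Z t \<omega>)"
  using levy_Z by (auto simp: spec_pos_levy_def cadlag_def)

lemma measurable_Z_joint [measurable (raw)]:
  assumes "f \<in> borel_measurable N" "g \<in> measurable N M"
  shows "(\<lambda>x. Z (max 0 (f x)) (g x)) \<in> borel_measurable N"
  using measurable_compose[OF measurable_Pair[OF assms] measurable_right_continuous_process[of Z M]]
    Z_right_cont by simp

section \<open>Increments on grids and the Markov property\<close>

lemma stationary:
  assumes "0 \<le> s" "0 \<le> t" and [measurable]: "f \<in> borel_measurable borel"
  shows "(\<integral>\<^sup>+ \<omega>. f (Z (s + t) \<omega> - Z s \<omega>) \<partial>M) = (\<integral>\<^sup>+ \<omega>. f (Z t \<omega>) \<partial>M)"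
proof -
  have "distr M borel (\<lambda>\<omega>. Z (s + t) \<omega> - Z s \<omega>) = distr M borel (Z t)"
    using levy_Z assms by (auto simp: spec_pos_levy_def)
  then have "(\<integral>\<^sup>+ x. f x \<partial>distr M borel (\<lambda>\<omega>. Z (s + t) \<omega> - Z s \<omega>)) = (\<integral>\<^sup>+ x. f x \<partial>distr M borel (Z t))" by simp
  then show ?thesis by (simp add: nn_integral_distr)
qed

text \<open>The past of the grid walk as an extensional function, hence a random element of a finite
  product space, to which independence of blocks of increments applies.\<close>

definition increments :: "real \<Rightarrow> nat \<Rightarrow> 'a \<Rightarrow> nat \<Rightarrow> real" where
  "increments d k \<omega> = (\<lambda>i\<in>{..<k}. Z (d * real (Suc i)) \<omega> - Z (d * real i) \<omega>)"

lemma grid_indep: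
  assumes "0 \<le> d" "0 \<le> r"
  shows "indep_var (PiM {..<k} (\<lambda>_. borel)) (increments d k)
    (PiM {k} (\<lambda>_. borel)) (\<lambda>\<omega>. \<lambda>i\<in>{k}. Z (d * real k + r) \<omega> - Z (d * real k) \<omega>)"
proof -
  \<comment> \<open>\<open>spec_pos_levy\<close> gives independence along one monotone sequence of
    times; this one follows the grid up to index \<open>k\<close> and then makes the single step
    \<open>r\<close>.\<close>
  define t where "t i = (if i \<le> k then d * real i else d * real k + r)" for i
  have "mono t" using assms by (auto simp: mono_def t_def intro!: mult_left_mono add_increasing2)
  moreover have "0 \<le> t 0" by (simp add: t_def)
  ultimately have ind: "indep_vars (\<lambda>_. borel) (\<lambda>i \<omega>. Z (t (Suc i)) \<omega> - Z (t i) \<omega>) {..<Suc k}"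
    using levy_Z unfolding spec_pos_levy_def by blast
  have "indep_var (PiM {..<k} (\<lambda>_. borel)) (\<lambda>\<omega>. \<lambda>i\<in>{..<k}. Z (t (Suc i)) \<omega> - Z (t i) \<omega>)
      (PiM {k} (\<lambda>_. borel)) (\<lambda>\<omega>. \<lambda>i\<in>{k}. Z (t (Suc i)) \<omega> - Z (t i) \<omega>)"
    by (rule indep_var_restrict[OF ind]) auto
  moreover have "(\<lambda>\<omega>. \<lambda>i\<in>{..<k}. Z (t (Suc i)) \<omega> - Z (t i) \<omega>)
      = increments d k"
    by (auto simp: t_def fun_eq_iff restrict_def increments_def)
  moreover have "(\<lambda>\<omega>. \<lambda>i\<in>{k}. Z (t (Suc i)) \<omega> - Z (t i) \<omega>)
      = (\<lambda>\<omega>. \<lambda>i\<in>{k}. Z (d * real k + r) \<omega> - Z (d * real k) \<omega>)"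
    by (auto simp: t_def fun_eq_iff restrict_def)
  ultimately show ?thesis by simp
qed

text \<open>The functional may depend on the whole grid past, as is needed at the first grid visit
  below a level.\<close>

lemma markov_grid:
  assumes "0 \<le> d" "0 \<le> r" and [measurable]: "H \<in> borel_measurable (PiM {..<k} (\<lambda>_. borel) \<Otimes>\<^sub>M borel)"
  shows "(\<integral>\<^sup>+ \<omega>. H (increments d k \<omega>, Z (d * real k + r) \<omega> - Z (d * real k) \<omega>) \<partial>M)
    = (\<integral>\<^sup>+ \<omega>. \<integral>\<^sup>+ \<omega>'. H (increments d k \<omega>, Z r \<omega>') \<partial>M \<partial>M)"
proof -
  have [measurable]: "(increments d k) \<in> measurable M (PiM {..<k} (\<lambda>_. borel))"
    unfolding increments_def by (intro measurable_restrict) auto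
  have "(\<integral>\<^sup>+ \<omega>'. H (increments d k \<omega>, Z (d * real k + r) \<omega>' - Z (d * real k) \<omega>') \<partial>M)
     = (\<integral>\<^sup>+ \<omega>'. H (increments d k \<omega>, Z r \<omega>') \<partial>M)" if "\<omega> \<in> space M" for \<omega>
    using assms that by (intro stationary) (auto intro!: measurable_compose[OF _ assms(3)] measurable_Pair measurable_const simp: space_PiM PiE_def extensional_def increments_def simp del: of_nat_Suc)
  moreover have "(\<lambda>(v, w). H (v, w k)) \<in> borel_measurable (PiM {..<k} (\<lambda>_. borel) \<Otimes>\<^sub>M PiM {k} (\<lambda>_. borel))"
    by measurable
  from indep_var_nn_integral[OF grid_indep[OF assms(1,2)] this]
  have "(\<integral>\<^sup>+ \<omega>. H (increments d k \<omega>, Z (d * real k + r) \<omega> - Z (d * real k) \<omega>) \<partial>M)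
    = (\<integral>\<^sup>+ \<omega>. \<integral>\<^sup>+ \<omega>'. H (increments d k \<omega>, Z (d * real k + r) \<omega>' - Z (d * real k) \<omega>') \<partial>M \<partial>M)"
    by simp
  ultimately show ?thesis
    by (simp cong: nn_integral_cong)
qed

lemma markov:
  assumes "0 \<le> s" "0 \<le> r" and H [measurable]: "H \<in> borel_measurable (borel \<Otimes>\<^sub>M borel)"
  shows "(\<integral>\<^sup>+ \<omega>. H (Z s \<omega>, Z (s + r) \<omega>) \<partial>M) = (\<integral>\<^sup>+ \<omega>. \<integral>\<^sup>+ \<omega>'. H (Z s \<omega>, Z s \<omega> + Z r \<omega>') \<partial>M \<partial>M)"
proof -
  \<comment> \<open>The grid with mesh \<open>s\<close> and one step: its only increment is Z s,
    because Z starts at 0.\<close>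
  have "(\<lambda>(v :: nat \<Rightarrow> real, z). H (v 0, v 0 + z)) \<in> borel_measurable (PiM {..<1} (\<lambda>_. borel) \<Otimes>\<^sub>M (borel :: real measure))"
    unfolding split_beta'
    by (intro measurable_compose[OF _ H] measurable_Pair borel_measurable_add
        measurable_compose[OF measurable_fst measurable_component_singleton] measurable_snd) auto
  from markov_grid[OF assms(1,2) this] show ?thesis
    by (simp add: increments_def Z_0 cong: nn_integral_cong)
qed

section \<open>Laplace transform of the process at all times\<close>

lemma laplace_mult:
  assumes "0 \<le> s" "0 \<le> t"
  shows "(\<integral>\<^sup>+ \<omega>. ennreal (exp (- l * Z (s + t) \<omega>)) \<partial>M)
    = (\<integral>\<^sup>+ \<omega>. ennreal (exp (- l * Z s \<omega>)) \<partial>M) * (\<integral>\<^sup>+ \<omega>. ennreal (exp (- l * Z t \<omega>)) \<partial>M)"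
proof -
  have "(\<integral>\<^sup>+ \<omega>. ennreal (exp (- l * Z (s + t) \<omega>)) \<partial>M)
      = (\<integral>\<^sup>+ \<omega>. \<integral>\<^sup>+ \<omega>'. ennreal (exp (- l * (Z s \<omega> + Z t \<omega>'))) \<partial>M \<partial>M)"
    using markov[OF assms, of "\<lambda>(x, y). ennreal (exp (- l * y))"] by simp
  also have "\<dots> = (\<integral>\<^sup>+ \<omega>. \<integral>\<^sup>+ \<omega>'. ennreal (exp (- l * Z s \<omega>)) * ennreal (exp (- l * Z t \<omega>')) \<partial>M \<partial>M)"
    by (simp add: ennreal_mult[symmetric] exp_add[symmetric] algebra_simps)
  also have "\<dots> = (\<integral>\<^sup>+ \<omega>. ennreal (exp (- l * Z s \<omega>)) \<partial>M) * (\<integral>\<^sup>+ \<omega>. ennreal (exp (- l * Z t \<omega>)) \<partial>M)"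
    by (simp add: nn_integral_cmult nn_integral_multc)
  finally show ?thesis .
qed

text \<open>The formula for rational times and Fatou's lemma along times decreasing to \<open>t\<close> give the upper bound;
  multiplicativity between \<open>0\<close>, \<open>t\<close> and an integer time turns it into an equality.\<close>

lemma laplace_Z:
  assumes l: "0 \<le> l" and t: "0 \<le> t"
  shows "(\<integral>\<^sup>+ \<omega>. ennreal (exp (- l * Z t \<omega>)) \<partial>M) = ennreal (exp (t * \<Psi> l))"
proof -
  define m where "m t = (\<integral>\<^sup>+ \<omega>. ennreal (exp (- l * Z t \<omega>)) \<partial>M)" for t
  have m1: "m 1 = ennreal (exp (\<Psi> l))" using levy_Z l by (auto simp: spec_pos_levy_def m_def)
  have mult: "m (s + t) = m s * m t" if "0 \<le> s" "0 \<le> t" for s t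
    unfolding m_def by (rule laplace_mult[OF that])
  have m0: "m 0 = 1" by (simp add: m_def Z_0 emeasure_space_1 cong: nn_integral_cong)
  have pow: "m (real k * s) = m s ^ k" if "0 \<le> s" for k s
  proof (induction k)
    case (Suc k)
    have "real (Suc k) * s = s + real k * s" by (simp add: algebra_simps)
    then show ?case using mult[of s "real k * s"] Suc that by simp
  qed (simp add: m0)
  have m_nat: "m (real k) = ennreal (exp (real k * \<Psi> l))" for k
    using pow[of 1 k] m1 by (simp add: ennreal_power exp_of_nat_mult)
  have inv: "m (1 / real (Suc n)) = ennreal (exp (\<Psi> l / real (Suc n)))" for n
  proof -
    have p: "m (1 / real (Suc n)) ^ Suc n = ennreal (exp (\<Psi> l))"
      using pow[of "1 / real (Suc n)" "Suc n"] m1 by simp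
    then have "m (1 / real (Suc n)) \<noteq> \<top>" by (auto simp: power_eq_top_ennreal)
    then obtain a where a: "a \<ge> 0" "m (1 / real (Suc n)) = ennreal a" by (metis ennreal_enn2real enn2real_nonneg less_top)
    with p have "a ^ Suc n = exp (\<Psi> l)" by (simp add: ennreal_power del: power_Suc)
    moreover have "exp (\<Psi> l / real (Suc n)) ^ Suc n = exp (\<Psi> l)"
      by (subst exp_of_nat_mult[symmetric]) simp
    ultimately have "a = exp (\<Psi> l / real (Suc n))" using a by (metis exp_ge_zero power_inject_base)
    with a show ?thesis by simp
  qed
  have rat: "m (real k / real (Suc n)) = ennreal (exp (real k / real (Suc n) * \<Psi> l))" for k n
    using pow[of "1 / real (Suc n)" k] unfolding inv
    by (simp add: ennreal_power exp_of_nat_mult[symmetric])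
  have le: "m t \<le> ennreal (exp (t * \<Psi> l))" if t: "t \<ge> 0" for t
  proof -
    define x where "x n = real_of_int (\<lfloor>real (Suc n) * t\<rfloor> + 1) / real (Suc n)" for n
    have xr: "filterlim x (at_right t) sequentially" unfolding x_def[abs_def] by (rule floor_grid_tendsto)
    then have x: "x \<longlonglongrightarrow> t" by (simp add: filterlim_at)
    have x_nat: "\<exists>k. x n = real k / real (Suc n)" for n
      using t by (intro exI[of _ "nat (\<lfloor>real (Suc n) * t\<rfloor> + 1)"]) (simp add: x_def)
    have mx: "m (x n) = ennreal (exp (x n * \<Psi> l))" for n
      using x_nat[of n] rat by metis
    have "m t = (\<integral>\<^sup>+ \<omega>. liminf (\<lambda>n. ennreal (exp (- l * Z (x n) \<omega>))) \<partial>M)"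
      unfolding m_def
    proof (intro nn_integral_cong)
      fix \<omega> assume "\<omega> \<in> space M"
      then have "((\<lambda>t. Z t \<omega>) \<longlongrightarrow> Z t \<omega>) (at_right t)"
        using Z_right_cont t by (simp add: continuous_within)
      from filterlim_compose[OF this xr] have "(\<lambda>n. ennreal (exp (- l * Z (x n) \<omega>))) \<longlonglongrightarrow> ennreal (exp (- l * Z t \<omega>))"
        by (intro tendsto_ennrealI tendsto_intros)
      from lim_imp_Liminf[OF _ this]
      show "ennreal (exp (- l * Z t \<omega>)) = liminf (\<lambda>n. ennreal (exp (- l * Z (x n) \<omega>)))"
        by simp
    qed
    also have "\<dots> \<le> liminf (\<lambda>n. m (x n))"
      unfolding m_def by (rule nn_integral_liminf) auto
    also have "\<dots> = ennreal (exp (t * \<Psi> l))"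
      unfolding mx by (intro lim_imp_Liminf tendsto_intros x) auto
    finally show ?thesis .
  qed
  obtain n where n: "t \<le> real n" using real_arch_simple by blast
  have "ennreal (exp (real n * \<Psi> l)) = m t * m (real n - t)"
    using mult[of t "real n - t"] t n m_nat by simp
  also have "\<dots> \<le> m t * ennreal (exp ((real n - t) * \<Psi> l))"
    using n by (intro mult_left_mono le) auto
  finally have "ennreal (exp (real n * \<Psi> l)) * ennreal (exp (- (real n - t) * \<Psi> l))
      \<le> m t * ennreal (exp ((real n - t) * \<Psi> l)) * ennreal (exp (- (real n - t) * \<Psi> l))"
    by (rule mult_right_mono) simp
  then have "ennreal (exp (t * \<Psi> l)) \<le> m t"
    by (simp add: mult.assoc ennreal_mult[symmetric] exp_add[symmetric] algebra_simps)
  with le[OF t] show ?thesis by (simp add: m_def)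
qed

section \<open>Potential measure\<close>

text \<open>The occupation measure alone has transform (exp(t \<open>\<Psi>\<close>) - 1) /
  \<open>\<Psi>\<close>. Adding W(y) dy, with transform 1 / \<open>\<Psi>\<close>, removes the -1
  and leaves a product of transforms, that is, a convolution.\<close>

lemma occupation_plus_W:
  assumes t: "0 \<le> t" and f [measurable]: "f \<in> borel_measurable borel"
  shows "(\<integral>\<^sup>+ s. indicator {0..t} s * (\<integral>\<^sup>+ \<omega>. f (Z (max 0 s) \<omega>) \<partial>M) \<partial>lborel)
      + (\<integral>\<^sup>+ y. ennreal (W y) * f y \<partial>lborel)
    = (\<integral>\<^sup>+ y. f y * (\<integral>\<^sup>+ \<omega>. ennreal (W (y - Z t \<omega>)) \<partial>M) \<partial>lborel)"
proof -
  \<comment> \<open>\<open>A\<close> is the occupation measure of [0, t], \<open>B\<close> is W(y)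
    dy, and \<open>C\<close> is the law of Z t convolved with \<open>B\<close>.\<close>
  define A where "A = distr (density (lborel \<Otimes>\<^sub>M M) (\<lambda>x. indicator {0..t} (fst x))) borel (\<lambda>x. Z (max 0 (fst x)) (snd x))"
  define B where "B = density lborel (\<lambda>y. ennreal (W y))"
  define C where "C = distr (density (lborel \<Otimes>\<^sub>M M) (\<lambda>x. ennreal (W (fst x)))) borel (\<lambda>x. Z t (snd x) + fst x)"
  interpret L: pair_sigma_finite lborel M ..
  have sets: "sets A = sets borel" "sets B = sets borel" "sets C = sets borel"
    by (simp_all add: A_def B_def C_def)
  have A: "(\<integral>\<^sup>+ y. g y \<partial>A) = (\<integral>\<^sup>+ s. indicator {0..t} s * (\<integral>\<^sup>+ \<omega>. g (Z (max 0 s) \<omega>) \<partial>M) \<partial>lborel)"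
    if [measurable]: "g \<in> borel_measurable borel" for g
    unfolding A_def
    by (subst nn_integral_distr, measurable, subst nn_integral_density, measurable)
      (simp add: nn_integral_fst[symmetric] nn_integral_cmult)
  have B: "(\<integral>\<^sup>+ y. g y \<partial>B) = (\<integral>\<^sup>+ y. ennreal (W y) * g y \<partial>lborel)"
    if [measurable]: "g \<in> borel_measurable borel" for g
    unfolding B_def by (rule nn_integral_density) measurable
  have C: "(\<integral>\<^sup>+ y. g y \<partial>C) = (\<integral>\<^sup>+ \<omega>. \<integral>\<^sup>+ y. ennreal (W y) * g (Z t \<omega> + y) \<partial>lborel \<partial>M)"
    if [measurable]: "g \<in> borel_measurable borel" for g
    unfolding C_def
    by (subst nn_integral_distr, measurable, subst nn_integral_density, measurable)
      (simp add: L.nn_integral_snd[symmetric])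
  have "plus_measure A B = C"
  proof (rule laplace_transform_unique)
    fix l :: real assume l: "0 < l"
    have P: "0 < \<Psi> l" by (rule Psi_pos[OF l])
    have "(\<integral>\<^sup>+ y. ennreal (exp (- l * y)) \<partial>A) = (\<integral>\<^sup>+ s. ennreal (exp (s * \<Psi> l)) * indicator {0..t} s \<partial>lborel)"
      using l laplace_Z[of l] by (subst A) (auto simp: indicator_def intro!: nn_integral_cong)
    also have "\<dots> = ennreal (exp (t * \<Psi> l) / \<Psi> l - exp (0 * \<Psi> l) / \<Psi> l)"
    proof (rule nn_integral_FTC_Icc)
      show "((\<lambda>s. exp (s * \<Psi> l) / \<Psi> l) has_real_derivative exp (s * \<Psi> l)) (at s)" for s
        using P by (auto intro!: derivative_eq_intros)
    qed (use t in auto)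
    finally have "(\<integral>\<^sup>+ y. ennreal (exp (- l * y)) \<partial>A) = ennreal ((exp (t * \<Psi> l) - 1) / \<Psi> l)"
      by (simp add: diff_divide_distrib)
    moreover have "(\<integral>\<^sup>+ y. ennreal (exp (- l * y)) \<partial>B) = ennreal (1 / \<Psi> l)"
      using nn_laplace_W[OF l] by (subst B) (auto simp: mult.commute)
    moreover have "ennreal ((exp (t * \<Psi> l) - 1) / \<Psi> l) + ennreal (1 / \<Psi> l) = ennreal (exp (t * \<Psi> l) * (1 / \<Psi> l))"
      using P t by (subst ennreal_plus[symmetric]) (auto simp: add_divide_distrib[symmetric] intro!: divide_nonneg_nonneg)
    ultimately have AB: "(\<integral>\<^sup>+ y. ennreal (exp (- l * y)) \<partial>plus_measure A B) = ennreal (exp (t * \<Psi> l) * (1 / \<Psi> l))"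
      by (subst nn_integral_plus_measure) (auto simp: sets cong: measurable_cong_sets)
    have "(\<integral>\<^sup>+ y. ennreal (exp (- l * y)) \<partial>C)
        = (\<integral>\<^sup>+ \<omega>. \<integral>\<^sup>+ y. ennreal (exp (- l * Z t \<omega>)) * (ennreal (exp (- l * y)) * ennreal (W y)) \<partial>lborel \<partial>M)"
      by (subst C) (auto simp: ennreal_mult[symmetric] W_nonneg exp_add[symmetric] algebra_simps intro!: nn_integral_cong)
    also have "\<dots> = ennreal (exp (t * \<Psi> l)) * ennreal (1 / \<Psi> l)"
      using l t nn_laplace_W[OF l] laplace_Z[of l t] by (simp add: nn_integral_cmult nn_integral_multc)
    finally have "(\<integral>\<^sup>+ y. ennreal (exp (- l * y)) \<partial>C) = ennreal (exp (t * \<Psi> l) * (1 / \<Psi> l))"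
      using P by (simp add: ennreal_mult[symmetric])
    with AB show "(\<integral>\<^sup>+ y. ennreal (exp (- l * y)) \<partial>plus_measure A B) = (\<integral>\<^sup>+ y. ennreal (exp (- l * y)) \<partial>C)" by simp
    show "(\<integral>\<^sup>+ y. ennreal (exp (- l * y)) \<partial>plus_measure A B) < \<infinity>" unfolding AB by simp
  qed (simp_all add: sets)
  then have "(\<integral>\<^sup>+ y. f y \<partial>A) + (\<integral>\<^sup>+ y. f y \<partial>B) = (\<integral>\<^sup>+ y. f y \<partial>C)"
    by (subst nn_integral_plus_measure[symmetric]) (auto simp: sets cong: measurable_cong_sets)
  also have "(\<integral>\<^sup>+ y. f y \<partial>C) = (\<integral>\<^sup>+ \<omega>. \<integral>\<^sup>+ y. ennreal (W (y - Z t \<omega>)) * f y \<partial>lborel \<partial>M)"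
    unfolding C[OF f]
  proof (rule nn_integral_cong)
    fix \<omega>
    show "(\<integral>\<^sup>+ y. ennreal (W y) * f (Z t \<omega> + y) \<partial>lborel) = (\<integral>\<^sup>+ y. ennreal (W (y - Z t \<omega>)) * f y \<partial>lborel)"
      by (subst (2) nn_integral_real_affine[where c=1 and t="Z t \<omega>"]) auto
  qed
  also have "\<dots> = (\<integral>\<^sup>+ y. \<integral>\<^sup>+ \<omega>. ennreal (W (y - Z t \<omega>)) * f y \<partial>M \<partial>lborel)"
    by (rule L.Fubini') measurable
  also have "\<dots> = (\<integral>\<^sup>+ y. f y * (\<integral>\<^sup>+ \<omega>. ennreal (W (y - Z t \<omega>)) \<partial>M) \<partial>lborel)"
    by (simp add: nn_integral_multc, simp add: mult.commute)
  finally show ?thesis by (simp add: A B)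
qed

text \<open>Chebyshev's inequality for exp(-Z_n / n). Its mean exp(n \<open>\<Psi>\<close> (1/n))
  tends to exp(\<open>\<gamma>\<close>) and its second moment exp(n \<open>\<Psi>\<close> (2/n)) to
  exp(2 \<open>\<gamma>\<close>), so the variance vanishes, whereas Z_n >= K keeps the variable
  below exp(-K/n), which tends to 1.\<close>

lemma drift_to_minus_infinity:
  "(\<lambda>n. measure M {\<omega>\<in>space M. K \<le> Z (real (Suc n)) \<omega>}) \<longlonglongrightarrow> 0"
proof -
  let ?l = "\<lambda>n. 1 / real (Suc n)"
  define m where "m n = exp (real (Suc n) * \<Psi> (?l n))" for n
  define m2 where "m2 n = exp (real (Suc n) * \<Psi> (2 * ?l n))" for n
  have lap: "integrable M (\<lambda>\<omega>. exp (- l * Z t \<omega>))" "expectation (\<lambda>\<omega>. exp (- l * Z t \<omega>)) = exp (t * \<Psi> l)"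
    if "0 \<le> l" "0 \<le> t" for l t
    using laplace_Z[OF that] by (auto intro!: integrableI_nn_integral_finite simp: integral_eq_nn_integral)
  have l1: "(\<lambda>n. real (Suc n) * \<Psi> (?l n)) \<longlonglongrightarrow> \<gamma>"
    using Psi_over_tendsto[OF inverse_Suc_sequence(2,3,1)] by (simp add: mult.commute)
  \<comment> \<open>The index is shifted because 2 / (n + 1) exceeds 1 at n = 0, outside the range
    of \<open>Psi_over_tendsto\<close>.\<close>
  have "(\<lambda>n. \<Psi> (2 * ?l (Suc n)) / (2 * ?l (Suc n))) \<longlonglongrightarrow> \<gamma>"
  proof (rule Psi_over_tendsto)
    have "(\<lambda>n. 2 * ?l (Suc n)) \<longlonglongrightarrow> 2 * 0"
      by (intro tendsto_intros LIMSEQ_Suc[OF inverse_Suc_sequence(1)])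
    then show "(\<lambda>n. 2 * ?l (Suc n)) \<longlonglongrightarrow> 0" by simp
  qed auto
  then have "(\<lambda>n. 2 * (\<Psi> (2 * ?l n) / (2 * ?l n))) \<longlonglongrightarrow> 2 * \<gamma>"
    by (intro tendsto_intros) (rule LIMSEQ_imp_Suc)
  then have l2: "(\<lambda>n. real (Suc n) * \<Psi> (2 * ?l n)) \<longlonglongrightarrow> 2 * \<gamma>" by (simp add: mult.commute)
  have mlim: "m \<longlonglongrightarrow> exp \<gamma>" "m2 \<longlonglongrightarrow> exp (2 * \<gamma>)"
    unfolding m_def[abs_def] m2_def[abs_def] by (intro tendsto_intros l1 l2)+
  have klim: "(\<lambda>n. exp (- K * ?l n)) \<longlonglongrightarrow> exp (- K * 0)" by (intro tendsto_intros inverse_Suc_sequence)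
  \<comment> \<open>Half of the limiting gap between the mean and exp(-K/n).\<close>
  define a where "a = (exp \<gamma> - 1) / 2"
  have a: "a > 0" using gamma_pos by (simp add: a_def)
  have "\<forall>\<^sub>F n in sequentially. m n - exp (- K * ?l n) > a"
  proof (rule order_tendstoD(1))
    show "(\<lambda>n. m n - exp (- K * ?l n)) \<longlonglongrightarrow> exp \<gamma> - exp (- K * 0)" by (intro tendsto_intros mlim klim)
    show "a < exp \<gamma> - exp (- K * 0)" using gamma_pos a by (simp add: a_def field_simps)
  qed
  moreover have "measure M {\<omega>\<in>space M. K \<le> Z (real (Suc n)) \<omega>} \<le> (m2 n - (m n)\<^sup>2) / a\<^sup>2"
    if n: "m n - exp (- K * ?l n) > a" for n
  proof -
    define X where "X \<omega> = exp (- ?l n * Z (real (Suc n)) \<omega>)" for \<omega>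
    have [measurable]: "random_variable borel X" unfolding X_def by measurable
    have X2: "(X \<omega>)\<^sup>2 = exp (- (2 * ?l n) * Z (real (Suc n)) \<omega>)" for \<omega>
      by (simp add: X_def exp_double[symmetric] algebra_simps del: of_nat_Suc)
    have i: "integrable M X" "expectation X = m n" "integrable M (\<lambda>\<omega>. (X \<omega>)\<^sup>2)" "expectation (\<lambda>\<omega>. (X \<omega>)\<^sup>2) = m2 n"
      using lap[of "?l n" "real (Suc n)"] lap[of "2 * ?l n" "real (Suc n)"]
      unfolding X2 m2_def m_def by (simp_all add: X_def[abs_def] del: of_nat_Suc)
    have "measure M {\<omega>\<in>space M. K \<le> Z (real (Suc n)) \<omega>} \<le> measure M {\<omega>\<in>space M. a \<le> \<bar>X \<omega> - expectation X\<bar>}"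
    proof (intro finite_measure_mono subsetI)
      fix \<omega> assume "\<omega> \<in> {\<omega>\<in>space M. K \<le> Z (real (Suc n)) \<omega>}"
      then have w: "\<omega> \<in> space M" "K \<le> Z (real (Suc n)) \<omega>" by auto
      have "X \<omega> \<le> exp (- K * ?l n)"
        using w(2) unfolding X_def by (simp add: divide_right_mono)
      with n w i show "\<omega> \<in> {\<omega>\<in>space M. a \<le> \<bar>X \<omega> - expectation X\<bar>}" by auto
    qed measurable
    also have "\<dots> \<le> variance X / a\<^sup>2" using i by (intro Chebyshev_inequality a) auto
    also have "variance X = m2 n - (m n)\<^sup>2" using variance_eq[OF i(1,3)] unfolding i(2,4) .
    finally show ?thesis .
  qed
  ultimately have "\<forall>\<^sub>F n in sequentially. measure M {\<omega>\<in>space M. K \<le> Z (real (Suc n)) \<omega>} \<le> (m2 n - (m n)\<^sup>2) / a\<^sup>2"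
    by (rule eventually_mono)
  moreover have "(\<lambda>n. (m2 n - (m n)\<^sup>2) / a\<^sup>2) \<longlonglongrightarrow> (exp (2 * \<gamma>) - (exp \<gamma>)\<^sup>2) / a\<^sup>2"
    using a by (intro tendsto_intros mlim) auto
  then have "(\<lambda>n. (m2 n - (m n)\<^sup>2) / a\<^sup>2) \<longlonglongrightarrow> 0" by (simp add: exp_double)
  ultimately show ?thesis
    by (rule tendsto_sandwich[rotated 1, OF _ tendsto_const[of 0]]) (rule always_eventually, simp)
qed

text \<open>W never exceeds its limit 1 / \<open>\<gamma>\<close>. From below, restrict to the event
  y - Z > x for a fixed \<open>x\<close> with W x close to the limit; its probability tends to
  1.\<close>

lemma expectation_W_tendsto:
  "(\<lambda>n. \<integral>\<^sup>+ \<omega>. ennreal (W (y - Z (real (Suc n)) \<omega>)) \<partial>M) \<longlonglongrightarrow> ennreal (1 / \<gamma>)"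
proof (rule order_tendstoI)
  fix c assume c: "ennreal (1 / \<gamma>) < c"
  have "(\<integral>\<^sup>+ \<omega>. ennreal (W (y - Z (real (Suc n)) \<omega>)) \<partial>M) < c" for n
  proof -
    have "(\<integral>\<^sup>+ \<omega>. ennreal (W (y - Z (real (Suc n)) \<omega>)) \<partial>M) \<le> (\<integral>\<^sup>+ \<omega>. ennreal (1 / \<gamma>) \<partial>M)"
      by (intro nn_integral_mono ennreal_leI W_le)
    also have "\<dots> < c" using c by (simp add: emeasure_space_1)
    finally show ?thesis .
  qed
  then show "\<forall>\<^sub>F n in sequentially. (\<integral>\<^sup>+ \<omega>. ennreal (W (y - Z (real (Suc n)) \<omega>)) \<partial>M) < c"
    by (rule always_eventually[OF allI])
next
  fix c assume c: "c < ennreal (1 / \<gamma>)"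
  then obtain c' where c': "c = ennreal c'" "0 \<le> c'" "c' < 1 / \<gamma>"
    by (cases c rule: ennreal_cases) (auto simp: ennreal_less_iff)
  then have "\<forall>\<^sub>F x in at_top. c' < W x" by (intro order_tendstoD(1)[OF W_tendsto])
  then obtain x where x: "c' < W x" by (auto simp: eventually_at_top_linorder)
  define P where "P n = measure M {\<omega>\<in>space M. y - x \<le> Z (real (Suc n)) \<omega>}" for n
  have "(\<lambda>n. W x * (1 - P n)) \<longlonglongrightarrow> W x * (1 - 0)"
    unfolding P_def by (intro tendsto_intros drift_to_minus_infinity)
  then have "\<forall>\<^sub>F n in sequentially. c' < W x * (1 - P n)" using x by (intro order_tendstoD(1)) auto
  then show "\<forall>\<^sub>F n in sequentially. c < (\<integral>\<^sup>+ \<omega>. ennreal (W (y - Z (real (Suc n)) \<omega>)) \<partial>M)"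
  proof eventually_elim
    fix n assume n: "c' < W x * (1 - P n)"
    have "c < ennreal (W x * (1 - P n))" using n c' by (simp add: ennreal_less_iff)
    also have "\<dots> = ennreal (W x) * emeasure M {\<omega>\<in>space M. \<not> (y - x \<le> Z (real (Suc n)) \<omega>)}"
      by (simp add: P_def emeasure_eq_measure prob_neg ennreal_mult W_nonneg)
    also have "\<dots> = (\<integral>\<^sup>+ \<omega>. ennreal (W x) * indicator {\<omega>\<in>space M. \<not> (y - x \<le> Z (real (Suc n)) \<omega>)} \<omega> \<partial>M)"
      by (subst nn_integral_cmult_indicator) auto
    also have "\<dots> \<le> (\<integral>\<^sup>+ \<omega>. ennreal (W (y - Z (real (Suc n)) \<omega>)) \<partial>M)"
      by (intro nn_integral_mono) (auto simp: indicator_def intro!: ennreal_leI monoD[OF mono_W])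
    finally show "c < (\<integral>\<^sup>+ \<omega>. ennreal (W (y - Z (real (Suc n)) \<omega>)) \<partial>M)" .
  qed
qed

text \<open>The limit t -> infinity in \<open>occupation_plus_W\<close>: the right side tends to the
  integral of f / \<open>\<gamma>\<close>. The integral of W f is then cancelled, which is
  legitimate because \<open>fin\<close> makes it finite.\<close>

lemma potential_density:
  assumes f [measurable]: "f \<in> borel_measurable borel" and fin: "(\<integral>\<^sup>+ y. f y \<partial>lborel) < \<infinity>"
  shows "(\<integral>\<^sup>+ s. indicator {0..} s * (\<integral>\<^sup>+ \<omega>. f (x + Z (max 0 s) \<omega>) \<partial>M) \<partial>lborel)
    = (\<integral>\<^sup>+ y. f y * ennreal (Delta W (y - x)) \<partial>lborel)"
proof -
  define g where "g y = f (x + y)" for y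
  have [measurable]: "g \<in> borel_measurable borel" unfolding g_def by measurable
  have gi: "(\<integral>\<^sup>+ y. g y * h y \<partial>lborel) = (\<integral>\<^sup>+ y. f y * h (y - x) \<partial>lborel)"
    if [measurable]: "h \<in> borel_measurable borel" for h
    by (subst (2) nn_integral_real_affine[where c=1 and t=x]) (auto simp: g_def)
  have gfin: "(\<integral>\<^sup>+ y. g y \<partial>lborel) < \<infinity>" using gi[of "\<lambda>_. 1"] fin by simp
  define I where "I s = (\<integral>\<^sup>+ \<omega>. g (Z (max 0 s) \<omega>) \<partial>M)" for s
  have [measurable]: "I \<in> borel_measurable borel" unfolding I_def by measurable
  define w where "w = (\<integral>\<^sup>+ y. ennreal (W y) * g y \<partial>lborel)"
  have wfin: "w < \<infinity>"
  proof -
    have "w \<le> (\<integral>\<^sup>+ y. ennreal (1 / \<gamma>) * g y \<partial>lborel)"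
      unfolding w_def by (intro nn_integral_mono mult_right_mono ennreal_leI W_le) auto
    also have "\<dots> < \<infinity>" using gfin by (simp add: nn_integral_cmult ennreal_mult_less_top)
    finally show ?thesis .
  qed
  define v where "v n y = (\<integral>\<^sup>+ \<omega>. ennreal (W (y - Z (real (Suc n)) \<omega>)) \<partial>M)" for n y
  have [measurable]: "v n \<in> borel_measurable borel" for n unfolding v_def by measurable
  have id: "(\<integral>\<^sup>+ s. indicator {0..real (Suc n)} s * I s \<partial>lborel) + w = (\<integral>\<^sup>+ y. g y * v n y \<partial>lborel)" for n
    using occupation_plus_W[of "real (Suc n)" g] by (simp add: I_def w_def v_def)
  have v_le: "v n y \<le> ennreal (1 / \<gamma>)" for n y
  proof -
    have "v n y \<le> (\<integral>\<^sup>+ \<omega>. ennreal (1 / \<gamma>) \<partial>M)"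
      unfolding v_def by (intro nn_integral_mono ennreal_leI W_le)
    then show ?thesis by (simp add: emeasure_space_1)
  qed
  have sup: "(\<integral>\<^sup>+ s. indicator {0..} s * I s \<partial>lborel)
      = (SUP n. \<integral>\<^sup>+ s. indicator {0..real (Suc n)} s * I s \<partial>lborel)"
  proof -
    have "(SUP n. indicator {0..real (Suc n)} s * I s) = indicator {0..} s * I s" for s
    proof (cases "s \<ge> 0")
      case True
      obtain k where k: "s \<le> real k" using real_arch_simple by blast
      show ?thesis
      proof (rule antisym)
        show "(SUP n. indicator {0..real (Suc n)} s * I s) \<le> indicator {0..} s * I s"
          by (intro SUP_least) (auto simp: indicator_def)
        show "indicator {0..} s * I s \<le> (SUP n. indicator {0..real (Suc n)} s * I s)"
          using True k by (intro SUP_upper2[of k]) (auto simp: indicator_def)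
      qed
    qed (auto simp: indicator_def)
    then have "(\<integral>\<^sup>+ s. indicator {0..} s * I s \<partial>lborel) = (\<integral>\<^sup>+ s. (SUP n. indicator {0..real (Suc n)} s * I s) \<partial>lborel)" by simp
    also have "\<dots> = (SUP n. \<integral>\<^sup>+ s. indicator {0..real (Suc n)} s * I s \<partial>lborel)"
      by (intro nn_integral_monotone_convergence_SUP) (auto simp: incseq_def le_fun_def indicator_def)
    finally show ?thesis .
  qed
  have "(\<integral>\<^sup>+ s. indicator {0..} s * I s \<partial>lborel) + w = (SUP n. \<integral>\<^sup>+ y. g y * v n y \<partial>lborel)"
    unfolding sup id[symmetric] by (rule ennreal_SUP_add_left[symmetric]) auto
  also have "\<dots> = (\<integral>\<^sup>+ y. g y * ennreal (1 / \<gamma>) \<partial>lborel)"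
  proof (rule antisym)
    show "(SUP n. \<integral>\<^sup>+ y. g y * v n y \<partial>lborel) \<le> (\<integral>\<^sup>+ y. g y * ennreal (1 / \<gamma>) \<partial>lborel)"
      by (intro SUP_least nn_integral_mono mult_left_mono v_le) auto
    have "(\<integral>\<^sup>+ y. g y * ennreal (1 / \<gamma>) \<partial>lborel) \<le> (\<integral>\<^sup>+ y. liminf (\<lambda>n. g y * v n y) \<partial>lborel)"
    proof (intro nn_integral_mono)
      fix y
      have "(\<lambda>n. g y * v n y) \<longlonglongrightarrow> g y * ennreal (1 / \<gamma>)"
        unfolding v_def using gamma_pos by (intro tendsto_mult_ennreal expectation_W_tendsto tendsto_const) auto
      from lim_imp_Liminf[OF _ this] show "g y * ennreal (1 / \<gamma>) \<le> liminf (\<lambda>n. g y * v n y)" by simp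
    qed
    also have "\<dots> \<le> liminf (\<lambda>n. \<integral>\<^sup>+ y. g y * v n y \<partial>lborel)" by (rule nn_integral_liminf) auto
    also have "\<dots> \<le> (SUP n. \<integral>\<^sup>+ y. g y * v n y \<partial>lborel)"
    proof -
      have "liminf (\<lambda>n. \<integral>\<^sup>+ y. g y * v n y \<partial>lborel) \<le> liminf (\<lambda>_::nat. SUP n. \<integral>\<^sup>+ y. g y * v n y \<partial>lborel)"
        by (intro Liminf_mono always_eventually allI SUP_upper UNIV_I)
      then show ?thesis by (simp add: Liminf_const)
    qed
    finally show "(\<integral>\<^sup>+ y. g y * ennreal (1 / \<gamma>) \<partial>lborel) \<le> (SUP n. \<integral>\<^sup>+ y. g y * v n y \<partial>lborel)" .
  qed
  also have "\<dots> = (\<integral>\<^sup>+ y. g y * ennreal (Delta W y) + ennreal (W y) * g y \<partial>lborel)"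
  proof (intro nn_integral_cong)
    fix y
    have "ennreal (1 / \<gamma>) = ennreal (Delta W y) + ennreal (W y)"
      using Delta_nonneg[of y] W_nonneg[of y] by (subst ennreal_plus[symmetric]) (auto simp: Delta_eq)
    then show "g y * ennreal (1 / \<gamma>) = g y * ennreal (Delta W y) + ennreal (W y) * g y"
      by (simp add: distrib_left mult.commute)
  qed
  also have "\<dots> = (\<integral>\<^sup>+ y. g y * ennreal (Delta W y) \<partial>lborel) + w"
    unfolding w_def by (rule nn_integral_add) auto
  finally have "(\<integral>\<^sup>+ s. indicator {0..} s * I s \<partial>lborel) = (\<integral>\<^sup>+ y. g y * ennreal (Delta W y) \<partial>lborel)"
    using wfin by (auto simp: add.commute[of _ w] ennreal_add_left_cancel)
  then show ?thesis
    using gi[of "\<lambda>y. ennreal (Delta W y)"] by (simp add: I_def g_def)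
qed

end

section \<open>Occupation times\<close>

lemma right_continuous_less_nbhd:
  fixes y :: "real \<Rightarrow> 'c::linorder_topology"
  assumes "continuous (at_right u) y" "y u < b"
  obtains e where "e > u" "\<And>v. u \<le> v \<Longrightarrow> v < e \<Longrightarrow> y v < b"
proof -
  have "\<forall>\<^sub>F v in at_right u. y v < b"
    using assms by (intro order_tendstoD(2)) (auto simp: continuous_within)
  then obtain e where "e > u" "\<And>v. u < v \<Longrightarrow> v < e \<Longrightarrow> y v < b"
    by (auto simp: eventually_at_right[of u "u + 1"])
  then show thesis using that[of e] assms(2) by (metis order_le_less)
qed

text \<open>A value below \<open>b\<close> at \<open>u\<close> persists on a right neighbourhood of
  \<open>u\<close>. Since u < s is strict, this contains a rational time still before
  \<open>s\<close>.\<close>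

lemma right_continuous_all_ge_iff_rat:
  fixes y :: "real \<Rightarrow> 'c::linorder_topology"
  assumes rc: "\<And>t. 0 \<le> t \<Longrightarrow> continuous (at_right t) y"
  shows "(\<forall>u\<ge>0. u < s \<longrightarrow> b \<le> y u) \<longleftrightarrow> (\<forall>q::rat. 0 \<le> (of_rat q :: real) \<longrightarrow> of_rat q < s \<longrightarrow> b \<le> y (of_rat q))"
proof (intro iffI allI impI)
  fix u :: real
  assume q: "\<forall>q::rat. 0 \<le> (of_rat q :: real) \<longrightarrow> of_rat q < s \<longrightarrow> b \<le> y (of_rat q)" and u: "0 \<le> u" "u < s"
  show "b \<le> y u"
  proof (rule ccontr)
    assume "\<not> b \<le> y u"
    then obtain e where e: "e > u" "\<And>v. u \<le> v \<Longrightarrow> v < e \<Longrightarrow> y v < b"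
      using right_continuous_less_nbhd[OF rc[OF u(1)], of b] by (metis not_le)
    obtain p where p: "u < of_rat p" "of_rat p < min e s" using of_rat_dense[of u "min e s"] e(1) u by auto
    have "0 \<le> (of_rat p :: real)" using p u by linarith
    from q[rule_format, OF this] e(2)[of "of_rat p"] p u show False by auto
  qed
qed auto

context levy_scale
begin

text \<open>Given by its density, so that it makes sense for every \<open>f\<close>;
  \<open>potential_density\<close> identifies it with a mean occupation time when \<open>f\<close>
  has finite integral.\<close>

definition potential :: "(real \<Rightarrow> ennreal) \<Rightarrow> real \<Rightarrow> ennreal" where
  "potential f x = (\<integral>\<^sup>+ y. f y * ennreal (Delta W (y - x)) \<partial>lborel)"

definition occ :: "(real \<Rightarrow> ennreal) \<Rightarrow> real \<Rightarrow> 'a \<Rightarrow> ennreal" where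
  "occ f x \<omega> = (\<integral>\<^sup>+ s. indicator {0..} s * f (x + Z (max 0 s) \<omega>) \<partial>lborel)"

definition above :: "real \<Rightarrow> real \<Rightarrow> 'a \<Rightarrow> real \<Rightarrow> bool" where
  "above b x \<omega> s \<longleftrightarrow> (\<forall>u\<ge>0. u < s \<longrightarrow> b \<le> x + Z u \<omega>)"

definition killed_occ :: "(real \<Rightarrow> ennreal) \<Rightarrow> real \<Rightarrow> real \<Rightarrow> 'a \<Rightarrow> ennreal" where
  "killed_occ f b x \<omega> = (\<integral>\<^sup>+ s. indicator {s. 0 \<le> s \<and> above b x \<omega> s} s * f (x + Z (max 0 s) \<omega>) \<partial>lborel)"

lemma measurable_potential [measurable]:
  assumes [measurable]: "f \<in> borel_measurable borel"
  shows "potential f \<in> borel_measurable borel"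
  unfolding potential_def by measurable

lemma potential_le:
  assumes [measurable]: "f \<in> borel_measurable borel"
  shows "potential f x \<le> ennreal (1 / \<gamma>) * (\<integral>\<^sup>+ y. f y \<partial>lborel)"
  unfolding potential_def by (subst nn_integral_cmult[symmetric])
    (auto intro!: nn_integral_mono mult_left_mono ennreal_leI Delta_le simp: mult.commute[of "ennreal (1 / \<gamma>)"])

lemma expectation_occ:
  assumes [measurable]: "f \<in> borel_measurable borel" and "(\<integral>\<^sup>+ y. f y \<partial>lborel) < \<infinity>"
  shows "(\<integral>\<^sup>+ \<omega>. occ f x \<omega> \<partial>M) = potential f x"
proof -
  interpret L: pair_sigma_finite lborel M ..
  have "(\<integral>\<^sup>+ \<omega>. occ f x \<omega> \<partial>M) = (\<integral>\<^sup>+ s. \<integral>\<^sup>+ \<omega>. indicator {0..} s * f (x + Z (max 0 s) \<omega>) \<partial>M \<partial>lborel)"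
    unfolding occ_def by (rule L.Fubini') measurable
  also have "\<dots> = potential f x"
    unfolding potential_def potential_density[OF assms, symmetric] by (simp add: nn_integral_cmult)
  finally show ?thesis .
qed

text \<open>Write the square as a double integral and split it along the diagonal; by symmetry both
  halves agree, and the substitution r = s + u gives the ordered form.\<close>

lemma nn_integral_square_le:
  assumes [measurable]: "F \<in> borel_measurable borel" and F0: "\<And>s. s < 0 \<Longrightarrow> F s = 0"
  shows "(\<integral>\<^sup>+ s. F s \<partial>lborel)\<^sup>2 \<le> 2 * (\<integral>\<^sup>+ s. \<integral>\<^sup>+ u. F s * (indicator {0..} u * F (s + u)) \<partial>lborel \<partial>(lborel :: real measure))"
proof -
  have "(\<integral>\<^sup>+ s. F s \<partial>lborel)\<^sup>2 = (\<integral>\<^sup>+ s. \<integral>\<^sup>+ r. F s * F r \<partial>lborel \<partial>lborel)"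
    by (simp add: power2_eq_square nn_integral_cmult nn_integral_multc)
  also have "\<dots> \<le> (\<integral>\<^sup>+ s. \<integral>\<^sup>+ r. (if s \<le> r then F s * F r else 0) + (if r \<le> s then F s * F r else 0) \<partial>lborel \<partial>lborel)"
    by (intro nn_integral_mono) auto
  also have "\<dots> = (\<integral>\<^sup>+ s. \<integral>\<^sup>+ r. (if s \<le> r then F s * F r else 0) \<partial>lborel \<partial>lborel)
     + (\<integral>\<^sup>+ s. \<integral>\<^sup>+ r. (if r \<le> s then F s * F r else 0) \<partial>lborel \<partial>lborel)"
    by (simp add: nn_integral_add)
  also have "(\<integral>\<^sup>+ s. \<integral>\<^sup>+ r. (if r \<le> s then F s * F r else 0) \<partial>lborel \<partial>lborel)
     = (\<integral>\<^sup>+ r. \<integral>\<^sup>+ s. (if r \<le> s then F s * F r else 0) \<partial>lborel \<partial>lborel)"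
    by (rule lborel_pair.Fubini') measurable
  also have "\<dots> = (\<integral>\<^sup>+ s. \<integral>\<^sup>+ r. (if s \<le> r then F s * F r else 0) \<partial>lborel \<partial>lborel)"
    by (intro nn_integral_cong) (simp add: mult.commute)
  also have "(\<integral>\<^sup>+ s. \<integral>\<^sup>+ r. (if s \<le> r then F s * F r else 0) \<partial>lborel \<partial>lborel)
     = (\<integral>\<^sup>+ s. \<integral>\<^sup>+ u. F s * (indicator {0..} u * F (s + u)) \<partial>lborel \<partial>lborel)"
  proof (rule nn_integral_cong)
    fix s
    show "(\<integral>\<^sup>+ r. (if s \<le> r then F s * F r else 0) \<partial>lborel) = (\<integral>\<^sup>+ u. F s * (indicator {0..} u * F (s + u)) \<partial>lborel)"
      by (subst nn_integral_real_affine[where c=1 and t=s]) (auto simp: indicator_def intro!: nn_integral_cong)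
  qed
  finally show ?thesis by (simp add: mult_2)
qed

lemma measurable_occ [measurable]:
  assumes [measurable]: "f \<in> borel_measurable borel"
  shows "(\<lambda>p. occ f (fst p) (snd p)) \<in> borel_measurable (borel \<Otimes>\<^sub>M M)" "occ f x \<in> borel_measurable M"
  unfolding occ_def by measurable

text \<open>Kac's moment formula: once the two times are ordered, the Markov property at the earlier
  one turns the integral over the later one into \<open>potential f\<close>.\<close>

lemma occ_second_moment:
  assumes [measurable]: "f \<in> borel_measurable borel" and fin: "(\<integral>\<^sup>+ y. f y \<partial>lborel) < \<infinity>"
  shows "(\<integral>\<^sup>+ \<omega>. (occ f x \<omega>)\<^sup>2 \<partial>M) \<le> 2 * potential (\<lambda>y. f y * potential f y) x"
proof -
  interpret L: pair_sigma_finite lborel M ..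
  let ?F = "\<lambda>\<omega> s. indicator {0..} s * f (x + Z (max 0 s) \<omega>)"
  have "(\<integral>\<^sup>+ \<omega>. (occ f x \<omega>)\<^sup>2 \<partial>M)
      \<le> (\<integral>\<^sup>+ \<omega>. 2 * (\<integral>\<^sup>+ s. \<integral>\<^sup>+ u. ?F \<omega> s * (indicator {0..} u * ?F \<omega> (s + u)) \<partial>lborel \<partial>lborel) \<partial>M)"
    unfolding occ_def by (intro nn_integral_mono nn_integral_square_le) auto
  also have "\<dots> = 2 * (\<integral>\<^sup>+ \<omega>. (\<integral>\<^sup>+ s. \<integral>\<^sup>+ u. ?F \<omega> s * (indicator {0..} u * ?F \<omega> (s + u)) \<partial>lborel \<partial>lborel) \<partial>M)"
    by (rule nn_integral_cmult) measurable
  also have "(\<integral>\<^sup>+ \<omega>. (\<integral>\<^sup>+ s. \<integral>\<^sup>+ u. ?F \<omega> s * (indicator {0..} u * ?F \<omega> (s + u)) \<partial>lborel \<partial>lborel) \<partial>M)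
    = (\<integral>\<^sup>+ s. \<integral>\<^sup>+ \<omega>. \<integral>\<^sup>+ u. ?F \<omega> s * (indicator {0..} u * ?F \<omega> (s + u)) \<partial>lborel \<partial>M \<partial>lborel)"
    by (rule L.Fubini') measurable
  also have "\<dots> = (\<integral>\<^sup>+ s. \<integral>\<^sup>+ u. \<integral>\<^sup>+ \<omega>. ?F \<omega> s * (indicator {0..} u * ?F \<omega> (s + u)) \<partial>M \<partial>lborel \<partial>lborel)"
    by (intro nn_integral_cong L.Fubini') measurable
  \<comment> \<open>\<open>markov\<close> works at fixed \<open>s\<close> and \<open>u\<close>, so
    the expectation has to be innermost here; it is moved out again before \<open>u\<close> is
    integrated.\<close>
  also have "\<dots> = (\<integral>\<^sup>+ s. \<integral>\<^sup>+ u. \<integral>\<^sup>+ \<omega>. ?F \<omega> s * (indicator {0..} u * (\<integral>\<^sup>+ \<omega>'. f (x + Z (max 0 s) \<omega> + Z (max 0 u) \<omega>') \<partial>M)) \<partial>M \<partial>lborel \<partial>lborel)"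
  proof (rule nn_integral_cong, rule nn_integral_cong)
    fix s u :: real
    show "(\<integral>\<^sup>+ \<omega>. ?F \<omega> s * (indicator {0..} u * ?F \<omega> (s + u)) \<partial>M)
      = (\<integral>\<^sup>+ \<omega>. ?F \<omega> s * (indicator {0..} u * (\<integral>\<^sup>+ \<omega>'. f (x + Z (max 0 s) \<omega> + Z (max 0 u) \<omega>') \<partial>M)) \<partial>M)"
    proof (cases "0 \<le> s \<and> 0 \<le> u")
      case True
      then show ?thesis
        using markov[of s u "\<lambda>(a, b). f (x + a) * f (x + b)"] by (simp add: nn_integral_cmult add.assoc)
    qed (auto simp: indicator_def)
  qed
  also have "\<dots> = (\<integral>\<^sup>+ s. \<integral>\<^sup>+ \<omega>. \<integral>\<^sup>+ u. ?F \<omega> s * (indicator {0..} u * (\<integral>\<^sup>+ \<omega>'. f (x + Z (max 0 s) \<omega> + Z (max 0 u) \<omega>') \<partial>M)) \<partial>lborel \<partial>M \<partial>lborel)"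
    by (intro nn_integral_cong L.Fubini'[symmetric]) measurable
  also have "\<dots> = (\<integral>\<^sup>+ s. \<integral>\<^sup>+ \<omega>. ?F \<omega> s * potential f (x + Z (max 0 s) \<omega>) \<partial>M \<partial>lborel)"
    unfolding potential_def potential_density[OF assms, symmetric] by (simp add: nn_integral_cmult)
  also have "\<dots> = (\<integral>\<^sup>+ s. indicator {0..} s * (\<integral>\<^sup>+ \<omega>. f (x + Z (max 0 s) \<omega>) * potential f (x + Z (max 0 s) \<omega>) \<partial>M) \<partial>lborel)"
    by (simp add: nn_integral_cmult mult.assoc)
  also have "\<dots> = potential (\<lambda>y. f y * potential f y) x"
    unfolding potential_def[of "\<lambda>y. f y * potential f y"]
  proof (rule potential_density[where f="\<lambda>y. f y * potential f y"])
    have "(\<integral>\<^sup>+ y. f y * potential f y \<partial>lborel) \<le> (\<integral>\<^sup>+ y. f y * (ennreal (1 / \<gamma>) * (\<integral>\<^sup>+ y. f y \<partial>lborel)) \<partial>lborel)"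
      by (intro nn_integral_mono mult_left_mono potential_le) auto
    also have "\<dots> < \<infinity>" using fin by (simp add: nn_integral_multc ennreal_mult_less_top)
    finally show "(\<integral>\<^sup>+ y. f y * potential f y \<partial>lborel) < \<infinity>" .
  qed measurable
  finally show ?thesis .
qed

section \<open>Occupation before the first passage below a level\<close>

lemma above_iff_rat:
  assumes "\<omega> \<in> space M"
  shows "above b x \<omega> s \<longleftrightarrow> (\<forall>q::rat. 0 \<le> (of_rat q :: real) \<longrightarrow> of_rat q < s \<longrightarrow> b \<le> x + Z (of_rat q) \<omega>)"
  unfolding above_def
  by (rule right_continuous_all_ge_iff_rat) (intro continuous_intros Z_right_cont assms)

lemma measurable_above [measurable (raw)]:
  assumes f [measurable]: "f \<in> borel_measurable N" and g [measurable]: "g \<in> measurable N M" and h [measurable]: "h \<in> borel_measurable N"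
  shows "Measurable.pred N (\<lambda>p. above b (h p) (g p) (f p))"
proof -
  have "Measurable.pred N (\<lambda>p. \<forall>q::rat. 0 \<le> (of_rat q :: real) \<longrightarrow> of_rat q < f p \<longrightarrow> b \<le> h p + Z (of_rat q) (g p))"
    by measurable
  then show ?thesis
    by (rule measurable_cong[THEN iffD1, rotated]) (simp add: above_iff_rat measurable_space[OF g])
qed

lemma measurable_killed_occ [measurable]:
  assumes [measurable]: "f \<in> borel_measurable borel"
  shows "(\<lambda>p. killed_occ f b (fst p) (snd p)) \<in> borel_measurable (borel \<Otimes>\<^sub>M M)" "killed_occ f b x \<in> borel_measurable M"
  unfolding killed_occ_def indicator_def mem_Collect_eq by measurable

lemma killed_occ_le: "killed_occ f b x \<omega> \<le> occ f x \<omega>"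
  unfolding killed_occ_def occ_def by (intro nn_integral_mono) (auto simp: indicator_def)

text \<open>Lowering the start enlarges y - x and \<open>Delta W\<close> is antitone. This absorbs
  the overshoot below \<open>b\<close> that occurs when the path is watched on a grid only.\<close>

lemma potential_antimono_start: "x \<le> b \<Longrightarrow> potential f x \<le> potential f b"
  unfolding potential_def by (intro nn_integral_mono mult_left_mono ennreal_leI Delta_antimono) auto

text \<open>\<open>E k\<close> makes index \<open>k\<close> the first grid visit below
  \<open>b\<close>. It depends on the increments before time d k only, so \<open>markov_grid\<close>
  leaves the potential at a point below \<open>b\<close>.\<close>

lemma first_grid_passage:
  fixes x b d :: real
  assumes d: "0 < d" and f [measurable]: "f \<in> borel_measurable borel" and fin: "(\<integral>\<^sup>+ y. f y \<partial>lborel) < \<infinity>"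
  defines "E \<equiv> \<lambda>k \<omega>. (\<forall>j<k. b \<le> x + Z (d * real j) \<omega>) \<and> x + Z (d * real k) \<omega> < b"
  shows "(\<integral>\<^sup>+ \<omega>. \<integral>\<^sup>+ s. of_bool (E k \<omega>) * (indicator {d * real k..} s * f (x + Z (max 0 s) \<omega>)) \<partial>lborel \<partial>M)
    \<le> potential f b * emeasure M {\<omega>\<in>space M. E k \<omega>}"
proof -
  interpret L: pair_sigma_finite lborel M ..
  have [measurable]: "Measurable.pred M (E k)" unfolding E_def by measurable
  have part [measurable]: "(\<lambda>v. \<Sum>i<j. v i) \<in> borel_measurable (PiM {..<k} (\<lambda>_. borel :: real measure))" if "j \<le> k" for j
    using that by (intro borel_measurable_sum measurable_component_singleton) auto
  \<comment> \<open>The event and the position at time d k are rewritten in terms of the past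
    increments \<open>v\<close>, which telescope because Z starts at 0; \<open>z\<close> is the
    increment after d k.\<close>
  define H where "H r = (\<lambda>(v, z). of_bool ((\<forall>j<k. b \<le> x + (\<Sum>i<j. v i)) \<and> x + (\<Sum>i<k. v i) < b) * f (x + (\<Sum>i<k. v i) + z))" for r :: real
  have Hm: "H r \<in> borel_measurable (PiM {..<k} (\<lambda>_. borel) \<Otimes>\<^sub>M borel)" for r
  proof -
    have [measurable]: "(\<lambda>p. \<Sum>i<j. fst p i) \<in> borel_measurable (PiM {..<k} (\<lambda>_. borel :: real measure) \<Otimes>\<^sub>M (borel :: real measure))" if "j \<le> k" for j
      by (rule measurable_compose[OF measurable_fst part[OF that]])
    have [measurable]: "Measurable.pred (PiM {..<k} (\<lambda>_. borel :: real measure) \<Otimes>\<^sub>M (borel :: real measure)) (\<lambda>p. \<forall>j\<in>{..<k}. b \<le> x + (\<Sum>i<j. fst p i))"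
      by (rule pred_intros_finite) auto
    show ?thesis unfolding H_def split_beta' of_bool_def by (simp only: lessThan_iff[symmetric] Ball_def[symmetric]) measurable
  qed
  have tele: "(\<Sum>i<j. increments d k \<omega> i) = Z (d * real j) \<omega>"
    if "j \<le> k" "\<omega> \<in> space M" for j \<omega>
  proof -
    have "(\<Sum>i<j. increments d k \<omega> i) = (\<Sum>i<j. Z (d * real (Suc i)) \<omega> - Z (d * real i) \<omega>)"
      using that by (intro sum.cong) (auto simp: increments_def)
    also have "\<dots> = Z (d * real j) \<omega>"
      using sum_lessThan_telescope[of "\<lambda>i. Z (d * real i) \<omega>" j] that by (simp add: Z_0)
    finally show ?thesis .
  qed
  have mk: "(\<integral>\<^sup>+ \<omega>. of_bool (E k \<omega>) * f (x + Z (d * real k + r) \<omega>) \<partial>M)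
      = (\<integral>\<^sup>+ \<omega>. of_bool (E k \<omega>) * (\<integral>\<^sup>+ \<omega>'. f (x + Z (d * real k) \<omega> + Z r \<omega>') \<partial>M) \<partial>M)" if r: "0 \<le> r" for r
  proof -
    have "(\<integral>\<^sup>+ \<omega>. of_bool (E k \<omega>) * f (x + Z (d * real k + r) \<omega>) \<partial>M)
      = (\<integral>\<^sup>+ \<omega>. H r (increments d k \<omega>, Z (d * real k + r) \<omega> - Z (d * real k) \<omega>) \<partial>M)"
      by (intro nn_integral_cong) (simp add: H_def tele E_def)
    also have "\<dots> = (\<integral>\<^sup>+ \<omega>. \<integral>\<^sup>+ \<omega>'. H r (increments d k \<omega>, Z r \<omega>') \<partial>M \<partial>M)"
      using d r by (intro markov_grid Hm) auto
    also have "\<dots> = (\<integral>\<^sup>+ \<omega>. of_bool (E k \<omega>) * (\<integral>\<^sup>+ \<omega>'. f (x + Z (d * real k) \<omega> + Z r \<omega>') \<partial>M) \<partial>M)"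
      by (intro nn_integral_cong) (simp add: H_def tele E_def nn_integral_cmult)
    finally show ?thesis .
  qed
  have "(\<integral>\<^sup>+ \<omega>. \<integral>\<^sup>+ s. of_bool (E k \<omega>) * (indicator {d * real k..} s * f (x + Z (max 0 s) \<omega>)) \<partial>lborel \<partial>M)
    = (\<integral>\<^sup>+ \<omega>. \<integral>\<^sup>+ r. of_bool (E k \<omega>) * (indicator {0..} r * f (x + Z (max 0 (d * real k + r)) \<omega>)) \<partial>lborel \<partial>M)"
  proof (rule nn_integral_cong)
    fix \<omega> assume [measurable]: "\<omega> \<in> space M"
    show "(\<integral>\<^sup>+ s. of_bool (E k \<omega>) * (indicator {d * real k..} s * f (x + Z (max 0 s) \<omega>)) \<partial>lborel)
      = (\<integral>\<^sup>+ r. of_bool (E k \<omega>) * (indicator {0..} r * f (x + Z (max 0 (d * real k + r)) \<omega>)) \<partial>lborel)"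
      by (subst nn_integral_real_affine[where c=1 and t="d * real k"]) (auto simp: indicator_def intro!: nn_integral_cong)
  qed
  also have "\<dots> = (\<integral>\<^sup>+ r. \<integral>\<^sup>+ \<omega>. of_bool (E k \<omega>) * (indicator {0..} r * f (x + Z (max 0 (d * real k + r)) \<omega>)) \<partial>M \<partial>lborel)"
    by (rule L.Fubini') measurable
  also have "\<dots> = (\<integral>\<^sup>+ r. \<integral>\<^sup>+ \<omega>. of_bool (E k \<omega>) * (indicator {0..} r * (\<integral>\<^sup>+ \<omega>'. f (x + Z (d * real k) \<omega> + Z (max 0 r) \<omega>') \<partial>M)) \<partial>M \<partial>lborel)"
  proof (rule nn_integral_cong)
    fix r :: real
    show "(\<integral>\<^sup>+ \<omega>. of_bool (E k \<omega>) * (indicator {0..} r * f (x + Z (max 0 (d * real k + r)) \<omega>)) \<partial>M)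
       = (\<integral>\<^sup>+ \<omega>. of_bool (E k \<omega>) * (indicator {0..} r * (\<integral>\<^sup>+ \<omega>'. f (x + Z (d * real k) \<omega> + Z (max 0 r) \<omega>') \<partial>M)) \<partial>M)"
      using mk[of r] d by (cases "0 \<le> r") (auto simp: indicator_def)
  qed
  also have "\<dots> = (\<integral>\<^sup>+ \<omega>. \<integral>\<^sup>+ r. of_bool (E k \<omega>) * (indicator {0..} r * (\<integral>\<^sup>+ \<omega>'. f (x + Z (d * real k) \<omega> + Z (max 0 r) \<omega>') \<partial>M)) \<partial>lborel \<partial>M)"
    by (rule L.Fubini'[symmetric]) measurable
  also have "\<dots> = (\<integral>\<^sup>+ \<omega>. of_bool (E k \<omega>) * potential f (x + Z (d * real k) \<omega>) \<partial>M)"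
    unfolding potential_def potential_density[OF f fin, symmetric] by (simp add: nn_integral_cmult)
  also have "\<dots> \<le> (\<integral>\<^sup>+ \<omega>. potential f b * indicator {\<omega>\<in>space M. E k \<omega>} \<omega> \<partial>M)"
    by (intro nn_integral_mono) (auto simp: indicator_def E_def intro!: potential_antimono_start)
  also have "\<dots> = potential f b * emeasure M {\<omega>\<in>space M. E k \<omega>}"
    by (rule nn_integral_cmult_indicator) measurable
  finally show ?thesis .
qed

text \<open>The first passage below \<open>b\<close> is approximated from the right by the first visits below \<open>b\<close> along grids;
  at such a visit the remaining potential is at most \<open>potential f b\<close>.\<close>

lemma potential_le_killed_occ:
  assumes f [measurable]: "f \<in> borel_measurable borel" and fin: "(\<integral>\<^sup>+ y. f y \<partial>lborel) < \<infinity>"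
  shows "potential f x \<le> (\<integral>\<^sup>+ \<omega>. killed_occ f b x \<omega> \<partial>M) + potential f b"
proof -
  \<comment> \<open>Fine grids detect every passage strictly before \<open>s\<close>. Hence the
    killed occupation plus the lower limit of \<open>rest n\<close> covers the whole occupation, and
    Fatou's lemma applies.\<close>
  define G where "G n \<omega> s = (\<exists>k::nat. 1 / real (Suc n) * real k \<le> s \<and> x + Z (1 / real (Suc n) * real k) \<omega> < b)" for n \<omega> s
  have [measurable]: "Measurable.pred (lborel \<Otimes>\<^sub>M M) (\<lambda>p. G n (snd p) (fst p))"
     "Measurable.pred (M \<Otimes>\<^sub>M lborel) (\<lambda>p. G n (fst p) (snd p))" "\<omega> \<in> space M \<Longrightarrow> Measurable.pred borel (G n \<omega>)" for n \<omega>
    unfolding G_def by measurable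
  define rest where "rest n \<omega> = (\<integral>\<^sup>+ s. of_bool (G n \<omega> s) * (indicator {0..} s * f (x + Z (max 0 s) \<omega>)) \<partial>lborel)" for n \<omega>
  have [measurable]: "rest n \<in> borel_measurable M" for n unfolding rest_def of_bool_def by measurable
  have occ_le: "occ f x \<omega> \<le> killed_occ f b x \<omega> + liminf (\<lambda>n. rest n \<omega>)" if w: "\<omega> \<in> space M" for \<omega>
  proof -
    note [measurable] = w
    have "occ f x \<omega> \<le> (\<integral>\<^sup>+ s. indicator {s. 0 \<le> s \<and> above b x \<omega> s} s * f (x + Z (max 0 s) \<omega>)
        + liminf (\<lambda>n. of_bool (G n \<omega> s) * (indicator {0..} s * f (x + Z (max 0 s) \<omega>))) \<partial>lborel)"
      unfolding occ_def
    proof (intro nn_integral_mono)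
      fix s :: real
      show "indicator {0..} s * f (x + Z (max 0 s) \<omega>) \<le> indicator {s. 0 \<le> s \<and> above b x \<omega> s} s * f (x + Z (max 0 s) \<omega>)
        + liminf (\<lambda>n. of_bool (G n \<omega> s) * (indicator {0..} s * f (x + Z (max 0 s) \<omega>)))"
      proof (cases "0 \<le> s \<and> \<not> above b x \<omega> s")
        case True
        \<comment> \<open>The path stays below \<open>b\<close> on a right neighbourhood of
          \<open>u\<close>, and every sufficiently fine grid meets it before
          \<open>s\<close>.\<close>
        then obtain u where u: "0 \<le> u" "u < s" "x + Z u \<omega> < b" by (auto simp: above_def not_le)
        have "continuous (at_right u) (\<lambda>t. x + Z t \<omega>)" by (intro continuous_intros Z_right_cont w u)
        then obtain e where e: "e > u" "\<And>v. u \<le> v \<Longrightarrow> v < e \<Longrightarrow> x + Z v \<omega> < b"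
          using right_continuous_less_nbhd[of u "\<lambda>t. x + Z t \<omega>"] u by blast
        have "\<forall>\<^sub>F n in sequentially. real_of_int (\<lfloor>real (Suc n) * u\<rfloor> + 1) / real (Suc n) \<in> {u<..<min e s}"
          using e(1) u by (intro eventually_compose_filterlim[OF _ floor_grid_tendsto] eventually_at_right_real) simp
        then have "\<forall>\<^sub>F n in sequentially. indicator {0..} s * f (x + Z (max 0 s) \<omega>) \<le> of_bool (G n \<omega> s) * (indicator {0..} s * f (x + Z (max 0 s) \<omega>))"
        proof eventually_elim
          fix n assume n: "real_of_int (\<lfloor>real (Suc n) * u\<rfloor> + 1) / real (Suc n) \<in> {u<..<min e s}"
          define k where "k = nat (\<lfloor>real (Suc n) * u\<rfloor> + 1)"
          have "1 / real (Suc n) * real k = real_of_int (\<lfloor>real (Suc n) * u\<rfloor> + 1) / real (Suc n)"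
            using u by (simp add: k_def)
          then have "G n \<omega> s" unfolding G_def using n e(2) by (intro exI[of _ k]) auto
          then show "indicator {0..} s * f (x + Z (max 0 s) \<omega>) \<le> of_bool (G n \<omega> s) * (indicator {0..} s * f (x + Z (max 0 s) \<omega>))" by simp
        qed
        then have "indicator {0..} s * f (x + Z (max 0 s) \<omega>) \<le> liminf (\<lambda>n. of_bool (G n \<omega> s) * (indicator {0..} s * f (x + Z (max 0 s) \<omega>)))"
          by (rule Liminf_bounded)
        then show ?thesis by (rule order_trans) simp
      qed (auto simp: indicator_def)
    qed
    also have "\<dots> = killed_occ f b x \<omega> + (\<integral>\<^sup>+ s. liminf (\<lambda>n. of_bool (G n \<omega> s) * (indicator {0..} s * f (x + Z (max 0 s) \<omega>))) \<partial>lborel)"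
      unfolding killed_occ_def of_bool_def indicator_def mem_Collect_eq by (rule nn_integral_add) measurable
    also have "\<dots> \<le> killed_occ f b x \<omega> + liminf (\<lambda>n. rest n \<omega>)"
      unfolding rest_def of_bool_def by (intro add_left_mono nn_integral_liminf) measurable
    finally show ?thesis .
  qed
  have rest_le: "(\<integral>\<^sup>+ \<omega>. rest n \<omega> \<partial>M) \<le> potential f b" for n
  proof -
    define d where "d = 1 / real (Suc n)"
    have d: "0 < d" by (simp add: d_def)
    define E where "E k \<omega> \<longleftrightarrow> (\<forall>j<k. b \<le> x + Z (d * real j) \<omega>) \<and> x + Z (d * real k) \<omega> < b" for k :: nat and \<omega>
    have [measurable]: "Measurable.pred M (E k)" for k unfolding E_def by measurable
    have GE: "of_bool (G n \<omega> s) * (indicator {0..} s * f (x + Z (max 0 s) \<omega>))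
      \<le> (\<Sum>k. of_bool (E k \<omega>) * (indicator {d * real k..} s * f (x + Z (max 0 s) \<omega>)))" for \<omega> s
    proof (cases "G n \<omega> s")
      case True
      then obtain k where k: "d * real k \<le> s" "x + Z (d * real k) \<omega> < b" by (auto simp: G_def d_def)
      \<comment> \<open>The least index turns a visit into a first visit; first visits are disjoint
        events, so their probabilities add up to at most 1.\<close>
      define k0 where "k0 = (LEAST k. x + Z (d * real k) \<omega> < b)"
      have "x + Z (d * real k0) \<omega> < b" "k0 \<le> k" unfolding k0_def using k by (auto intro: LeastI Least_le)
      moreover have "b \<le> x + Z (d * real j) \<omega>" if "j < k0" for j
        using not_less_Least[of j "\<lambda>k. x + Z (d * real k) \<omega> < b"] that unfolding k0_def by (auto simp: not_less)
      ultimately have E: "E k0 \<omega>" by (simp add: E_def)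
      have "d * real k0 \<le> s" using k \<open>k0 \<le> k\<close> d by (meson mult_left_mono of_nat_mono less_imp_le order_trans)
      then have "of_bool (G n \<omega> s) * (indicator {0..} s * f (x + Z (max 0 s) \<omega>))
        \<le> of_bool (E k0 \<omega>) * (indicator {d * real k0..} s * f (x + Z (max 0 s) \<omega>))"
        using E by (auto simp: indicator_def)
      also have "\<dots> \<le> (\<Sum>k. of_bool (E k \<omega>) * (indicator {d * real k..} s * f (x + Z (max 0 s) \<omega>)))"
      proof -
        define F where "F k = of_bool (E k \<omega>) * (indicator {d * real k..} s * f (x + Z (max 0 s) \<omega>))" for k
        have "sum F {k0} \<le> suminf F" by (rule sum_le_suminf) auto
        then have "F k0 \<le> suminf F" by simp
        then show ?thesis unfolding F_def .
      qed
      finally show ?thesis .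
    qed simp
    have "(\<integral>\<^sup>+ \<omega>. rest n \<omega> \<partial>M)
      \<le> (\<integral>\<^sup>+ \<omega>. \<integral>\<^sup>+ s. (\<Sum>k. of_bool (E k \<omega>) * (indicator {d * real k..} s * f (x + Z (max 0 s) \<omega>))) \<partial>lborel \<partial>M)"
      unfolding rest_def by (intro nn_integral_mono GE)
    also have "\<dots> = (\<integral>\<^sup>+ \<omega>. (\<Sum>k. \<integral>\<^sup>+ s. of_bool (E k \<omega>) * (indicator {d * real k..} s * f (x + Z (max 0 s) \<omega>)) \<partial>lborel) \<partial>M)"
      by (intro nn_integral_cong nn_integral_suminf) measurable
    also have "\<dots> = (\<Sum>k. \<integral>\<^sup>+ \<omega>. \<integral>\<^sup>+ s. of_bool (E k \<omega>) * (indicator {d * real k..} s * f (x + Z (max 0 s) \<omega>)) \<partial>lborel \<partial>M)"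
      unfolding of_bool_def by (intro nn_integral_suminf) measurable
    also have "\<dots> \<le> (\<Sum>k. potential f b * emeasure M {\<omega>\<in>space M. E k \<omega>})"
      unfolding E_def by (intro suminf_le first_grid_passage d f fin) auto
    also have "\<dots> = potential f b * emeasure M (\<Union>k. {\<omega>\<in>space M. E k \<omega>})"
    proof -
      have "disjoint_family (\<lambda>k. {\<omega>\<in>space M. E k \<omega>})"
        by (auto simp: disjoint_family_on_def E_def) (metis linorder_neqE_nat not_le)
      then show ?thesis by (subst suminf_emeasure[symmetric]) (auto simp: ennreal_suminf_cmult)
    qed
    also have "\<dots> \<le> potential f b * 1" by (intro mult_left_mono emeasure_le_1) auto
    finally show ?thesis by simp
  qed
  have "potential f x = (\<integral>\<^sup>+ \<omega>. occ f x \<omega> \<partial>M)" by (rule expectation_occ[OF f fin, symmetric])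
  also have "\<dots> \<le> (\<integral>\<^sup>+ \<omega>. killed_occ f b x \<omega> + liminf (\<lambda>n. rest n \<omega>) \<partial>M)"
    by (intro nn_integral_mono occ_le)
  also have "\<dots> = (\<integral>\<^sup>+ \<omega>. killed_occ f b x \<omega> \<partial>M) + (\<integral>\<^sup>+ \<omega>. liminf (\<lambda>n. rest n \<omega>) \<partial>M)"
    by (rule nn_integral_add) measurable
  also have "(\<integral>\<^sup>+ \<omega>. liminf (\<lambda>n. rest n \<omega>) \<partial>M) \<le> liminf (\<lambda>n. \<integral>\<^sup>+ \<omega>. rest n \<omega> \<partial>M)"
    by (rule nn_integral_liminf) measurable
  also have "\<dots> \<le> liminf (\<lambda>_::nat. potential f b)"
    by (intro Liminf_mono always_eventually allI rest_le)
  finally show ?thesis by (simp add: Liminf_const add_left_mono)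
qed

end

section \<open>The time change along a path\<close>

text \<open>Both f u < c and Q u survive a small move to the right, so a rational witness exists.
  The map \<open>f\<close> is left open to cover \<open>ereal\<close> in \<open>tau0\<close> and
  \<open>eta_inv\<close> and \<open>ennreal\<close> in \<open>first_passage\<close>.\<close>

lemma Inf_image_less_iff_rat:
  fixes f :: "real \<Rightarrow> 'c::{complete_linorder, linorder_topology}"
  assumes f: "\<And>u. (f \<longlongrightarrow> f u) (at_right u)"
    and Q: "\<And>u. 0 \<le> u \<Longrightarrow> Q u \<Longrightarrow> \<exists>e>u. \<forall>v. u \<le> v \<longrightarrow> v < e \<longrightarrow> Q v"
  shows "Inf (f ` {u. 0 \<le> u \<and> Q u}) < c \<longleftrightarrow> (\<exists>q::rat. 0 \<le> (of_rat q :: real) \<and> f (of_rat q) < c \<and> Q (of_rat q))"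
proof
  assume "Inf (f ` {u. 0 \<le> u \<and> Q u}) < c"
  then obtain u where u: "0 \<le> u" "Q u" "f u < c" unfolding Inf_less_iff by auto
  obtain e where e: "e > u" "\<And>v. u \<le> v \<Longrightarrow> v < e \<Longrightarrow> Q v" using Q[OF u(1,2)] by blast
  have "\<forall>\<^sub>F v in at_right u. f v < c" using order_tendstoD(2)[OF f u(3)] .
  then obtain e' where e': "e' > u" "\<And>v. u < v \<Longrightarrow> v < e' \<Longrightarrow> f v < c"
    by (auto simp: eventually_at_right[of u "u + 1"])
  obtain q where q: "u < of_rat q" "of_rat q < min e e'" using of_rat_dense[of u "min e e'"] e(1) e'(1) by auto
  have "0 \<le> (of_rat q :: real)" using q u by linarith
  then show "\<exists>q::rat. 0 \<le> (of_rat q :: real) \<and> f (of_rat q) < c \<and> Q (of_rat q)"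
    using q e(2)[of "of_rat q"] e'(2)[of "of_rat q"] by auto
next
  assume "\<exists>q::rat. 0 \<le> (of_rat q :: real) \<and> f (of_rat q) < c \<and> Q (of_rat q)"
  then show "Inf (f ` {u. 0 \<le> u \<and> Q u}) < c" unfolding Inf_less_iff by blast
qed

lemma measurable_Inf_image_right_open:
  fixes f :: "real \<Rightarrow> 'c::{complete_linorder, linorder_topology, second_countable_topology}"
  assumes f: "\<And>u. (f \<longlongrightarrow> f u) (at_right u)"
    and m: "\<And>u. 0 \<le> u \<Longrightarrow> Measurable.pred N (Q u)"
    and Q: "\<And>u \<omega>. \<omega> \<in> space N \<Longrightarrow> 0 \<le> u \<Longrightarrow> Q u \<omega> \<Longrightarrow> \<exists>e>u. \<forall>v. u \<le> v \<longrightarrow> v < e \<longrightarrow> Q v \<omega>"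
  shows "(\<lambda>\<omega>. Inf (f ` {u. 0 \<le> u \<and> Q u \<omega>})) \<in> borel_measurable N"
proof (rule borel_measurableI_less)
  fix c
  have "Measurable.pred N (\<lambda>\<omega>. 0 \<le> (of_rat q :: real) \<and> f (of_rat q) < c \<and> Q (of_rat q) \<omega>)" for q
    using m[of "of_rat q"] by (cases "0 \<le> (of_rat q :: real)") auto
  then have "Measurable.pred N (\<lambda>\<omega>. \<exists>q::rat. 0 \<le> (of_rat q :: real) \<and> f (of_rat q) < c \<and> Q (of_rat q) \<omega>)"
    by (rule pred_intros_countable)
  then show "{\<omega> \<in> space N. Inf (f ` {u. 0 \<le> u \<and> Q u \<omega>}) < c} \<in> sets N"
    unfolding pred_def by (rule back_subst[of "\<lambda>S. S \<in> sets N"])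
      (intro Collect_cong conj_cong refl Inf_image_less_iff_rat[symmetric] f Q)
qed

definition inv_rate :: "(real \<Rightarrow> real) \<Rightarrow> real \<Rightarrow> real \<Rightarrow> ennreal" where
  "inv_rate R b y = indicator {b..} y * inverse (ennreal (R y))"

locale rate =
  fixes R :: "real \<Rightarrow> real"
  assumes R_cont: "continuous_on {0..} R" and R_pos: "\<And>x. x > 0 \<Longrightarrow> R x > 0"
begin

lemma measurable_R_max [measurable]: "(\<lambda>y. R (max 0 y)) \<in> borel_measurable borel"
  by (intro borel_measurable_continuous_onI continuous_on_compose2[OF R_cont] continuous_intros) auto

text \<open>Nothing is known of \<open>R\<close> at negative arguments, not even measurability; the
  cut-off allows passing to the continuous function R (max 0 y).\<close>

lemma measurable_indicator_inverse_rate: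
  assumes "A \<in> sets borel" "A \<subseteq> {0..}"
  shows "(\<lambda>y. indicator A y * inverse (ennreal (R y))) \<in> borel_measurable borel"
proof -
  have "(\<lambda>y. indicator A y * inverse (ennreal (R y))) = (\<lambda>y. indicator A y * inverse (ennreal (R (max 0 y))))"
    using assms(2) by (force simp: indicator_def fun_eq_iff max_def)
  then show ?thesis using assms(1) by simp
qed

lemma measurable_inv_rate [measurable]: "b > 0 \<Longrightarrow> inv_rate R b \<in> borel_measurable borel"
  unfolding inv_rate_def[abs_def] by (rule measurable_indicator_inverse_rate) auto

end

locale rate_path = rate +
  fixes z :: "real \<Rightarrow> real"
  assumes z_rc: "\<And>t. 0 \<le> t \<Longrightarrow> continuous (at_right t) z"
begin

lemma measurable_z [measurable]: "(\<lambda>r. z (max 0 r)) \<in> borel_measurable borel"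
proof -
  have "(\<lambda>x. z (max 0 (fst x))) \<in> borel_measurable ((borel :: real measure) \<Otimes>\<^sub>M (count_space UNIV :: unit measure))"
    using measurable_right_continuous_process[of "\<lambda>t _. z t" "count_space UNIV :: unit measure"] z_rc by simp
  then have "(\<lambda>x. (\<lambda>x. z (max 0 (fst x))) (x, ())) \<in> borel_measurable borel"
    by (rule measurable_compose[rotated]) measurable
  then show ?thesis by simp
qed

lemma tau0_le: "0 \<le> t \<Longrightarrow> z t < 0 \<Longrightarrow> tau0 z \<le> ereal t"
  unfolding tau0_def by (intro Inf_lower) auto

lemma tau0_ge: "(\<And>t. 0 \<le> t \<Longrightarrow> z t < 0 \<Longrightarrow> c \<le> ereal t) \<Longrightarrow> c \<le> tau0 z"
  unfolding tau0_def by (intro Inf_greatest) auto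

lemma tau0_nonneg: "0 \<le> tau0 z"
  by (rule tau0_ge) simp

lemma z_before_tau0: "0 \<le> r \<Longrightarrow> ereal r < tau0 z \<Longrightarrow> 0 \<le> z r"
  using tau0_le[of r] by (metis not_le)

lemma z_at_tau0:
  assumes "tau0 z = ereal t"
  shows "0 \<le> t" "z t \<le> 0"
proof -
  show t: "0 \<le> t" using tau0_nonneg assms by simp
  show "z t \<le> 0"
  proof (rule ccontr)
    assume "\<not> z t \<le> 0"
    moreover have "continuous (at_right t) (\<lambda>t. - z t)" using t z_rc by (intro continuous_intros) auto
    ultimately obtain e where e: "e > t" "\<And>v. t \<le> v \<Longrightarrow> v < e \<Longrightarrow> - z v < 0"
      using right_continuous_less_nbhd[of t "\<lambda>t. - z t" 0] by auto
    have "ereal e \<le> tau0 z"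
    proof (rule tau0_ge)
      fix u assume u: "0 \<le> u" "z u < 0"
      then have "t \<le> u" using tau0_le[OF u] assms by simp
      then show "ereal e \<le> ereal u" using e(2)[of u] u by force
    qed
    with assms e show False by simp
  qed
qed

text \<open>At r = \<open>tau0 z\<close> the path may be negative, where \<open>R\<close> is
  arbitrary; this single point is a null set, and before it z is nonnegative.\<close>

lemma eta_alt:
  "eta R z s = (\<integral>\<^sup>+ r. of_bool (0 \<le> r \<and> r \<le> s \<and> ereal r \<le> tau0 z) * inverse (ennreal (R (max 0 (z (max 0 r))))) \<partial>lborel)"
  unfolding eta_def
proof (rule nn_integral_cong_AE)
  have "AE r in lborel. r \<noteq> real_of_ereal (tau0 z)"
    by (rule AE_lborel_singleton)
  then show "AE r in lborel. inverse (ennreal (R (z r))) * indicator {r. 0 \<le> r \<and> r \<le> s \<and> ereal r \<le> tau0 z} r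
      = of_bool (0 \<le> r \<and> r \<le> s \<and> ereal r \<le> tau0 z) * inverse (ennreal (R (max 0 (z (max 0 r)))))"
  proof eventually_elim
    fix r assume r: "r \<noteq> real_of_ereal (tau0 z)"
    show "inverse (ennreal (R (z r))) * indicator {r. 0 \<le> r \<and> r \<le> s \<and> ereal r \<le> tau0 z} r
      = of_bool (0 \<le> r \<and> r \<le> s \<and> ereal r \<le> tau0 z) * inverse (ennreal (R (max 0 (z (max 0 r)))))"
    proof (cases "0 \<le> r \<and> r \<le> s \<and> ereal r \<le> tau0 z")
      case True
      then have "ereal r < tau0 z" using r by (cases "tau0 z") auto
      then have "0 \<le> z r" using z_before_tau0 True by blast
      with True show ?thesis by simp
    qed (auto simp: indicator_def)
  qed
qed

lemma eta_mono: "r \<le> s \<Longrightarrow> eta R z r \<le> eta R z s"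
  unfolding eta_def by (intro nn_integral_mono) (auto simp: indicator_def)

lemma eta_inv_le: "0 \<le> s \<Longrightarrow> ennreal t < eta R z s \<Longrightarrow> eta_inv R z t \<le> ereal s"
  unfolding eta_inv_def by (intro Inf_lower) auto

lemma eta_inv_ge: "(\<And>s. 0 \<le> s \<Longrightarrow> ennreal t < eta R z s \<Longrightarrow> c \<le> ereal s) \<Longrightarrow> c \<le> eta_inv R z t"
  unfolding eta_inv_def by (intro Inf_greatest) auto

lemma eta_inv_nonneg: "0 \<le> eta_inv R z t"
  by (rule eta_inv_ge) simp

end

locale rate_path_level = rate_path +
  fixes b :: real
  assumes b_pos: "b > 0"
begin

definition J :: "real \<Rightarrow> bool" where
  "J s \<longleftrightarrow> (\<forall>u\<ge>0. u < s \<longrightarrow> b \<le> z u)"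

text \<open>The value of the clock when \<open>z\<close> first passes below \<open>b\<close>, that
  is, the passage time of the time-changed path. It has the shape of \<open>killed_occ\<close>, so
  that the two agree by unfolding.\<close>

definition lifetime :: ennreal where
  "lifetime = (\<integral>\<^sup>+ s. indicator {s. 0 \<le> s \<and> J s} s * inv_rate R b (z (max 0 s)) \<partial>lborel)"

lemma J_down: "J s \<Longrightarrow> r \<le> s \<Longrightarrow> J r"
  by (auto simp: J_def)

lemma J_tau0: "J s \<Longrightarrow> ereal s \<le> tau0 z"
  using b_pos by (intro tau0_ge) (force simp: J_def)

lemma measurable_J [measurable]: "Measurable.pred borel J"
proof -
  have "J s \<longleftrightarrow> (\<forall>q::rat. 0 \<le> (of_rat q :: real) \<longrightarrow> of_rat q < s \<longrightarrow> b \<le> z (of_rat q))" for s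
    unfolding J_def by (rule right_continuous_all_ge_iff_rat[OF z_rc])
  then have "J = (\<lambda>s. \<forall>q::rat. 0 \<le> (of_rat q :: real) \<longrightarrow> of_rat q < s \<longrightarrow> b \<le> z (of_rat q))" by auto
  then show ?thesis by simp
qed

lemma measurable_inv_rate_b [measurable]: "inv_rate R b \<in> borel_measurable borel"
  by (rule measurable_inv_rate[OF b_pos])

lemma partial_le_eta:
  assumes "J s'" "s < s'"
  shows "(\<integral>\<^sup>+ r. indicator {0..s} r * inv_rate R b (z (max 0 r)) \<partial>lborel) \<le> eta R z s"
  unfolding eta_def
proof (intro nn_integral_mono)
  fix r :: real
  have "ereal r \<le> tau0 z" if "r \<le> s" using J_tau0[OF assms(1)] assms(2) that
    by (meson ereal_less_eq(3) less_imp_le order_trans)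
  then show "indicator {0..s} r * inv_rate R b (z (max 0 r))
    \<le> inverse (ennreal (R (z r))) * indicator {r. 0 \<le> r \<and> r \<le> s \<and> ereal r \<le> tau0 z} r"
    by (auto simp: indicator_def inv_rate_def)
qed

text \<open>If the clock exceeded \<open>u\<close> at some \<open>s\<close> strictly before the
  passage, its inverse at \<open>u\<close> would be a time at which \<open>z\<close> is still at
  least \<open>b\<close>, contrary to \<open>X\<close>. The lifetime is exhausted by the clock at
  such \<open>s\<close>.\<close>

lemma lifetime_le:
  assumes u: "0 \<le> u" and X: "Xpath R z u < b"
  shows "lifetime \<le> ennreal u"
proof -
  have part: "(\<integral>\<^sup>+ r. indicator {0..s} r * inv_rate R b (z (max 0 r)) \<partial>lborel) \<le> ennreal u"
    if s: "0 \<le> s" "s < s'" "J s'" for s s'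
  proof (rule order_trans[OF partial_le_eta[OF s(3,2)]], rule ccontr)
    assume "\<not> eta R z s \<le> ennreal u"
    then have "eta_inv R z u \<le> ereal s" using s by (intro eta_inv_le) auto
    with eta_inv_nonneg[of u] obtain e where e: "eta_inv R z u = ereal e" "0 \<le> e" "e \<le> s"
      by (cases "eta_inv R z u") auto
    have "ereal e < tau0 z" using J_tau0[OF s(3)] e s by (meson ereal_less(2) le_less_trans less_ereal.simps(1) order_less_le_trans)
    then have "Xpath R z u = z e" using e by (simp add: Xpath_def min_absorb1 less_imp_le)
    moreover have "b \<le> z e" using s e by (auto simp: J_def)
    ultimately show False using X by simp
  qed
  \<comment> \<open>The margin 1 / (n + 1) keeps a stretch before the passage beyond
    \<open>s\<close>; the bound by \<open>n\<close> makes the supremum \<open>m\<close>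
    finite.\<close>
  define A where "A n = {s. 0 \<le> s \<and> s \<le> real n \<and> J (s + 1 / real (Suc n))}" for n
  have [measurable]: "A n \<in> sets borel" for n unfolding A_def by measurable
  have A_le: "(\<integral>\<^sup>+ r. indicator (A n) r * inv_rate R b (z (max 0 r)) \<partial>lborel) \<le> ennreal u" for n
  proof (cases "A n = {}")
    case False
    define m where "m = Sup (A n)"
    have bdd: "bdd_above (A n)" by (rule bdd_aboveI[of _ "real n"]) (auto simp: A_def)
    have le: "s \<le> m" if "s \<in> A n" for s unfolding m_def using that bdd by (rule cSup_upper)
    have m0: "0 \<le> m" using False le by (auto simp: A_def intro: order_trans)
    have Jm: "J (m + 1 / real (Suc n))"
      unfolding J_def
    proof (intro allI impI)
      fix v :: real assume v: "0 \<le> v" "v < m + 1 / real (Suc n)"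
      then have "v - 1 / real (Suc n) < Sup (A n)" by (simp add: m_def)
      then obtain s where "s \<in> A n" "v - 1 / real (Suc n) < s"
        using less_cSup_iff[OF False bdd] by blast
      then show "b \<le> z v" using v by (auto simp: A_def J_def)
    qed
    have "(\<integral>\<^sup>+ r. indicator (A n) r * inv_rate R b (z (max 0 r)) \<partial>lborel)
      \<le> (\<integral>\<^sup>+ r. indicator {0..m} r * inv_rate R b (z (max 0 r)) \<partial>lborel)"
      using le by (intro nn_integral_mono mult_right_mono) (auto simp: indicator_def A_def)
    also have "\<dots> \<le> ennreal u" by (rule part[OF m0 _ Jm]) simp
    finally show ?thesis .
  qed simp
  \<comment> \<open>\<open>c\<close> is the only possible last element of \<open>J\<close> and can
    be neglected as a null set; if there is none, any value serves.\<close>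
  obtain c where c: "\<And>s. J s \<Longrightarrow> (\<And>s'. s' > s \<Longrightarrow> \<not> J s') \<Longrightarrow> s = c"
  proof (cases "\<exists>s. J s \<and> (\<forall>s'>s. \<not> J s')")
    case True
    then obtain c where "J c" "\<And>s'. s' > c \<Longrightarrow> \<not> J s'" by blast
    then show ?thesis using that[of c] by (metis linorder_neqE_linordered_idom)
  qed (use that in blast)
  have inc: "incseq (\<lambda>n r. indicator (A n) r * inv_rate R b (z (max 0 r)))"
  proof (rule incseq_SucI, rule le_funI)
    fix n r
    have "A n \<subseteq> A (Suc n)"
      unfolding A_def by (auto intro: J_down simp: frac_le)
    then show "indicator (A n) r * inv_rate R b (z (max 0 r)) \<le> indicator (A (Suc n)) r * inv_rate R b (z (max 0 r))"
      by (auto simp: indicator_def)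
  qed
  have "lifetime \<le> (\<integral>\<^sup>+ r. (SUP n. indicator (A n) r * inv_rate R b (z (max 0 r))) \<partial>lborel)"
    unfolding lifetime_def
  proof (rule nn_integral_mono_AE)
    have "AE s in lborel. s \<noteq> c" by (rule AE_lborel_singleton)
    then show "AE s in lborel. indicator {s. 0 \<le> s \<and> J s} s * inv_rate R b (z (max 0 s))
        \<le> (SUP n. indicator (A n) s * inv_rate R b (z (max 0 s)))"
    proof eventually_elim
      fix s assume sc: "s \<noteq> c"
      show "indicator {s. 0 \<le> s \<and> J s} s * inv_rate R b (z (max 0 s))
        \<le> (SUP n. indicator (A n) s * inv_rate R b (z (max 0 s)))"
      proof (cases "0 \<le> s \<and> J s")
        case True
        with c sc obtain s' where s': "s' > s" "J s'" by blast
        obtain n1 where n1: "inverse (real (Suc n1)) < s' - s" using reals_Archimedean[of "s' - s"] s' by auto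
        obtain n2 where n2: "s \<le> real n2" using real_arch_simple by blast
        define n where "n = max n1 n2"
        have "1 / real (Suc n) \<le> 1 / real (Suc n1)" by (intro frac_le) (auto simp: n_def)
        then have "s \<in> A n" using True n1 n2 s' J_down[OF s'(2), of "s + 1 / real (Suc n)"]
          by (auto simp: A_def n_def inverse_eq_divide)
        then show ?thesis using True by (intro SUP_upper2[of n]) auto
      qed simp
    qed
  qed
  also have "\<dots> = (SUP n. \<integral>\<^sup>+ r. indicator (A n) r * inv_rate R b (z (max 0 r)) \<partial>lborel)"
    by (rule nn_integral_monotone_convergence_SUP[OF inc]) measurable
  also have "\<dots> \<le> ennreal u" by (intro SUP_least A_le)
  finally show ?thesis .
qed

text \<open>There is a time \<open>s1\<close> with z s1 < b and clock value still below
  \<open>t\<close>. Just after \<open>s1\<close> the path remains below \<open>b\<close> while the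
  clock advances, so the inverse clock at a rational time slightly above the value at
  \<open>s1\<close> lands there. If \<open>tau0 z\<close> has been reached, \<open>X\<close> is
  frozen at a value that is at most 0.\<close>

lemma passage_after_lifetime:
  assumes D: "lifetime < ennreal t" and w: "\<exists>w\<ge>0. z w < b"
  shows "\<exists>q::rat. 0 \<le> (of_rat q :: real) \<and> of_rat q < t \<and> Xpath R z (of_rat q) < b"
proof -
  define \<tau> where "\<tau> = Inf {u. 0 \<le> u \<and> z u < b}"
  have ne: "{u. 0 \<le> u \<and> z u < b} \<noteq> {}" and bdd: "bdd_below {u. 0 \<le> u \<and> z u < b}"
    using w by (auto intro!: bdd_belowI[of _ 0])
  have tau_le: "\<tau> \<le> u" if "0 \<le> u" "z u < b" for u
    unfolding \<tau>_def using that bdd by (intro cInf_lower) auto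
  have tau0: "0 \<le> \<tau>" unfolding \<tau>_def using ne by (intro cInf_greatest) auto
  have J_iff: "J s" if "s \<le> \<tau>" for s
    using that tau_le by (force simp: J_def not_le[symmetric])
  have near: "\<exists>u. \<tau> \<le> u \<and> u < e \<and> z u < b" if "\<tau> < e" for e
    using that cInf_lessD[OF ne] tau_le unfolding \<tau>_def[symmetric] by blast
  obtain d where d: "lifetime = ennreal d" "0 \<le> d" "d < t"
    using D by (cases "lifetime" rule: ennreal_cases) (auto simp: ennreal_less_iff)
  have "\<exists>s1\<ge>\<tau>. z s1 < b \<and> eta R z s1 < ennreal t"
  proof (cases "z \<tau> < b")
    case True
    have "eta R z \<tau> \<le> lifetime"
      unfolding eta_def lifetime_def
    proof (rule nn_integral_mono_AE)
      have "AE r in lborel. r \<noteq> \<tau>" by (rule AE_lborel_singleton)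
      then show "AE r in lborel. inverse (ennreal (R (z r))) * indicator {r. 0 \<le> r \<and> r \<le> \<tau> \<and> ereal r \<le> tau0 z} r
          \<le> indicator {s. 0 \<le> s \<and> J s} r * inv_rate R b (z (max 0 r))"
      proof eventually_elim
        fix r assume "r \<noteq> \<tau>"
        then show "inverse (ennreal (R (z r))) * indicator {r. 0 \<le> r \<and> r \<le> \<tau> \<and> ereal r \<le> tau0 z} r
          \<le> indicator {s. 0 \<le> s \<and> J s} r * inv_rate R b (z (max 0 r))"
          using J_iff[of r] J_iff[of \<tau>] by (auto simp: indicator_def inv_rate_def J_def)
      qed
    qed
    with D True show ?thesis by (intro exI[of _ \<tau>]) auto
  next
    case False
    \<comment> \<open>Here z is still at least \<open>b\<close> at its passage time, with values
      below \<open>b\<close> accumulating from the right. Close to that time the rate exceeds half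
      of \<open>\<rho>\<close>, so the clock gains at most 2 / \<open>\<rho>\<close> per unit of
      time.\<close>
    define \<rho> where "\<rho> = R (z \<tau>)"
    have z\<tau>: "z \<tau> > 0" using False b_pos by simp
    have \<rho>: "\<rho> > 0" unfolding \<rho>_def using z\<tau> by (rule R_pos)
    have "isCont R (z \<tau>)" using continuous_on_interior[OF R_cont, of "z \<tau>"] z\<tau> by simp
    then have "((\<lambda>r. - R (z r)) \<longlongrightarrow> - \<rho>) (at_right \<tau>)"
      unfolding \<rho>_def using z_rc[OF tau0] by (intro tendsto_intros isCont_tendsto_compose[of _ R]) (auto simp: continuous_within)
    then have "continuous (at_right \<tau>) (\<lambda>r. - R (z r))" by (simp add: continuous_within \<rho>_def)
    then obtain e where e: "e > \<tau>" "\<And>v. \<tau> \<le> v \<Longrightarrow> v < e \<Longrightarrow> - R (z v) < - \<rho> / 2"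
      using right_continuous_less_nbhd[of \<tau> "\<lambda>r. - R (z r)" "- \<rho> / 2"] \<rho> by (auto simp: \<rho>_def)
    \<comment> \<open>t - d is the clock time left before \<open>t\<close>; at speed 2 /
      \<open>\<rho>\<close> it permits this delay after the passage.\<close>
    define e' where "e' = min e (\<tau> + (t - d) * \<rho> / 2)"
    have "\<tau> < e'" using e d \<rho> by (auto simp: e'_def)
    from near[OF this] obtain s1 where s1: "\<tau> \<le> s1" "s1 < e'" "z s1 < b" by blast
    have "eta R z s1 \<le> (\<integral>\<^sup>+ r. indicator {s. 0 \<le> s \<and> J s} r * inv_rate R b (z (max 0 r)) + ennreal (2 / \<rho>) * indicator {\<tau>..s1} r \<partial>lborel)"
      unfolding eta_def
    proof (rule nn_integral_mono)
      fix r :: real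
      have "inverse (ennreal (R (z r))) \<le> ennreal (2 / \<rho>)" if "\<tau> \<le> r" "r \<le> s1"
      proof -
        have "R (z r) > \<rho> / 2" using e(2)[of r] that s1 by (auto simp: e'_def)
        then show ?thesis using \<rho> by (subst inverse_ennreal) (auto simp: field_simps intro!: ennreal_leI)
      qed
      then show "inverse (ennreal (R (z r))) * indicator {r. 0 \<le> r \<and> r \<le> s1 \<and> ereal r \<le> tau0 z} r
        \<le> indicator {s. 0 \<le> s \<and> J s} r * inv_rate R b (z (max 0 r)) + ennreal (2 / \<rho>) * indicator {\<tau>..s1} r"
        using J_iff[of r] J_iff[of \<tau>] tau0
        by (cases "\<tau> \<le> r") (auto simp: indicator_def inv_rate_def J_def add_increasing)
    qed
    also have "\<dots> = lifetime + ennreal (2 / \<rho>) * ennreal (s1 - \<tau>)"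
      unfolding lifetime_def using s1 by (subst nn_integral_add) (auto simp: nn_integral_cmult_indicator)
    also have "\<dots> = ennreal (d + 2 / \<rho> * (s1 - \<tau>))"
      using d \<rho> s1 by (simp add: ennreal_mult[symmetric] ennreal_plus[symmetric] del: ennreal_plus)
    also have "\<dots> < ennreal t"
    proof -
      have "2 / \<rho> * (s1 - \<tau>) < 2 / \<rho> * ((t - d) * \<rho> / 2)"
        using s1 \<rho> by (intro mult_strict_left_mono) (auto simp: e'_def)
      also have "\<dots> = t - d" using \<rho> by simp
      finally show ?thesis using d \<rho> s1 by (intro ennreal_lessI) auto
    qed
    finally show ?thesis using s1 by blast
  qed
  then obtain s1 where s1: "\<tau> \<le> s1" "z s1 < b" "eta R z s1 < ennreal t" by blast
  then have s10: "0 \<le> s1" using tau0 by simp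
  obtain x where x: "eta R z s1 = ennreal x" "0 \<le> x" "x < t"
    using s1(3) by (cases "eta R z s1" rule: ennreal_cases) (auto simp: ennreal_less_iff)
  obtain e where e: "e > s1" "\<And>v. s1 \<le> v \<Longrightarrow> v < e \<Longrightarrow> z v < b"
    using right_continuous_less_nbhd[OF z_rc[OF s10] s1(2)] by blast
  show ?thesis
  proof (cases "ereal s1 < tau0 z")
    case True
    obtain s2 where s2: "s1 < s2" "s2 < e" "ereal s2 < tau0 z"
    proof (cases "tau0 z")
      case (real r)
      then show ?thesis using that[of "(s1 + min e r) / 2"] True e by (auto simp: min_def field_simps)
    qed (use True that[of "(s1 + e) / 2"] e in auto)
    have "compact (R ` {0..b})"
      by (intro compact_continuous_image continuous_on_subset[OF R_cont]) auto
    then obtain B where B: "\<And>y. 0 \<le> y \<Longrightarrow> y \<le> b \<Longrightarrow> R y \<le> B"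
      using bounded_imp_bdd_above[OF compact_imp_bounded] unfolding bdd_above_def by fastforce
    \<comment> \<open>A positive bound for \<open>R\<close> on [0, b], where the path is between
      \<open>s1\<close> and \<open>s2\<close>. The clock runs there at speed at least 1 /
      \<open>B'\<close>, so its inverse cannot jump past \<open>s2\<close>.\<close>
    define B' where "B' = max B 1"
    have B': "B' > 0" by (simp add: B'_def)
    let ?g = "\<lambda>r. inverse (ennreal (R (max 0 (z (max 0 r)))))"
    have "eta R z s1 + ennreal (1 / B') * ennreal (s2 - s1)
      = (\<integral>\<^sup>+ r. of_bool (0 \<le> r \<and> r \<le> s1 \<and> ereal r \<le> tau0 z) * ?g r + ennreal (1 / B') * indicator {s1<..s2} r \<partial>lborel)"
      unfolding eta_alt of_bool_def using s2 by (subst nn_integral_add) (auto simp: nn_integral_cmult_indicator)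
    also have "\<dots> \<le> eta R z s2"
      unfolding eta_alt
    proof (rule nn_integral_mono)
      fix r :: real
      have "ennreal (1 / B') \<le> ?g r \<and> ereal r \<le> tau0 z" if "s1 < r" "r \<le> s2"
      proof -
        have r: "ereal r < tau0 z" using s2(3) that by (meson ereal_less_eq(3) le_less_trans)
        then have "0 \<le> z r" "z r < b" using z_before_tau0[of r] e(2)[of r] that s2 s10 by auto
        then have "R (z r) \<le> B'" using B[of "z r"] by (simp add: B'_def)
        then have "inverse (ennreal B') \<le> inverse (ennreal (R (z r)))"
          using B' by (cases "R (z r) > 0")
            (auto simp: inverse_ennreal ennreal_neg intro!: ennreal_leI le_imp_inverse_le)
        moreover have "inverse (ennreal B') = ennreal (1 / B')" using B' by (simp add: inverse_ennreal inverse_eq_divide)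
        ultimately show ?thesis using r \<open>0 \<le> z r\<close> that s10 by (simp add: max_def)
      qed
      then show "of_bool (0 \<le> r \<and> r \<le> s1 \<and> ereal r \<le> tau0 z) * ?g r + ennreal (1 / B') * indicator {s1<..s2} r
        \<le> of_bool (0 \<le> r \<and> r \<le> s2 \<and> ereal r \<le> tau0 z) * ?g r"
        using s2 s10 by (cases "r \<le> s1") (auto simp: indicator_def)
    qed
    finally have inc: "ennreal (x + 1 / B' * (s2 - s1)) \<le> eta R z s2"
      using x B' s2 by (simp add: ennreal_mult[symmetric] ennreal_plus[symmetric] del: ennreal_plus)
    \<comment> \<open>The rational lies above the clock value at \<open>s1\<close> and below both
      \<open>t\<close> and the lower bound for the clock at \<open>s2\<close>, which confines its
      inverse to [s1, s2].\<close>
    have "x < min t (x + 1 / B' * (s2 - s1))" using x B' s2 by simp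
    then obtain q where q: "x < of_rat q" "of_rat q < min t (x + 1 / B' * (s2 - s1))"
      using of_rat_dense by blast
    define y where "y = (of_rat q :: real)"
    have "ennreal y < eta R z s2"
      using q x by (intro less_le_trans[OF ennreal_lessI inc]) (auto simp: y_def)
    then have le: "eta_inv R z y \<le> ereal s2" using s2 s10 by (intro eta_inv_le) auto
    have ge: "ereal s1 \<le> eta_inv R z y"
    proof (rule eta_inv_ge)
      fix s assume s: "0 \<le> s" "ennreal y < eta R z s"
      have "eta R z s1 < eta R z s" using s q x by (simp add: y_def) (meson ennreal_leI le_less_trans less_imp_le)
      then show "ereal s1 \<le> ereal s" using eta_mono[of s s1] by (metis ereal_less_eq(3) linear not_le)
    qed
    obtain e' where e': "eta_inv R z y = ereal e'" "s1 \<le> e'" "e' \<le> s2"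
      using le ge by (cases "eta_inv R z y") auto
    have "ereal e' < tau0 z" using s2 e' by (meson ereal_less_eq(3) le_less_trans)
    then have "Xpath R z y = z e'" using e' by (simp add: Xpath_def min_absorb1 less_imp_le)
    moreover have "0 \<le> y" using q(1) x(2) unfolding y_def by linarith
    ultimately show ?thesis using q e(2)[of e'] e' s2 unfolding y_def by (intro exI[of _ q]) auto
  next
    case False
    \<comment> \<open>The clock has stopped, so it never exceeds a rational above its value at
      \<open>s1\<close>; the inverse is infinite and the path is read at
      \<open>tau0 z\<close>.\<close>
    with tau0_nonneg obtain r where r: "tau0 z = ereal r" "r \<le> s1" by (cases "tau0 z") auto
    obtain q where q: "x < of_rat q" "of_rat q < t" using of_rat_dense x by blast
    define y where "y = (of_rat q :: real)"
    have "eta R z s \<le> eta R z s1" for s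
      unfolding eta_def using r by (intro nn_integral_mono) (auto simp: indicator_def)
    then have no: "\<not> ennreal y < eta R z s" for s
      using x q by (metis ennreal_leI less_imp_le not_le order_trans y_def)
    have "eta_inv R z y \<ge> \<infinity>" by (rule eta_inv_ge) (use no in auto)
    then have "Xpath R z y = z r" using r by (simp add: Xpath_def)
    moreover have "0 \<le> y" using q(1) x(2) unfolding y_def by linarith
    ultimately show ?thesis using q z_at_tau0[OF r(1)] b_pos unfolding y_def by (intro exI[of _ q]) auto
  qed
qed

text \<open>\<open>w\<close> excludes paths that stay above \<open>b\<close> while the clock has a
  finite total: the inverse clock is then infinite and \<open>Xpath\<close> falls back to the
  default value z 0. Rational times are the ones that the Markov property of \<open>Y\<close> can
  later handle.\<close>

lemma Xpath_above_iff:
  assumes t: "0 \<le> t" and w: "\<exists>w\<ge>0. z w < b"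
  shows "(\<forall>q::rat. 0 \<le> (of_rat q :: real) \<longrightarrow> of_rat q < t \<longrightarrow> b \<le> Xpath R z (of_rat q)) \<longleftrightarrow> ennreal t \<le> lifetime"
proof
  assume "\<forall>q::rat. 0 \<le> (of_rat q :: real) \<longrightarrow> of_rat q < t \<longrightarrow> b \<le> Xpath R z (of_rat q)"
  then show "ennreal t \<le> lifetime"
    using passage_after_lifetime[OF _ w, of t] by (meson not_le)
next
  assume l: "ennreal t \<le> lifetime"
  show "\<forall>q::rat. 0 \<le> (of_rat q :: real) \<longrightarrow> of_rat q < t \<longrightarrow> b \<le> Xpath R z (of_rat q)"
  proof (intro allI impI, rule ccontr)
    fix q :: rat assume q: "0 \<le> (of_rat q :: real)" "of_rat q < t" "\<not> b \<le> Xpath R z (of_rat q)"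
    then have "lifetime \<le> ennreal (of_rat q)" by (intro lifetime_le) auto
    with l have "ennreal t \<le> ennreal (of_rat q)" by (rule order_trans)
    then show False using q by (simp add: ennreal_le_iff2)
  qed
qed

end

section \<open>Measurability of the time-changed path\<close>

lemma measurable_Xpath:
  fixes \<zeta> :: "real \<Rightarrow> 'a \<Rightarrow> real"
  assumes "rate R"
    and m: "\<And>t. 0 \<le> t \<Longrightarrow> \<zeta> t \<in> borel_measurable N"
    and rc: "\<And>\<omega> t. \<omega> \<in> space N \<Longrightarrow> 0 \<le> t \<Longrightarrow> continuous (at_right t) (\<lambda>t. \<zeta> t \<omega>)"
  shows "(\<lambda>\<omega>. Xpath R (\<lambda>r. \<zeta> r \<omega>) t) \<in> borel_measurable N"
proof -
  interpret rate R by fact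
  have path: "rate_path R (\<lambda>r. \<zeta> r \<omega>)" if "\<omega> \<in> space N" for \<omega>
    by unfold_locales (rule rc[OF that])
  have joint [measurable (raw)]: "(\<lambda>x. \<zeta> (max 0 (f x)) (g x)) \<in> borel_measurable L"
    if "f \<in> borel_measurable L" "g \<in> measurable L N" for f g L
    using measurable_compose[OF measurable_Pair[OF that] measurable_right_continuous_process[of \<zeta> N]] m rc by simp
  have [measurable]: "(\<lambda>\<omega>. tau0 (\<lambda>r. \<zeta> r \<omega>)) \<in> borel_measurable N"
    unfolding tau0_def
  proof (rule measurable_Inf_image_right_open)
    fix u \<omega> assume "\<omega> \<in> space N" "0 \<le> u" "\<zeta> u \<omega> < 0"
    then show "\<exists>e>u. \<forall>v. u \<le> v \<longrightarrow> v < e \<longrightarrow> \<zeta> v \<omega> < 0"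
      using right_continuous_less_nbhd[OF rc, of \<omega> u 0] by metis
  next
    fix u :: real assume "0 \<le> u"
    from m[OF this] show "Measurable.pred N (\<lambda>\<omega>. \<zeta> u \<omega> < 0)" by measurable
  qed (intro tendsto_intros)
  have [measurable]: "(\<lambda>\<omega>. eta R (\<lambda>r. \<zeta> r \<omega>) s) \<in> borel_measurable N" for s
  proof -
    have "(\<lambda>\<omega>. \<integral>\<^sup>+ r. of_bool (0 \<le> r \<and> r \<le> s \<and> ereal r \<le> tau0 (\<lambda>r. \<zeta> r \<omega>)) * inverse (ennreal (R (max 0 (\<zeta> (max 0 r) \<omega>)))) \<partial>lborel) \<in> borel_measurable N"
      unfolding of_bool_def by measurable
    then show ?thesis
      by (rule measurable_cong[THEN iffD1, rotated]) (simp add: rate_path.eta_alt[OF path])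
  qed
  have [measurable]: "(\<lambda>\<omega>. eta_inv R (\<lambda>r. \<zeta> r \<omega>) t) \<in> borel_measurable N"
    unfolding eta_inv_def setcompr_eq_image
  proof (rule measurable_Inf_image_right_open)
    fix u \<omega> assume "\<omega> \<in> space N" "0 \<le> u" "ennreal t < eta R (\<lambda>r. \<zeta> r \<omega>) u"
    then show "\<exists>e>u. \<forall>v. u \<le> v \<longrightarrow> v < e \<longrightarrow> ennreal t < eta R (\<lambda>r. \<zeta> r \<omega>) v"
      using rate_path.eta_mono[OF path] by (intro exI[of _ "u + 1"]) (auto intro: less_le_trans)
  qed (auto intro!: tendsto_intros)
  have "(\<lambda>\<omega>. \<zeta> (max 0 (real_of_ereal (min (eta_inv R (\<lambda>r. \<zeta> r \<omega>) t) (tau0 (\<lambda>r. \<zeta> r \<omega>))))) \<omega>) \<in> borel_measurable N"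
    by measurable
  then show ?thesis
  proof (rule measurable_cong[THEN iffD1, rotated])
    fix \<omega> assume w: "\<omega> \<in> space N"
    have "0 \<le> real_of_ereal (min (eta_inv R (\<lambda>r. \<zeta> r \<omega>) t) (tau0 (\<lambda>r. \<zeta> r \<omega>)))"
      using rate_path.eta_inv_nonneg[OF path[OF w]] rate_path.tau0_nonneg[OF path[OF w]] by (intro real_of_ereal_pos) auto
    then show "\<zeta> (max 0 (real_of_ereal (min (eta_inv R (\<lambda>r. \<zeta> r \<omega>) t) (tau0 (\<lambda>r. \<zeta> r \<omega>))))) \<omega> = Xpath R (\<lambda>r. \<zeta> r \<omega>) t"
      by (simp add: Xpath_def max_def)
  qed
qed

section \<open>The process started at infinity\<close>

text \<open>The value infinity is included because finiteness of passage times is itself deduced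
  from their moments.\<close>

lemma layer_cake_first:
  "(\<integral>\<^sup>+ t. of_bool (0 < t \<and> ennreal t \<le> s) \<partial>lborel) = s"
proof (cases s rule: ennreal_cases)
  case (real r)
  have "(\<integral>\<^sup>+ t. of_bool (0 < t \<and> ennreal t \<le> s) \<partial>lborel) = (\<integral>\<^sup>+ t. indicator {0<..r} t \<partial>lborel)"
    using real by (intro nn_integral_cong) (auto simp: indicator_def ennreal_le_iff2)
  then show ?thesis using real by simp
next
  case top
  have "(\<integral>\<^sup>+ t. of_bool (0 < t \<and> ennreal t \<le> s) \<partial>lborel) = (\<integral>\<^sup>+ t. indicator {0<..} t \<partial>(lborel :: real measure))"
    using top by (intro nn_integral_cong) (auto simp: indicator_def)
  moreover have "emeasure lborel {0 :: real<..} = \<infinity>"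
  proof (rule ccontr)
    assume "emeasure lborel {0 :: real<..} \<noteq> \<infinity>"
    then obtain c where c: "emeasure lborel {0 :: real<..} = ennreal c" "c \<ge> 0"
      by (cases "emeasure lborel {0 :: real<..}" rule: ennreal_cases) auto
    have "emeasure lborel {0<..c + 1} \<le> emeasure lborel {0 :: real<..}" by (intro emeasure_mono) auto
    with c show False by simp
  qed
  ultimately show ?thesis using top by simp
qed

lemma layer_cake_second:
  "(\<integral>\<^sup>+ t. ennreal (2 * t) * of_bool (0 < t \<and> ennreal t \<le> s) \<partial>lborel) = s\<^sup>2" (is "?I s = _")
proof -
  have real: "?I (ennreal r) = ennreal (r\<^sup>2)" if r: "0 \<le> r" for r
  proof -
    have "?I (ennreal r) = (\<integral>\<^sup>+ t. ennreal (2 * t) * indicator {0..r} t \<partial>lborel)"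
      using r by (intro nn_integral_cong) (auto simp: indicator_def ennreal_le_iff2 ennreal_neg)
    also have "\<dots> = ennreal (r\<^sup>2 - 0\<^sup>2)"
      using r by (intro nn_integral_FTC_Icc) (auto intro!: derivative_eq_intros)
    finally show ?thesis by simp
  qed
  show ?thesis
  proof (cases s rule: ennreal_cases)
    case (real r)
    then show ?thesis using \<open>0 \<le> r \<Longrightarrow> ?I (ennreal r) = ennreal (r\<^sup>2)\<close> by (simp add: ennreal_power)
  next
    case top
    have le: "ennreal (r\<^sup>2) \<le> ?I s" if "0 \<le> r" for r
      unfolding real[OF that, symmetric] using top by (intro nn_integral_mono mult_left_mono) auto
    have "?I s = \<top>"
    proof (rule ccontr)
      assume "?I s \<noteq> \<top>"
      then obtain c where c: "?I s = ennreal c" "0 \<le> c" by (cases "?I s" rule: ennreal_cases) auto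
      have "(c + 1)\<^sup>2 \<le> c" using le[of "c + 1"] c by simp
      then show False using c(2) by (simp add: power2_eq_square algebra_simps) (smt (verit) mult_nonneg_nonneg)
    qed
    then show ?thesis using top by (simp add: power2_eq_square)
  qed
qed

text \<open>An extended counterpart of \<open>T_below\<close>: a level that is never passed gives
  infinity here, whereas the real infimum of the empty set carries no information.\<close>

definition first_passage :: "(real \<Rightarrow> ereal) \<Rightarrow> real \<Rightarrow> ennreal" where
  "first_passage y b = Inf (ennreal ` {u. 0 \<le> u \<and> y u < ereal b})"

lemma first_passage_le: "0 \<le> u \<Longrightarrow> y u < ereal b \<Longrightarrow> first_passage y b \<le> ennreal u"
  unfolding first_passage_def by (intro Inf_lower) auto

lemma first_passage_ge: "(\<And>u. 0 \<le> u \<Longrightarrow> y u < ereal b \<Longrightarrow> c \<le> ennreal u) \<Longrightarrow> c \<le> first_passage y b"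
  unfolding first_passage_def by (intro Inf_greatest) auto

lemma le_first_passage_iff:
  assumes "0 \<le> t" and rc: "\<And>t. 0 \<le> t \<Longrightarrow> continuous (at_right t) y"
  shows "ennreal t \<le> first_passage y b
    \<longleftrightarrow> (\<forall>q::rat. 0 \<le> (of_rat q :: real) \<longrightarrow> of_rat q < t \<longrightarrow> ereal b \<le> y (of_rat q))"
proof -
  have "ennreal t \<le> first_passage y b \<longleftrightarrow> (\<forall>u\<ge>0. u < t \<longrightarrow> ereal b \<le> y u)"
    unfolding first_passage_def le_Inf_iff using assms(1) by (force simp: ennreal_le_iff2 not_le[symmetric])
  also have "\<dots> \<longleftrightarrow> (\<forall>q::rat. 0 \<le> (of_rat q :: real) \<longrightarrow> of_rat q < t \<longrightarrow> ereal b \<le> y (of_rat q))"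
    by (rule right_continuous_all_ge_iff_rat[OF rc])
  finally show ?thesis .
qed

lemma T_below_eq: "first_passage (\<lambda>t. Y t \<omega>) b < \<top> \<Longrightarrow> T_below Y b \<omega> = enn2real (first_passage (\<lambda>t. Y t \<omega>) b)"
proof -
  let ?S = "{t. 0 \<le> t \<and> Y t \<omega> < ereal b}"
  assume f: "first_passage (\<lambda>t. Y t \<omega>) b < \<top>"
  then have ne: "?S \<noteq> {}" unfolding first_passage_def by (metis image_is_empty Inf_empty less_irrefl)
  have bdd: "bdd_below ?S" by (rule bdd_belowI[of _ 0]) auto
  have T0: "0 \<le> T_below Y b \<omega>" unfolding T_below_def using ne by (intro cInf_greatest) auto
  have "first_passage (\<lambda>t. Y t \<omega>) b = ennreal (T_below Y b \<omega>)"
  proof (rule antisym)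
    show "ennreal (T_below Y b \<omega>) \<le> first_passage (\<lambda>t. Y t \<omega>) b"
      unfolding T_below_def by (intro first_passage_ge ennreal_leI cInf_lower bdd) auto
    obtain c where c: "first_passage (\<lambda>t. Y t \<omega>) b = ennreal c" "0 \<le> c" using f by (cases "first_passage (\<lambda>t. Y t \<omega>) b" rule: ennreal_cases) auto
    have "c \<le> t" if "t \<in> ?S" for t
      using first_passage_le[of t "\<lambda>t. Y t \<omega>" b] that c by auto
    then have "c \<le> T_below Y b \<omega>" unfolding T_below_def using ne by (intro cInf_greatest) auto
    then show "first_passage (\<lambda>t. Y t \<omega>) b \<le> ennreal (T_below Y b \<omega>)" using c by (simp add: ennreal_leI)
  qed
  with T0 show ?thesis by simp
qed

locale entrance = levy_scale \<gamma> \<sigma> \<pi> M Z W + rate R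
  for \<gamma> \<sigma> :: real and \<pi> :: "real measure" and M :: "'a measure" and Z W R +
  fixes N :: "'b measure" and F :: "real \<Rightarrow> 'b measure" and Y :: "real \<Rightarrow> 'b \<Rightarrow> ereal" and b :: real
  assumes from_infty: "entrance_process M Z R N F Y" and b_pos: "b > 0"
begin

sublocale N: prob_space N
  using from_infty by (simp add: entrance_process_def)

lemma F_sets: "sets (F t) \<subseteq> sets N" and F_space: "space (F t) = space N"
  and F_mono: "s \<le> t \<Longrightarrow> sets (F s) \<subseteq> sets (F t)"
  and Y_adapted: "Y t \<in> borel_measurable (F t)"
  and Y_0: "\<omega> \<in> space N \<Longrightarrow> Y 0 \<omega> = \<infinity>"
  and Y_finite: "\<omega> \<in> space N \<Longrightarrow> t > 0 \<Longrightarrow> Y t \<omega> < \<infinity>"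
  and Y_rc: "\<omega> \<in> space N \<Longrightarrow> t \<ge> 0 \<Longrightarrow> continuous (at_right t) (\<lambda>t. Y t \<omega>)"
  using from_infty by (auto simp: entrance_process_def cadlag_def)

lemma measurable_Y [measurable]: "Y t \<in> borel_measurable N"
proof (rule measurableI)
  fix B :: "ereal set" assume "B \<in> sets borel"
  then have "Y t -` B \<inter> space (F t) \<in> sets (F t)" by (rule measurable_sets[OF Y_adapted])
  then show "Y t -` B \<inter> space N \<in> sets N" using F_sets F_space by auto
qed simp

lemma Y_shift_rc:
  assumes w: "\<omega> \<in> space N" and e: "0 \<le> e" and t: "0 \<le> t"
  shows "continuous (at_right t) (\<lambda>u. Y (e + u) \<omega>)"
proof -
  have "filterlim (\<lambda>u. e + u) (at_right (e + t)) (at_right t)"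
    unfolding filterlim_at by (auto intro!: tendsto_intros simp: eventually_at_filter)
  moreover have "((\<lambda>t. Y t \<omega>) \<longlongrightarrow> Y (e + t) \<omega>) (at_right (e + t))"
    using Y_rc[OF w, of "e + t"] e t by (simp add: continuous_within)
  ultimately show ?thesis unfolding continuous_within by (rule filterlim_compose[rotated])
qed

text \<open>Staying above the level at all positive integer times is at most as likely as being
  above it at time n, for each n, and this probability tends to 0.\<close>

lemma AE_goes_below: "AE \<omega> in M. \<exists>w\<ge>0. x + Z w \<omega> < b"
proof -
  let ?B = "{\<omega>\<in>space M. \<forall>n. b - x \<le> Z (real (Suc n)) \<omega>}"
  have "measure M ?B \<le> measure M {\<omega>\<in>space M. b - x \<le> Z (real (Suc n)) \<omega>}" for n
    by (intro finite_measure_mono) auto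
  then have "measure M ?B \<le> 0"
    by (intro LIMSEQ_le_const[OF drift_to_minus_infinity[of "b - x"]]) auto
  then have "measure M ?B = 0" using measure_nonneg[of M ?B] by linarith
  then have "AE \<omega> in M. \<not> (\<forall>n. b - x \<le> Z (real (Suc n)) \<omega>)"
    by (subst AE_iff_measurable[OF _ refl]) (auto simp: emeasure_eq_measure)
  then show ?thesis
  proof eventually_elim
    fix \<omega> assume "\<not> (\<forall>n. b - x \<le> Z (real (Suc n)) \<omega>)"
    then obtain n where "Z (real (Suc n)) \<omega> < b - x" by (auto simp: not_le)
    then show "\<exists>w\<ge>0. x + Z w \<omega> < b" by (intro exI[of _ "real (Suc n)"]) auto
  qed
qed

abbreviation "rt \<equiv> inv_rate R b"
abbreviation "life \<equiv> killed_occ rt b"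

lemma measurable_rt [measurable]: "rt \<in> borel_measurable borel"
  by (rule measurable_inv_rate[OF b_pos])

lemma AE_Xfrom_above_iff:
  assumes t: "0 \<le> t"
  shows "AE \<omega> in M. (\<forall>q::rat. 0 \<le> (of_rat q :: real) \<longrightarrow> of_rat q < t \<longrightarrow> b \<le> Xfrom R Z x \<omega> (of_rat q))
    \<longleftrightarrow> ennreal t \<le> life x \<omega>"
  using AE_goes_below[of x]
proof (rule AE_mp, intro AE_I2 impI)
  fix \<omega> assume w: "\<omega> \<in> space M" and below: "\<exists>w\<ge>0. x + Z w \<omega> < b"
  interpret rate_path_level R "\<lambda>r. x + Z r \<omega>" b
    by unfold_locales (auto intro!: continuous_intros Z_right_cont w b_pos)
  have "lifetime = life x \<omega>"
    unfolding lifetime_def killed_occ_def J_def above_def ..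
  then show "(\<forall>q::rat. 0 \<le> (of_rat q :: real) \<longrightarrow> of_rat q < t \<longrightarrow> b \<le> Xfrom R Z x \<omega> (of_rat q))
    \<longleftrightarrow> ennreal t \<le> life x \<omega>"
    using Xpath_above_iff[OF t below] by (simp add: Xfrom_def)
qed

lemma measurable_Xfrom [measurable (raw)]:
  assumes "f \<in> borel_measurable L" "g \<in> measurable L M"
  shows "(\<lambda>p. Xfrom R Z (f p) (g p) u) \<in> borel_measurable L"
proof -
  have "(\<lambda>p. Xpath R (\<lambda>r. fst p + Z r (snd p)) u) \<in> borel_measurable (borel \<Otimes>\<^sub>M M)"
  proof (rule measurable_Xpath)
    show "rate R" by unfold_locales
    show "continuous (at_right t) (\<lambda>t. fst p + Z t (snd p))" if "p \<in> space (borel \<Otimes>\<^sub>M M)" "0 \<le> t" for p t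
      using that by (intro continuous_intros Z_right_cont) (auto simp: space_pair_measure)
  qed measurable
  from measurable_compose[OF measurable_Pair[OF assms] this] show ?thesis
    by (simp add: Xfrom_def)
qed

lemma measurable_life [measurable (raw)]:
  assumes "f \<in> borel_measurable L" "g \<in> measurable L M"
  shows "(\<lambda>p. life (f p) (g p)) \<in> borel_measurable L"
  using measurable_compose[OF measurable_Pair[OF assms] measurable_killed_occ(1)[OF measurable_rt]] by simp

definition surv :: "real \<Rightarrow> real \<Rightarrow> ennreal" where
  "surv t x = (\<integral>\<^sup>+ \<omega>. of_bool (ennreal t \<le> life x \<omega>) \<partial>M)"

lemma markov_at:
  fixes n :: nat and u :: "nat \<Rightarrow> real"
  assumes e: "0 < e" and A: "A \<in> sets (F e)" and u: "\<And>i. 0 \<le> u i"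
  shows "emeasure N {\<omega>\<in>A. \<forall>i<n. ereal b \<le> Y (e + u i) \<omega>}
    = (\<integral>\<^sup>+ \<omega>. (\<integral>\<^sup>+ \<omega>'. of_bool (\<forall>i<n. b \<le> Xfrom R Z (real_of_ereal (Y e \<omega>)) \<omega>' (u i)) \<partial>M) * indicator A \<omega> \<partial>N)"
proof -
  have st: "stopping_time_ext N F (\<lambda>_. ereal e)"
    unfolding stopping_time_ext_def
  proof (intro conjI allI ballI)
    fix t
    show "{\<omega> \<in> space N. ereal e \<le> ereal t} \<in> sets (F t)"
      using sets.top[of "F t"] F_space[of t] by (cases "e \<le> t") auto
  qed (use e in simp)
  have AN: "A \<in> sets N" using A F_sets by blast
  have As: "A \<in> stopped_sets N F (\<lambda>_. ereal e)"
    unfolding stopped_sets_def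
  proof (intro CollectI conjI allI AN)
    fix t
    show "{\<omega> \<in> A. ereal e \<le> ereal t} \<in> sets (F t)"
      using A F_mono[of e t] by (cases "e \<le> t") auto
  qed
  have AS: "\<omega> \<in> space N" if "\<omega> \<in> A" for \<omega> using that AN sets.sets_into_space by blast
  have sm: "\<forall>\<tau>. stopping_time_ext N F \<tau> \<longrightarrow>
        (\<forall>A\<in>stopped_sets N F \<tau>. \<forall>(n::nat) (u::nat \<Rightarrow> real) (B::nat \<Rightarrow> real set).
           (\<forall>i. 0 \<le> u i) \<longrightarrow> (\<forall>i. B i \<in> sets borel) \<longrightarrow>
           emeasure N {\<omega>\<in>A. \<tau> \<omega> < \<infinity> \<and> Y (real_of_ereal (\<tau> \<omega>)) \<omega> < \<infinity> \<and>
               (\<forall>i<n. Y (real_of_ereal (\<tau> \<omega>) + u i) \<omega> \<in> ereal ` B i)}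
           = (\<integral>\<^sup>+ \<omega> \<in> {\<omega>\<in>A. \<tau> \<omega> < \<infinity> \<and> Y (real_of_ereal (\<tau> \<omega>)) \<omega> < \<infinity>}.
                emeasure M {\<omega>'\<in>space M. \<forall>i<n.
                   Xfrom R Z (real_of_ereal (Y (real_of_ereal (\<tau> \<omega>)) \<omega>)) \<omega>' (u i) \<in> B i} \<partial>N))"
    using from_infty by (simp add: entrance_process_def)
  have "emeasure N {\<omega>\<in>A. ereal e < \<infinity> \<and> Y e \<omega> < \<infinity> \<and> (\<forall>i<n. Y (e + u i) \<omega> \<in> ereal ` {b..})}
     = (\<integral>\<^sup>+ \<omega> \<in> {\<omega>\<in>A. ereal e < \<infinity> \<and> Y e \<omega> < \<infinity>}. emeasure M {\<omega>'\<in>space M. \<forall>i<n. Xfrom R Z (real_of_ereal (Y e \<omega>)) \<omega>' (u i) \<in> {b..}} \<partial>N)"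
    using sm[rule_format, OF st As, of u "\<lambda>_. {b..}" n] u by simp
  moreover have "{\<omega>\<in>A. ereal e < \<infinity> \<and> Y e \<omega> < \<infinity>} = A" using AS Y_finite[OF _ e] by auto
  moreover have "(Y (e + u i) \<omega> \<in> ereal ` {b..}) \<longleftrightarrow> ereal b \<le> Y (e + u i) \<omega>" if "\<omega> \<in> A" for \<omega> i
    using Y_finite[OF AS[OF that], of "e + u i"] e u[of i] by (cases "Y (e + u i) \<omega>") (auto simp: add_pos_nonneg)
  then have "{\<omega>\<in>A. ereal e < \<infinity> \<and> Y e \<omega> < \<infinity> \<and> (\<forall>i<n. Y (e + u i) \<omega> \<in> ereal ` {b..})} = {\<omega>\<in>A. \<forall>i<n. ereal b \<le> Y (e + u i) \<omega>}"
    using AS Y_finite[OF _ e] by auto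
  moreover have "emeasure M {\<omega>'\<in>space M. \<forall>i<n. Xfrom R Z x \<omega>' (u i) \<in> {b..}} = (\<integral>\<^sup>+ \<omega>'. of_bool (\<forall>i<n. b \<le> Xfrom R Z x \<omega>' (u i)) \<partial>M)" for x
  proof -
    have "emeasure M {\<omega>'\<in>space M. \<forall>i<n. Xfrom R Z x \<omega>' (u i) \<in> {b..}} = (\<integral>\<^sup>+ \<omega>'. indicator {\<omega>'\<in>space M. \<forall>i<n. Xfrom R Z x \<omega>' (u i) \<in> {b..}} \<omega>' \<partial>M)"
      by (rule nn_integral_indicator[symmetric]) measurable
    also have "\<dots> = (\<integral>\<^sup>+ \<omega>'. of_bool (\<forall>i<n. b \<le> Xfrom R Z x \<omega>' (u i)) \<partial>M)"
      by (intro nn_integral_cong) (auto simp: indicator_def)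
    finally show ?thesis .
  qed
  ultimately show ?thesis by simp
qed

text \<open>An enumeration of the rationals in [0, t) turns survival into a decreasing sequence of
  conditions at finitely many times, each handled by \<open>markov_at\<close>. Both sides pass to
  the limit by continuity from above and decreasing monotone convergence.\<close>

lemma markov_survival:
  assumes e: "0 < e" and A: "A \<in> sets (F e)" and t: "0 < t"
  shows "emeasure N {\<omega>\<in>A. ennreal t \<le> first_passage (\<lambda>u. Y (e + u) \<omega>) b}
    = (\<integral>\<^sup>+ \<omega>. surv t (real_of_ereal (Y e \<omega>)) * indicator A \<omega> \<partial>N)"
proof -
  define C :: "real set" where "C = {of_rat q | q. 0 \<le> (of_rat q :: real) \<and> of_rat q < t}"
  have C: "countable C" unfolding C_def by (rule countable_subset[of _ "range of_rat"]) auto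
  have ne: "C \<noteq> {}" using t unfolding C_def by (auto intro!: exI[of _ 0])
  define u where "u = from_nat_into C"
  have ru: "range u = C" unfolding u_def using range_from_nat_into[OF ne C] .
  have u0: "0 \<le> u i" for i
  proof -
    have "u i \<in> C" using ru by blast
    then show ?thesis unfolding C_def by auto
  qed
  have all_C: "(\<forall>i. Q (u i)) \<longleftrightarrow> (\<forall>q::rat. 0 \<le> (of_rat q :: real) \<longrightarrow> of_rat q < t \<longrightarrow> Q (of_rat q))" for Q
  proof -
    have "(\<forall>i. Q (u i)) \<longleftrightarrow> (\<forall>c\<in>range u. Q c)" by simp
    also have "\<dots> \<longleftrightarrow> (\<forall>q::rat. 0 \<le> (of_rat q :: real) \<longrightarrow> of_rat q < t \<longrightarrow> Q (of_rat q))"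
      unfolding ru C_def by (simp only: Ball_def mem_Collect_eq) blast
    finally show ?thesis .
  qed
  have AN [measurable]: "A \<in> sets N" using A F_sets by blast
  have AS: "\<omega> \<in> space N" if "\<omega> \<in> A" for \<omega> using that AN sets.sets_into_space by blast
  define I where "I n x = (\<integral>\<^sup>+ \<omega>'. of_bool (\<forall>i<n. b \<le> Xfrom R Z x \<omega>' (u i)) \<partial>M)" for n :: nat and x
  have [measurable]: "I n \<in> borel_measurable borel" for n unfolding I_def of_bool_def by measurable
  have I_inf: "(INF n. I n x) = surv t x" for x
  proof -
    have "(INF n. I n x) = (\<integral>\<^sup>+ \<omega>'. (INF n. of_bool (\<forall>i<n. b \<le> Xfrom R Z x \<omega>' (u i))) \<partial>M)"
      unfolding I_def
    proof (rule nn_integral_monotone_convergence_INF_decseq[symmetric])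
      show "decseq (\<lambda>n \<omega>'. of_bool (\<forall>i<n. b \<le> Xfrom R Z x \<omega>' (u i)) :: ennreal)"
        unfolding decseq_def by (auto simp: le_fun_def)
      show "(\<lambda>\<omega>'. of_bool (\<forall>i<n. b \<le> Xfrom R Z x \<omega>' (u i)) :: ennreal) \<in> borel_measurable M" for n
        unfolding of_bool_def by measurable
      have "(\<integral>\<^sup>+ \<omega>'. of_bool (\<forall>i<0. b \<le> Xfrom R Z x \<omega>' (u i)) \<partial>M) \<le> (\<integral>\<^sup>+ \<omega>'. 1 \<partial>M)" by (intro nn_integral_mono) auto
      also have "\<dots> < \<infinity>" by (simp add: emeasure_space_1)
      finally show "(\<integral>\<^sup>+ \<omega>'. of_bool (\<forall>i<0. b \<le> Xfrom R Z x \<omega>' (u i)) \<partial>M) < \<infinity>" .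
    qed
    also have "\<dots> = surv t x"
      unfolding surv_def
    proof (rule nn_integral_cong_AE)
      show "AE \<omega>' in M. (INF n. of_bool (\<forall>i<n. b \<le> Xfrom R Z x \<omega>' (u i))) = (of_bool (ennreal t \<le> life x \<omega>') :: ennreal)"
        using AE_Xfrom_above_iff[OF less_imp_le[OF t], of x]
      proof eventually_elim
        fix \<omega>'
        assume "(\<forall>q::rat. 0 \<le> (of_rat q :: real) \<longrightarrow> of_rat q < t \<longrightarrow> b \<le> Xfrom R Z x \<omega>' (of_rat q)) \<longleftrightarrow> ennreal t \<le> life x \<omega>'"
        then have iff: "(\<forall>i. b \<le> Xfrom R Z x \<omega>' (u i)) \<longleftrightarrow> ennreal t \<le> life x \<omega>'"
          using all_C[of "\<lambda>r. b \<le> Xfrom R Z x \<omega>' r"] by simp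
        show "(INF n. of_bool (\<forall>i<n. b \<le> Xfrom R Z x \<omega>' (u i))) = (of_bool (ennreal t \<le> life x \<omega>') :: ennreal)"
        proof (cases "\<forall>i. b \<le> Xfrom R Z x \<omega>' (u i)")
          case True
          then show ?thesis using iff by simp
        next
          case False
          then obtain i where i: "\<not> b \<le> Xfrom R Z x \<omega>' (u i)" by blast
          have "(INF n. of_bool (\<forall>i<n. b \<le> Xfrom R Z x \<omega>' (u i))) \<le> (0 :: ennreal)"
            by (rule INF_lower2[of "Suc i"]) (use i in auto)
          then show ?thesis using iff False by simp
        qed
      qed
    qed
    finally show ?thesis .
  qed
  have "emeasure N {\<omega>\<in>A. ennreal t \<le> first_passage (\<lambda>u. Y (e + u) \<omega>) b} = emeasure N (\<Inter>n. {\<omega>\<in>A. \<forall>i<n. ereal b \<le> Y (e + u i) \<omega>})"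
  proof (rule arg_cong[where f="emeasure N"])
    have "ennreal t \<le> first_passage (\<lambda>u. Y (e + u) \<omega>) b \<longleftrightarrow> (\<forall>i. ereal b \<le> Y (e + u i) \<omega>)" if "\<omega> \<in> A" for \<omega>
      using le_first_passage_iff[of t "\<lambda>u. Y (e + u) \<omega>" b] Y_shift_rc[OF AS[OF that]] e t all_C[of "\<lambda>r. ereal b \<le> Y (e + r) \<omega>"] by simp
    then show "{\<omega>\<in>A. ennreal t \<le> first_passage (\<lambda>u. Y (e + u) \<omega>) b} = (\<Inter>n. {\<omega>\<in>A. \<forall>i<n. ereal b \<le> Y (e + u i) \<omega>})"
      by auto
  qed
  also have "\<dots> = (INF n. emeasure N {\<omega>\<in>A. \<forall>i<n. ereal b \<le> Y (e + u i) \<omega>})"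
  proof (rule INF_emeasure_decseq[symmetric])
    show "range (\<lambda>n. {\<omega>\<in>A. \<forall>i<n. ereal b \<le> Y (e + u i) \<omega>}) \<subseteq> sets N"
    proof (rule image_subsetI)
      fix n
      have "{\<omega>\<in>A. \<forall>i<n. ereal b \<le> Y (e + u i) \<omega>} = A \<inter> {\<omega>\<in>space N. \<forall>i<n. ereal b \<le> Y (e + u i) \<omega>}" using AS by auto
      also have "\<dots> \<in> sets N" by measurable
      finally show "{\<omega>\<in>A. \<forall>i<n. ereal b \<le> Y (e + u i) \<omega>} \<in> sets N" .
    qed
  qed (auto simp: decseq_def)
  also have "\<dots> = (INF n. \<integral>\<^sup>+ \<omega>. I n (real_of_ereal (Y e \<omega>)) * indicator A \<omega> \<partial>N)"
    unfolding I_def by (simp add: markov_at[OF e A u0])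
  also have "\<dots> = (\<integral>\<^sup>+ \<omega>. (INF n. I n (real_of_ereal (Y e \<omega>)) * indicator A \<omega>) \<partial>N)"
  proof (rule nn_integral_monotone_convergence_INF_decseq[symmetric])
    have "decseq (\<lambda>n. I n x)" for x
      unfolding I_def decseq_def by (auto intro!: nn_integral_mono)
    then show "decseq (\<lambda>n \<omega>. I n (real_of_ereal (Y e \<omega>)) * indicator A \<omega>)"
      unfolding decseq_def by (auto simp: le_fun_def intro!: mult_right_mono)
    have "(\<integral>\<^sup>+ \<omega>. I 0 (real_of_ereal (Y e \<omega>)) * indicator A \<omega> \<partial>N) \<le> (\<integral>\<^sup>+ \<omega>. 1 \<partial>N)"
      by (intro nn_integral_mono) (auto simp: I_def emeasure_space_1 indicator_def)
    also have "\<dots> < \<infinity>" by (simp add: N.emeasure_space_1)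
    finally show "(\<integral>\<^sup>+ \<omega>. I 0 (real_of_ereal (Y e \<omega>)) * indicator A \<omega> \<partial>N) < \<infinity>" .
  qed measurable
  also have "\<dots> = (\<integral>\<^sup>+ \<omega>. surv t (real_of_ereal (Y e \<omega>)) * indicator A \<omega> \<partial>N)"
    unfolding I_inf[symmetric] by (intro nn_integral_cong) (auto simp: indicator_def)
  finally show ?thesis .
qed

lemma measurable_first_passage:
  assumes e: "0 \<le> e"
  shows "(\<lambda>\<omega>. first_passage (\<lambda>u. Y (e + u) \<omega>) b) \<in> borel_measurable N"
  unfolding first_passage_def
proof (rule measurable_Inf_image_right_open)
  fix u \<omega> assume "\<omega> \<in> space N" "0 \<le> u" "Y (e + u) \<omega> < ereal b"
  then show "\<exists>e'>u. \<forall>v. u \<le> v \<longrightarrow> v < e' \<longrightarrow> Y (e + v) \<omega> < ereal b"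
    using right_continuous_less_nbhd[OF Y_shift_rc[OF _ e], of \<omega> u "ereal b"] by metis
qed (auto intro!: tendsto_ennrealI tendsto_ident_at)

text \<open>The survival identity integrated against w(t) dt; by the layer cake formulas the weights
  1 and 2 t yield the first two moments.\<close>

lemma markov_layer:
  assumes e: "0 < e" and A: "A \<in> sets (F e)" and w [measurable]: "w \<in> borel_measurable borel"
  shows "(\<integral>\<^sup>+ \<omega>. (\<integral>\<^sup>+ t. w t * of_bool (0 < t \<and> ennreal t \<le> first_passage (\<lambda>u. Y (e + u) \<omega>) b) \<partial>lborel) * indicator A \<omega> \<partial>N)
    = (\<integral>\<^sup>+ \<omega>. (\<integral>\<^sup>+ \<omega>'. \<integral>\<^sup>+ t. w t * of_bool (0 < t \<and> ennreal t \<le> life (real_of_ereal (Y e \<omega>)) \<omega>') \<partial>lborel \<partial>M) * indicator A \<omega> \<partial>N)"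
proof -
  interpret LM: pair_sigma_finite lborel M ..
  interpret LN: pair_sigma_finite lborel N ..
  define S where "S \<omega> = first_passage (\<lambda>u. Y (e + u) \<omega>) b" for \<omega>
  have [measurable]: "S \<in> borel_measurable N" unfolding S_def using e by (intro measurable_first_passage) simp
  have AN [measurable]: "A \<in> sets N" using A F_sets by blast
  have AS: "\<omega> \<in> space N" if "\<omega> \<in> A" for \<omega> using that AN sets.sets_into_space by blast
  have [measurable]: "(\<lambda>p. surv (f p) (g p)) \<in> borel_measurable L" if [measurable]: "f \<in> borel_measurable L" "g \<in> borel_measurable L" for f g and L :: "'z measure"
    unfolding surv_def of_bool_def by measurable
  have "(\<integral>\<^sup>+ \<omega>. (\<integral>\<^sup>+ t. w t * of_bool (0 < t \<and> ennreal t \<le> S \<omega>) \<partial>lborel) * indicator A \<omega> \<partial>N)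
    = (\<integral>\<^sup>+ \<omega>. \<integral>\<^sup>+ t. w t * of_bool (0 < t \<and> ennreal t \<le> S \<omega>) * indicator A \<omega> \<partial>lborel \<partial>N)"
    unfolding of_bool_def by (intro nn_integral_cong nn_integral_multc[symmetric]) measurable
  also have "\<dots> = (\<integral>\<^sup>+ t. \<integral>\<^sup>+ \<omega>. w t * of_bool (0 < t \<and> ennreal t \<le> S \<omega>) * indicator A \<omega> \<partial>N \<partial>lborel)"
    unfolding of_bool_def by (rule LN.Fubini') measurable
  also have "\<dots> = (\<integral>\<^sup>+ t. \<integral>\<^sup>+ \<omega>. w t * of_bool (0 < t) * surv t (real_of_ereal (Y e \<omega>)) * indicator A \<omega> \<partial>N \<partial>lborel)"
  proof (rule nn_integral_cong)
    fix t :: real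
    show "(\<integral>\<^sup>+ \<omega>. w t * of_bool (0 < t \<and> ennreal t \<le> S \<omega>) * indicator A \<omega> \<partial>N)
      = (\<integral>\<^sup>+ \<omega>. w t * of_bool (0 < t) * surv t (real_of_ereal (Y e \<omega>)) * indicator A \<omega> \<partial>N)"
    proof (cases "0 < t")
      case True
      have eq: "{\<omega>\<in>A. ennreal t \<le> S \<omega>} = A \<inter> {\<omega>\<in>space N. ennreal t \<le> S \<omega>}" using AS by auto
      have m: "{\<omega>\<in>A. ennreal t \<le> S \<omega>} \<in> sets N" unfolding eq by measurable
      have "(\<integral>\<^sup>+ \<omega>. w t * of_bool (0 < t \<and> ennreal t \<le> S \<omega>) * indicator A \<omega> \<partial>N)
        = (\<integral>\<^sup>+ \<omega>. w t * indicator {\<omega>\<in>A. ennreal t \<le> S \<omega>} \<omega> \<partial>N)"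
        using True by (intro nn_integral_cong) (auto simp: indicator_def)
      also have "\<dots> = w t * emeasure N {\<omega>\<in>A. ennreal t \<le> S \<omega>}" by (rule nn_integral_cmult_indicator[OF m])
      also have "\<dots> = w t * (\<integral>\<^sup>+ \<omega>. surv t (real_of_ereal (Y e \<omega>)) * indicator A \<omega> \<partial>N)"
        unfolding S_def markov_survival[OF e A True] ..
      also have "\<dots> = (\<integral>\<^sup>+ \<omega>. w t * of_bool (0 < t) * surv t (real_of_ereal (Y e \<omega>)) * indicator A \<omega> \<partial>N)"
        using True by (subst nn_integral_cmult[symmetric]) (auto simp: mult.assoc)
      finally show ?thesis .
    qed simp
  qed
  also have "\<dots> = (\<integral>\<^sup>+ \<omega>. \<integral>\<^sup>+ t. w t * of_bool (0 < t) * surv t (real_of_ereal (Y e \<omega>)) * indicator A \<omega> \<partial>lborel \<partial>N)"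
    unfolding of_bool_def by (rule LN.Fubini'[symmetric]) measurable
  also have "\<dots> = (\<integral>\<^sup>+ \<omega>. (\<integral>\<^sup>+ t. w t * of_bool (0 < t) * surv t (real_of_ereal (Y e \<omega>)) \<partial>lborel) * indicator A \<omega> \<partial>N)"
    unfolding of_bool_def by (intro nn_integral_cong nn_integral_multc) measurable
  also have "(\<lambda>\<omega>. \<integral>\<^sup>+ t. w t * of_bool (0 < t) * surv t (real_of_ereal (Y e \<omega>)) \<partial>lborel)
    = (\<lambda>\<omega>. \<integral>\<^sup>+ \<omega>'. \<integral>\<^sup>+ t. w t * of_bool (0 < t \<and> ennreal t \<le> life (real_of_ereal (Y e \<omega>)) \<omega>') \<partial>lborel \<partial>M)"
  proof (rule ext)
    fix \<omega>
    have "(\<integral>\<^sup>+ t. w t * of_bool (0 < t) * surv t (real_of_ereal (Y e \<omega>)) \<partial>lborel)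
      = (\<integral>\<^sup>+ t. \<integral>\<^sup>+ \<omega>'. w t * of_bool (0 < t) * of_bool (ennreal t \<le> life (real_of_ereal (Y e \<omega>)) \<omega>') \<partial>M \<partial>lborel)"
      unfolding surv_def of_bool_def by (intro nn_integral_cong nn_integral_cmult[symmetric]) measurable
    also have "\<dots> = (\<integral>\<^sup>+ \<omega>'. \<integral>\<^sup>+ t. w t * of_bool (0 < t) * of_bool (ennreal t \<le> life (real_of_ereal (Y e \<omega>)) \<omega>') \<partial>lborel \<partial>M)"
      unfolding of_bool_def by (rule LM.Fubini'[symmetric]) measurable
    finally show "(\<integral>\<^sup>+ t. w t * of_bool (0 < t) * surv t (real_of_ereal (Y e \<omega>)) \<partial>lborel)
      = (\<integral>\<^sup>+ \<omega>'. \<integral>\<^sup>+ t. w t * of_bool (0 < t \<and> ennreal t \<le> life (real_of_ereal (Y e \<omega>)) \<omega>') \<partial>lborel \<partial>M)"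
      by (simp add: of_bool_conj mult.assoc)
  qed
  finally show ?thesis unfolding S_def .
qed

section \<open>Moments of the passage time of the process from infinity\<close>

definition passage :: "'b \<Rightarrow> ennreal" where "passage \<omega> = first_passage (\<lambda>t. Y t \<omega>) b"
definition shifted_passage :: "real \<Rightarrow> 'b \<Rightarrow> ennreal" where "shifted_passage e \<omega> = first_passage (\<lambda>u. Y (e + u) \<omega>) b"

lemma measurable_passage [measurable]: "passage \<in> borel_measurable N"
  using measurable_first_passage[of 0] by (simp add: passage_def[abs_def])

lemma measurable_shifted_passage [measurable]: "0 \<le> e \<Longrightarrow> shifted_passage e \<in> borel_measurable N"
  using measurable_first_passage[of e] by (simp add: shifted_passage_def[abs_def])

lemma markov_shifted_passage:
  assumes "0 < e" "A \<in> sets (F e)"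
  shows "(\<integral>\<^sup>+ \<omega>. shifted_passage e \<omega> * indicator A \<omega> \<partial>N) = (\<integral>\<^sup>+ \<omega>. (\<integral>\<^sup>+ \<omega>'. life (real_of_ereal (Y e \<omega>)) \<omega>' \<partial>M) * indicator A \<omega> \<partial>N)"
    and "(\<integral>\<^sup>+ \<omega>. (shifted_passage e \<omega>)\<^sup>2 * indicator A \<omega> \<partial>N) = (\<integral>\<^sup>+ \<omega>. (\<integral>\<^sup>+ \<omega>'. (life (real_of_ereal (Y e \<omega>)) \<omega>')\<^sup>2 \<partial>M) * indicator A \<omega> \<partial>N)"
  using markov_layer[OF assms, of "\<lambda>_. 1"] markov_layer[OF assms, of "\<lambda>t. ennreal (2 * t)"]
  by (simp_all add: layer_cake_first layer_cake_second shifted_passage_def)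

lemma passage_le: "0 \<le> e \<Longrightarrow> passage \<omega> \<le> ennreal e + shifted_passage e \<omega>"
proof (rule ennreal_le_epsilon)
  fix d :: real assume e: "0 \<le> e" and fin: "ennreal e + shifted_passage e \<omega> < \<top>" and d: "0 < d"
  then have "shifted_passage e \<omega> < shifted_passage e \<omega> + ennreal d" by (cases "shifted_passage e \<omega>" rule: ennreal_cases) (auto simp: ennreal_plus[symmetric] ennreal_less_iff simp del: ennreal_plus)
  then obtain u where u: "0 \<le> u" "Y (e + u) \<omega> < ereal b" "ennreal u < shifted_passage e \<omega> + ennreal d"
    unfolding shifted_passage_def[of e \<omega>] first_passage_def Inf_less_iff by auto
  have "passage \<omega> \<le> ennreal (e + u)" unfolding passage_def using u e by (intro first_passage_le) auto
  also have "\<dots> = ennreal e + ennreal u" using u e by simp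
  also have "\<dots> \<le> ennreal e + shifted_passage e \<omega> + ennreal d" using u by (simp add: add.assoc add_left_mono less_imp_le)
  finally show "passage \<omega> \<le> ennreal e + shifted_passage e \<omega> + ennreal d" .
qed

lemma shifted_passage_le: 
  assumes e: "0 \<le> e" and passage: "ennreal e \<le> passage \<omega>"
  shows "shifted_passage e \<omega> \<le> passage \<omega>"
  unfolding passage_def
proof (rule first_passage_ge)
  fix u assume u: "0 \<le> u" "Y u \<omega> < ereal b"
  then have "ennreal e \<le> ennreal u"
    using order_trans[OF passage[unfolded passage_def] first_passage_le[of u "\<lambda>t. Y t \<omega>" b]] by blast
  then have "e \<le> u" using u e by simp
  then have "shifted_passage e \<omega> \<le> ennreal (u - e)" unfolding shifted_passage_def using u by (intro first_passage_le) auto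
  also have "\<dots> \<le> ennreal u" using e by (intro ennreal_leI) auto
  finally show "shifted_passage e \<omega> \<le> ennreal u" .
qed

text \<open>Killing only shortens the occupation time, whose bounds are independent of the start.
  They hold for the passage after time \<open>e\<close> whatever the law of Y e, and
  \<open>passage_le\<close> lets \<open>e\<close> tend to 0.\<close>

lemma moment_upper_bounds:
  assumes fin: "(\<integral>\<^sup>+ y. rt y \<partial>lborel) < \<infinity>" and M2: "\<And>x. 2 * potential (\<lambda>y. rt y * potential rt y) x \<le> M2"
  shows "(\<integral>\<^sup>+ \<omega>. (passage \<omega>)\<^sup>2 \<partial>N) \<le> M2" "(\<integral>\<^sup>+ \<omega>. passage \<omega> \<partial>N) \<le> ennreal (1 / \<gamma>) * (\<integral>\<^sup>+ y. rt y \<partial>lborel)"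
proof -
  let ?M1 = "ennreal (1 / \<gamma>) * (\<integral>\<^sup>+ y. rt y \<partial>lborel)"
  have life1: "(\<integral>\<^sup>+ \<omega>'. life x \<omega>' \<partial>M) \<le> ?M1" for x
  proof -
    have "(\<integral>\<^sup>+ \<omega>'. life x \<omega>' \<partial>M) \<le> (\<integral>\<^sup>+ \<omega>'. occ rt x \<omega>' \<partial>M)" by (intro nn_integral_mono killed_occ_le)
    also have "\<dots> = potential rt x" by (rule expectation_occ[OF measurable_rt fin])
    also have "\<dots> \<le> ?M1" by (rule potential_le[OF measurable_rt])
    finally show ?thesis .
  qed
  have life2: "(\<integral>\<^sup>+ \<omega>'. (life x \<omega>')\<^sup>2 \<partial>M) \<le> M2" for x
  proof -
    have "(\<integral>\<^sup>+ \<omega>'. (life x \<omega>')\<^sup>2 \<partial>M) \<le> (\<integral>\<^sup>+ \<omega>'. (occ rt x \<omega>')\<^sup>2 \<partial>M)" by (intro nn_integral_mono power_mono killed_occ_le) auto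
    also have "\<dots> \<le> 2 * potential (\<lambda>y. rt y * potential rt y) x" by (rule occ_second_moment[OF measurable_rt fin])
    also have "\<dots> \<le> M2" by (rule M2)
    finally show ?thesis .
  qed
  have S1: "(\<integral>\<^sup>+ \<omega>. shifted_passage e \<omega> \<partial>N) \<le> ?M1" and S2: "(\<integral>\<^sup>+ \<omega>. (shifted_passage e \<omega>)\<^sup>2 \<partial>N) \<le> M2" if e: "0 < e" for e
  proof -
    have sp: "space N \<in> sets (F e)" using sets.top[of "F e"] F_space by simp
    have c: "(\<integral>\<^sup>+ \<omega>. f \<omega> * indicator (space N) \<omega> \<partial>N) = (\<integral>\<^sup>+ \<omega>. f \<omega> \<partial>N)" for f :: "'b \<Rightarrow> ennreal"
      by (intro nn_integral_cong) auto
    have "(\<integral>\<^sup>+ \<omega>. shifted_passage e \<omega> \<partial>N) \<le> (\<integral>\<^sup>+ \<omega>. ?M1 \<partial>N)" "(\<integral>\<^sup>+ \<omega>. (shifted_passage e \<omega>)\<^sup>2 \<partial>N) \<le> (\<integral>\<^sup>+ \<omega>. M2 \<partial>N)"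
      unfolding markov_shifted_passage[OF e sp, unfolded c] by (rule nn_integral_mono, rule life1, rule nn_integral_mono, rule life2)
    then show "(\<integral>\<^sup>+ \<omega>. shifted_passage e \<omega> \<partial>N) \<le> ?M1" "(\<integral>\<^sup>+ \<omega>. (shifted_passage e \<omega>)\<^sup>2 \<partial>N) \<le> M2" by (simp_all add: N.emeasure_space_1)
  qed
  have M1fin: "?M1 < \<top>" using fin by (simp add: ennreal_mult_less_top)
  have B1: "(\<integral>\<^sup>+ \<omega>. passage \<omega> \<partial>N) \<le> ennreal e + ?M1" if e: "0 < e" for e
  proof -
    have "(\<integral>\<^sup>+ \<omega>. passage \<omega> \<partial>N) \<le> (\<integral>\<^sup>+ \<omega>. ennreal e + shifted_passage e \<omega> \<partial>N)" using e by (intro nn_integral_mono passage_le) auto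
    also have "\<dots> = ennreal e + (\<integral>\<^sup>+ \<omega>. shifted_passage e \<omega> \<partial>N)" using e by (subst nn_integral_add) (auto simp: N.emeasure_space_1)
    also have "\<dots> \<le> ennreal e + ?M1" by (intro add_left_mono S1 e)
    finally show ?thesis .
  qed
  show "(\<integral>\<^sup>+ \<omega>. passage \<omega> \<partial>N) \<le> ?M1"
    by (rule ennreal_le_epsilon) (use B1 in \<open>simp add: add.commute\<close>)
  obtain m where m: "?M1 = ennreal m" "0 \<le> m" using M1fin by (cases ?M1 rule: ennreal_cases) auto
  have B2: "(\<integral>\<^sup>+ \<omega>. (passage \<omega>)\<^sup>2 \<partial>N) \<le> M2 + ennreal (e * (e + 2 * m))" if e: "0 < e" for e
  proof -
    have "(\<integral>\<^sup>+ \<omega>. (passage \<omega>)\<^sup>2 \<partial>N) \<le> (\<integral>\<^sup>+ \<omega>. (shifted_passage e \<omega>)\<^sup>2 + (ennreal (e * e) + ennreal (2 * e) * shifted_passage e \<omega>) \<partial>N)"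
    proof (intro nn_integral_mono)
      fix \<omega>
      have "(passage \<omega>)\<^sup>2 \<le> (ennreal e + shifted_passage e \<omega>)\<^sup>2" using e by (intro power_mono passage_le) auto
      also have "\<dots> = (shifted_passage e \<omega>)\<^sup>2 + (ennreal (e * e) + ennreal (2 * e) * shifted_passage e \<omega>)"
        using e by (simp add: power2_eq_square ennreal_mult distrib_left distrib_right add_ac mult_ac mult_2)
      finally show "(passage \<omega>)\<^sup>2 \<le> (shifted_passage e \<omega>)\<^sup>2 + (ennreal (e * e) + ennreal (2 * e) * shifted_passage e \<omega>)" .
    qed
    also have "\<dots> = (\<integral>\<^sup>+ \<omega>. (shifted_passage e \<omega>)\<^sup>2 \<partial>N) + (ennreal (e * e) + ennreal (2 * e) * (\<integral>\<^sup>+ \<omega>. shifted_passage e \<omega> \<partial>N))"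
      using e by (simp add: nn_integral_add nn_integral_cmult N.emeasure_space_1)
    also have "\<dots> \<le> M2 + (ennreal (e * e) + ennreal (2 * e) * ennreal m)"
      using S1[OF e] S2[OF e] m by (intro add_mono mult_left_mono) auto
    also have "\<dots> = M2 + ennreal (e * (e + 2 * m))"
      using e m by (simp add: ennreal_mult[symmetric] ennreal_plus[symmetric] algebra_simps del: ennreal_plus)
    finally show ?thesis .
  qed
  show "(\<integral>\<^sup>+ \<omega>. (passage \<omega>)\<^sup>2 \<partial>N) \<le> M2"
  proof (rule ennreal_le_epsilon)
    fix d :: real assume d: "0 < d"
    \<comment> \<open>The error e^2 + 2 e m is at most e (1 + 2 m) when e <= 1, hence at most
      \<open>d\<close>.\<close>
    define e where "e = min 1 (d / (1 + 2 * m))"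
    have e: "0 < e" "e \<le> 1" "e \<le> d / (1 + 2 * m)" using d m by (auto simp: e_def)
    have "e * (e + 2 * m) \<le> d / (1 + 2 * m) * (1 + 2 * m)" using e m d by (intro mult_mono) auto
    also have "\<dots> = d" using m by (simp add: field_simps)
    finally show "(\<integral>\<^sup>+ \<omega>. (passage \<omega>)\<^sup>2 \<partial>N) \<le> M2 + ennreal d"
      using B2[OF e(1)] by (meson add_left_mono ennreal_leI order_trans)
  qed
qed

text \<open>On \<open>A n\<close> the level is not passed before time \<open>e n\<close> and Y (e n)
  is at least \<open>x0\<close>, so the shifted passage is at most the full one and the Markov
  property applies from a start covered by \<open>L\<close>. Right-continuity at 0, where
  \<open>Y\<close> is infinite, puts every path into \<open>A n\<close> eventually; Fatou's lemma
  concludes.\<close>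

lemma moment_lower_bound:
  assumes L: "\<And>x. x0 \<le> x \<Longrightarrow> L \<le> (\<integral>\<^sup>+ \<omega>'. life x \<omega>' \<partial>M)"
  shows "L \<le> (\<integral>\<^sup>+ \<omega>. passage \<omega> \<partial>N)"
proof -
  define e where "e n = 1 / real (Suc n)" for n
  have e: "0 < e n" for n by (simp add: e_def)
  \<comment> \<open>By right-continuity the rational times before \<open>e n\<close> suffice, and
    they keep the event in \<open>F (e n)\<close>.\<close>
  define A where "A n = {\<omega>\<in>space N. (\<forall>q::rat. 0 \<le> (of_rat q :: real) \<longrightarrow> of_rat q < e n \<longrightarrow> ereal b \<le> Y (of_rat q) \<omega>) \<and> ereal x0 \<le> Y (e n) \<omega>}" for n
  have Ym: "{\<omega>\<in>space N. ereal c \<le> Y t \<omega>} \<in> sets (F (e n))" if "t \<le> e n" for c t n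
  proof -
    have "{\<omega>\<in>space (F t). ereal c \<le> Y t \<omega>} \<in> sets (F t)" using Y_adapted[of t] by measurable
    then show ?thesis using F_mono[OF that] by (auto simp: F_space)
  qed
  have AF: "A n \<in> sets (F (e n))" for n
  proof -
    have "A n = (\<Inter>q::rat. if 0 \<le> (of_rat q :: real) \<and> of_rat q < e n then {\<omega>\<in>space N. ereal b \<le> Y (of_rat q) \<omega>} else space N) \<inter> {\<omega>\<in>space N. ereal x0 \<le> Y (e n) \<omega>}"
      by (auto simp: A_def split: if_splits)
    also have "\<dots> \<in> sets (F (e n))"
      using sets.top[of "F (e n)"] F_space
      by (intro sets.Int sets.countable_INT' Ym) (auto intro!: Ym)
    finally show ?thesis .
  qed
  have [measurable]: "A n \<in> sets N" for n using AF F_sets by blast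
  have "(\<integral>\<^sup>+ \<omega>. L * indicator (A n) \<omega> \<partial>N) \<le> (\<integral>\<^sup>+ \<omega>. passage \<omega> \<partial>N)" for n
  proof -
    have "(\<integral>\<^sup>+ \<omega>. L * indicator (A n) \<omega> \<partial>N) \<le> (\<integral>\<^sup>+ \<omega>. (\<integral>\<^sup>+ \<omega>'. life (real_of_ereal (Y (e n) \<omega>)) \<omega>' \<partial>M) * indicator (A n) \<omega> \<partial>N)"
    proof (rule nn_integral_mono)
      fix \<omega> assume w: "\<omega> \<in> space N"
      have "x0 \<le> real_of_ereal (Y (e n) \<omega>)" if "\<omega> \<in> A n"
        using that Y_finite[OF w e[of n]] by (cases "Y (e n) \<omega>") (auto simp: A_def)
      then show "L * indicator (A n) \<omega> \<le> (\<integral>\<^sup>+ \<omega>'. life (real_of_ereal (Y (e n) \<omega>)) \<omega>' \<partial>M) * indicator (A n) \<omega>"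
        using L by (auto simp: indicator_def)
    qed
    also have "\<dots> = (\<integral>\<^sup>+ \<omega>. shifted_passage (e n) \<omega> * indicator (A n) \<omega> \<partial>N)" by (rule markov_shifted_passage(1)[OF e AF, symmetric])
    also have "\<dots> \<le> (\<integral>\<^sup>+ \<omega>. passage \<omega> \<partial>N)"
    proof (rule nn_integral_mono)
      fix \<omega> assume w: "\<omega> \<in> space N"
      have "ennreal (e n) \<le> passage \<omega>" if "\<omega> \<in> A n"
        unfolding passage_def using that by (subst le_first_passage_iff[OF less_imp_le[OF e] Y_rc[OF w]]) (auto simp: A_def)
      then show "shifted_passage (e n) \<omega> * indicator (A n) \<omega> \<le> passage \<omega>" using shifted_passage_le[OF less_imp_le[OF e[of n]]] by (auto simp: indicator_def)
    qed
    finally show ?thesis .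
  qed
  then have "liminf (\<lambda>n. \<integral>\<^sup>+ \<omega>. L * indicator (A n) \<omega> \<partial>N) \<le> liminf (\<lambda>n::nat. \<integral>\<^sup>+ \<omega>. passage \<omega> \<partial>N)"
    by (intro Liminf_mono always_eventually allI)
  then have "liminf (\<lambda>n. \<integral>\<^sup>+ \<omega>. L * indicator (A n) \<omega> \<partial>N) \<le> (\<integral>\<^sup>+ \<omega>. passage \<omega> \<partial>N)"
    by (simp add: Liminf_const)
  moreover have "(\<integral>\<^sup>+ \<omega>. liminf (\<lambda>n. L * indicator (A n) \<omega>) \<partial>N) \<le> liminf (\<lambda>n. \<integral>\<^sup>+ \<omega>. L * indicator (A n) \<omega> \<partial>N)"
    by (rule nn_integral_liminf) measurable
  moreover have "L \<le> (\<integral>\<^sup>+ \<omega>. liminf (\<lambda>n. L * indicator (A n) \<omega>) \<partial>N)"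
  proof -
    have "L = (\<integral>\<^sup>+ \<omega>. L \<partial>N)" by (simp add: N.emeasure_space_1)
    also have "\<dots> \<le> (\<integral>\<^sup>+ \<omega>. liminf (\<lambda>n. L * indicator (A n) \<omega>) \<partial>N)"
    proof (rule nn_integral_mono)
      fix \<omega> assume w: "\<omega> \<in> space N"
      \<comment> \<open>The sign is reversed so that the infinite initial value becomes one below
        every level, as \<open>right_continuous_less_nbhd\<close> expects.\<close>
      have "continuous (at_right 0) (\<lambda>t. - Y t \<omega>)" using Y_rc[OF w, of 0] by (auto simp: continuous_within intro!: tendsto_intros)
      moreover have "- Y 0 \<omega> < - ereal (max b x0)" by (simp add: Y_0[OF w] max_def)
      ultimately obtain d where d: "d > 0" "\<And>v. 0 \<le> v \<Longrightarrow> v < d \<Longrightarrow> - Y v \<omega> < - ereal (max b x0)"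
        using right_continuous_less_nbhd[of 0 "\<lambda>t. - Y t \<omega>"] by blast
      have big: "ereal b \<le> Y v \<omega>" "ereal x0 \<le> Y v \<omega>" if "0 \<le> v" "v < d" for v
      proof -
        have "ereal (max b x0) < Y v \<omega>" using d(2)[OF that] by (simp only: ereal_minus_less_minus)
        then show "ereal b \<le> Y v \<omega>" "ereal x0 \<le> Y v \<omega>" by (auto intro: order_trans[OF _ less_imp_le])
      qed
      have "\<forall>\<^sub>F n in sequentially. e n < d"
        unfolding e_def by (rule order_tendstoD(2)[OF inverse_Suc_sequence(1) d(1)])
      then have "\<forall>\<^sub>F n in sequentially. L \<le> L * indicator (A n) \<omega>"
      proof eventually_elim
        fix n assume n: "e n < d"
        have "\<omega> \<in> A n" unfolding A_def using w big n e[of n] by auto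
        then show "L \<le> L * indicator (A n) \<omega>" by simp
      qed
      then show "L \<le> liminf (\<lambda>n. L * indicator (A n) \<omega>)" by (rule Liminf_bounded)
    qed
    finally show ?thesis .
  qed
  ultimately show ?thesis by (meson order_trans)
qed

end

section \<open>Moments of the passage times\<close>

text \<open>\<open>phi\<close> is a Bochner integral, with default value 0 when 1 / R is not
  integrable; from the level \<open>a\<close> on it is the true integral, so levels are taken
  there.\<close>

locale levy_rate = levy_scale \<gamma> \<sigma> \<pi> M Z W + rate R
  for \<gamma> \<sigma> :: real and \<pi> :: "real measure" and M :: "'a measure" and Z W R +
  fixes a :: real
  assumes a_pos: "a > 0" and int_R: "set_integrable lborel {a..} (\<lambda>x. 1 / R x)"
begin

abbreviation \<phi> :: "real \<Rightarrow> real" where "\<phi> \<equiv> phi \<gamma> R"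

lemma int_R_sub: "A \<in> sets borel \<Longrightarrow> A \<subseteq> {a..} \<Longrightarrow> set_integrable lborel A (\<lambda>x. 1 / R x)"
  by (rule set_integrable_subset[OF int_R]) auto

lemma phi_split:
  assumes "a \<le> b" "b \<le> c"
  shows "\<phi> b = (1 / \<gamma>) * (\<integral>x\<in>{b..<c}. 1 / R x \<partial>lborel) + \<phi> c"
proof -
  have "{b..} = {b..<c} \<union> {c..}" using assms by auto
  then have "(\<integral>x\<in>{b..}. 1 / R x \<partial>lborel) = (\<integral>x\<in>{b..<c}. 1 / R x \<partial>lborel) + (\<integral>x\<in>{c..}. 1 / R x \<partial>lborel)"
    using assms by (simp only:) (intro set_integral_Un int_R_sub, auto)
  then show ?thesis by (simp add: phi_def distrib_left)
qed

lemma nn_integral_R: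
  assumes A: "A \<in> sets borel" "A \<subseteq> {a..}"
  shows "(\<integral>\<^sup>+ x. indicator A x * inverse (ennreal (R x)) \<partial>lborel) = ennreal (\<integral>x\<in>A. 1 / R x \<partial>lborel)"
proof -
  have pos: "0 < R x" if "x \<in> A" for x using that A a_pos by (intro R_pos) auto
  have "(\<integral>\<^sup>+ x. indicator A x * inverse (ennreal (R x)) \<partial>lborel) = (\<integral>\<^sup>+ x. ennreal (indicator A x *\<^sub>R (1 / R x)) \<partial>lborel)"
    using pos by (intro nn_integral_cong) (auto simp: indicator_def inverse_ennreal inverse_eq_divide)
  also have "\<dots> = ennreal (\<integral>x. indicator A x *\<^sub>R (1 / R x) \<partial>lborel)"
    using int_R_sub[OF A] pos by (intro nn_integral_eq_integral) (auto simp: set_integrable_def indicator_def less_imp_le intro!: AE_I2)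
  finally show ?thesis by (simp add: set_lebesgue_integral_def)
qed

lemma nn_integral_R_Ico:
  assumes "a \<le> b" "b \<le> c"
  shows "(\<integral>\<^sup>+ x. indicator {b..<c} x * inverse (ennreal (R x)) \<partial>lborel) = ennreal (\<gamma> * (\<phi> b - \<phi> c))"
proof -
  have "{b..<c} \<subseteq> {a..}" using assms by auto
  moreover have "\<gamma> * (\<phi> b - \<phi> c) = (\<integral>x\<in>{b..<c}. 1 / R x \<partial>lborel)"
    using phi_split[OF assms] gamma_pos by (simp add: field_simps)
  ultimately show ?thesis using nn_integral_R[of "{b..<c}"] by simp
qed

lemma nn_integral_R_Ici:
  assumes "a \<le> b"
  shows "(\<integral>\<^sup>+ x. indicator {b..} x * inverse (ennreal (R x)) \<partial>lborel) = ennreal (\<gamma> * \<phi> b)"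
  using nn_integral_R[of "{b..}"] assms gamma_pos by (auto simp: phi_def)

lemma phi_nonneg: "a \<le> b \<Longrightarrow> 0 \<le> \<phi> b"
  unfolding phi_def set_lebesgue_integral_def using gamma_pos a_pos R_pos
  by (intro mult_nonneg_nonneg Bochner_Integration.integral_nonneg) (auto simp: indicator_def less_imp_le)

lemma phi_antimono: "a \<le> b \<Longrightarrow> b \<le> c \<Longrightarrow> \<phi> c \<le> \<phi> b"
proof -
  assume bc: "a \<le> b" "b \<le> c"
  have "0 \<le> (\<integral>x\<in>{b..<c}. 1 / R x \<partial>lborel)"
    unfolding set_lebesgue_integral_def using bc a_pos R_pos
    by (intro Bochner_Integration.integral_nonneg) (auto simp: indicator_def less_imp_le)
  then show ?thesis using phi_split[OF bc] gamma_pos by (auto intro: divide_nonneg_pos)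
qed

lemma phi_tendsto_0: "(\<phi> \<longlongrightarrow> 0) at_top"
proof -
  have l: "((\<lambda>b. \<integral>x\<in>{a..b}. 1 / R x \<partial>lborel) \<longlongrightarrow> (\<integral>x\<in>{a..}. 1 / R x \<partial>lborel)) at_top"
    by (rule tendsto_set_lebesgue_integral_at_top[OF _ int_R]) auto
  have "((\<lambda>b. \<phi> a - (1 / \<gamma>) * (\<integral>x\<in>{a..b}. 1 / R x \<partial>lborel)) \<longlongrightarrow> \<phi> a - (1 / \<gamma>) * (\<integral>x\<in>{a..}. 1 / R x \<partial>lborel)) at_top"
    by (intro tendsto_intros l)
  then have "((\<lambda>b. \<phi> a - (1 / \<gamma>) * (\<integral>x\<in>{a..b}. 1 / R x \<partial>lborel)) \<longlongrightarrow> 0) at_top" by (simp add: phi_def)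
  moreover have "\<forall>\<^sub>F b in at_top. \<phi> a - (1 / \<gamma>) * (\<integral>x\<in>{a..b}. 1 / R x \<partial>lborel) = \<phi> b"
  proof (rule eventually_at_top_linorderI[of a])
    fix b assume b: "a \<le> b"
    have "set_integrable lborel {a..b} (\<lambda>x. 1 / R x)" "set_integrable lborel {a..<b} (\<lambda>x. 1 / R x)"
      by (intro int_R_sub; force)+
    note m = this[unfolded set_integrable_def, THEN borel_measurable_integrable]
    have "(\<integral>x\<in>{a..b}. 1 / R x \<partial>lborel) = (\<integral>x\<in>{a..<b}. 1 / R x \<partial>lborel)"
    proof (rule set_integral_cong_set)
      show "AE x in lborel. (x \<in> {a..<b}) = (x \<in> {a..b})"
        using AE_lborel_singleton[of b] by eventually_elim auto
    qed (use m in \<open>simp_all add: set_borel_measurable_def\<close>)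
    then show "\<phi> a - (1 / \<gamma>) * (\<integral>x\<in>{a..b}. 1 / R x \<partial>lborel) = \<phi> b"
      using phi_split[OF order_refl b] by simp
  qed
  ultimately show ?thesis by (rule Lim_transform_eventually)
qed

lemma phi_has_derivative:
  assumes y: "a < y"
  shows "(\<phi> has_real_derivative (- (1 / (\<gamma> * R y)))) (at y)"
proof -
  have cont: "continuous_on {a..y + 1} (\<lambda>x. 1 / R x)"
  proof (intro continuous_intros continuous_on_subset[OF R_cont] ballI)
    fix x assume "x \<in> {a..y + 1}"
    then show "R x \<noteq> 0" using a_pos R_pos[of x] by auto
  qed (use a_pos in auto)
  have "((\<lambda>x. integral {a..x} (\<lambda>x. 1 / R x)) has_real_derivative 1 / R y) (at y within {a..y + 1})"
    using y by (intro integral_has_real_derivative[OF cont]) auto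
  then have d: "((\<lambda>x. integral {a..x} (\<lambda>x. 1 / R x)) has_real_derivative 1 / R y) (at y)"
    using y by (subst (asm) at_within_interior) auto
  have "((\<lambda>x. \<phi> a - (1 / \<gamma>) * integral {a..x} (\<lambda>x. 1 / R x)) has_real_derivative (- (1 / (\<gamma> * R y)))) (at y)"
    by (rule derivative_eq_intros d refl)+ simp
  moreover have "\<forall>\<^sub>F x in nhds y. \<phi> x = \<phi> a - (1 / \<gamma>) * integral {a..x} (\<lambda>x. 1 / R x)"
  proof -
    have "\<forall>\<^sub>F x in nhds y. a < x" using eventually_nhds_in_open[of "{a<..}" y] y by simp
    then show ?thesis
    proof eventually_elim
      fix x assume x: "a < x"
      have "(\<integral>x\<in>{a..<x}. 1 / R x \<partial>lborel) = integral {a..<x} (\<lambda>x. 1 / R x)"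
        using x by (intro set_borel_integral_eq_integral int_R_sub) auto
      also have "\<dots> = integral {a..x} (\<lambda>x. 1 / R x)"
        by (rule integral_spike_set; rule negligible_subset[OF negligible_sing[of x]]; force)
      finally show "\<phi> x = \<phi> a - (1 / \<gamma>) * integral {a..x} (\<lambda>x. 1 / R x)"
        using phi_split[of a x] x by simp
    qed
  qed
  ultimately show ?thesis by (rule DERIV_cong_ev[OF refl _ refl, THEN iffD2, rotated])
qed

text \<open>A zero would persist to the right by monotonicity and force a zero derivative, but the
  derivative is -1 / (\<open>\<gamma>\<close> R).\<close>

lemma phi_pos: "a \<le> b \<Longrightarrow> 0 < \<phi> b"
proof (rule ccontr)
  assume b: "a \<le> b" and "\<not> 0 < \<phi> b"
  then have "\<phi> b \<le> 0" by simp
  then have z: "\<phi> y = 0" if "b \<le> y" for y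
    using phi_antimono[OF b that] phi_nonneg[of y] b that by linarith
  have "(\<phi> has_real_derivative 0) (at (b + 1))"
    by (rule DERIV_cong_ev[THEN iffD2, OF refl _ refl, of _ "\<lambda>_. 0"])
      (use z in \<open>auto intro!: eventually_mono[OF eventually_nhds_in_open[of "{b<..}" "b + 1"]]\<close>)
  moreover have "(\<phi> has_real_derivative (- (1 / (\<gamma> * R (b + 1))))) (at (b + 1))"
    using b by (intro phi_has_derivative) auto
  ultimately have "- (1 / (\<gamma> * R (b + 1))) = 0" using DERIV_unique by blast
  then show False using gamma_pos R_pos[of "b + 1"] a_pos b by auto
qed

lemma phi_cont: "a < b \<Longrightarrow> continuous_on {b..} \<phi>"
  by (intro continuous_at_imp_continuous_on ballI DERIV_isCont[OF phi_has_derivative]) auto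

text \<open>Split at y + h. Below it \<open>Delta W\<close> is at most 1 / \<open>\<gamma>\<close>,
  which yields the difference of \<open>\<phi>\<close> governed by (i); above it
  \<open>Delta W\<close> is at most its value at \<open>h\<close>, which yields the last
  term.\<close>

lemma potential_rate_start:
  assumes y: "a \<le> y" and h: "0 \<le> h"
  shows "potential (inv_rate R y) y \<le> ennreal (\<phi> y - \<phi> (y + h) + \<gamma> * Delta W h * \<phi> y)"
proof -
  have [measurable]: "(\<lambda>x. indicator {y..<y + h} x * inverse (ennreal (R x))) \<in> borel_measurable borel"
    "(\<lambda>x. indicator {y..} x * inverse (ennreal (R x))) \<in> borel_measurable borel"
    using y a_pos by (auto intro!: measurable_indicator_inverse_rate)
  have "potential (inv_rate R y) y \<le> (\<integral>\<^sup>+ x. ennreal (1 / \<gamma>) * (indicator {y..<y + h} x * inverse (ennreal (R x)))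
      + ennreal (Delta W h) * (indicator {y..} x * inverse (ennreal (R x))) \<partial>lborel)"
    unfolding potential_def
  proof (rule nn_integral_mono)
    fix x
    show "inv_rate R y x * ennreal (Delta W (x - y)) \<le> ennreal (1 / \<gamma>) * (indicator {y..<y + h} x * inverse (ennreal (R x)))
      + ennreal (Delta W h) * (indicator {y..} x * inverse (ennreal (R x)))"
    proof (cases "x < y + h")
      case True
      then have "inv_rate R y x * ennreal (Delta W (x - y)) \<le> ennreal (1 / \<gamma>) * (indicator {y..<y + h} x * inverse (ennreal (R x)))"
        unfolding inv_rate_def mult.commute[of "ennreal (1 / \<gamma>)"] using Delta_le
        by (auto simp: indicator_def intro!: mult_left_mono ennreal_leI)
      then show ?thesis by (simp add: add_increasing2)
    next
      case False
      then have "inv_rate R y x * ennreal (Delta W (x - y)) \<le> ennreal (Delta W h) * (indicator {y..} x * inverse (ennreal (R x)))"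
        unfolding inv_rate_def mult.commute[of "ennreal (Delta W h)"]
        by (intro mult_left_mono ennreal_leI Delta_antimono) auto
      then show ?thesis by (simp add: add_increasing)
    qed
  qed
  also have "\<dots> = ennreal (1 / \<gamma>) * ennreal (\<gamma> * (\<phi> y - \<phi> (y + h))) + ennreal (Delta W h) * ennreal (\<gamma> * \<phi> y)"
    using y h by (subst nn_integral_add) (auto simp: nn_integral_cmult nn_integral_R_Ico nn_integral_R_Ici)
  also have "\<dots> = ennreal (\<phi> y - \<phi> (y + h) + \<gamma> * Delta W h * \<phi> y)"
    using y h gamma_pos phi_antimono[of y "y + h"] phi_nonneg[of y] Delta_nonneg
    by (simp add: ennreal_mult[symmetric] ennreal_plus[symmetric] mult_ac del: ennreal_plus)
  finally show ?thesis .
qed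

lemma potential_rate_upper:
  assumes b: "a \<le> b" "b \<le> y"
  shows "potential (inv_rate R b) y \<le> ennreal (\<phi> b - \<phi> y) + potential (inv_rate R y) y"
proof -
  have [measurable]: "inv_rate R c \<in> borel_measurable borel" if "b \<le> c" for c
    using a_pos b that by (intro measurable_inv_rate) auto
  have [measurable]: "(\<lambda>x. indicator {b..<y} x * inverse (ennreal (R x))) \<in> borel_measurable borel"
    using b a_pos by (intro measurable_indicator_inverse_rate) auto
  have "potential (inv_rate R b) y \<le> (\<integral>\<^sup>+ x. ennreal (1 / \<gamma>) * (indicator {b..<y} x * inverse (ennreal (R x)))
      + inv_rate R y x * ennreal (Delta W (x - y)) \<partial>lborel)"
    unfolding potential_def
  proof (rule nn_integral_mono)
    fix x
    show "inv_rate R b x * ennreal (Delta W (x - y)) \<le> ennreal (1 / \<gamma>) * (indicator {b..<y} x * inverse (ennreal (R x)))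
      + inv_rate R y x * ennreal (Delta W (x - y))"
      unfolding inv_rate_def mult.commute[of "ennreal (1 / \<gamma>)"] using Delta_le b
      by (auto simp: indicator_def intro!: mult_left_mono ennreal_leI)
  qed
  also have "\<dots> = ennreal (1 / \<gamma>) * ennreal (\<gamma> * (\<phi> b - \<phi> y)) + potential (inv_rate R y) y"
    unfolding potential_def using b by (subst nn_integral_add) (auto simp: nn_integral_cmult nn_integral_R_Ico)
  also have "ennreal (1 / \<gamma>) * ennreal (\<gamma> * (\<phi> b - \<phi> y)) = ennreal (\<phi> b - \<phi> y)"
    using gamma_pos b phi_antimono[of b y] by (simp add: ennreal_mult[symmetric])
  finally show ?thesis .
qed

text \<open>W vanishes at negative arguments, so the potential density equals 1 /
  \<open>\<gamma>\<close> at every level below the start; levels above \<open>y\<close> are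
  dropped.\<close>

lemma potential_rate_lower:
  assumes b: "a \<le> b" "b \<le> y"
  shows "ennreal (\<phi> b - \<phi> y) \<le> potential (inv_rate R b) y"
proof -
  have [measurable]: "inv_rate R b \<in> borel_measurable borel"
    using a_pos b by (intro measurable_inv_rate) auto
  have [measurable]: "(\<lambda>x. indicator {b..<y} x * inverse (ennreal (R x))) \<in> borel_measurable borel"
    using b a_pos by (intro measurable_indicator_inverse_rate) auto
  have "ennreal (\<phi> b - \<phi> y) = ennreal (1 / \<gamma>) * ennreal (\<gamma> * (\<phi> b - \<phi> y))"
    using gamma_pos b phi_antimono[of b y] by (simp add: ennreal_mult[symmetric])
  also have "\<dots> = (\<integral>\<^sup>+ x. ennreal (1 / \<gamma>) * (indicator {b..<y} x * inverse (ennreal (R x))) \<partial>lborel)"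
    using b by (simp add: nn_integral_cmult nn_integral_R_Ico)
  also have "\<dots> \<le> potential (inv_rate R b) y"
    unfolding potential_def
  proof (rule nn_integral_mono)
    fix x
    have "Delta W (x - y) = 1 / \<gamma>" if "x < y" using that by (simp add: Delta_eq W_neg)
    then show "ennreal (1 / \<gamma>) * (indicator {b..<y} x * inverse (ennreal (R x))) \<le> inv_rate R b x * ennreal (Delta W (x - y))"
      by (auto simp: indicator_def inv_rate_def mult.commute)
  qed
  finally show ?thesis .
qed

text \<open>Bounding the inner potential by \<open>\<phi>\<close> b - \<open>\<phi>\<close> y + K
  \<open>\<phi>\<close> y and the outer density by 1 / \<open>\<gamma>\<close> leaves an exact
  derivative, because \<open>\<phi>\<close> has derivative -1 / (\<open>\<gamma>\<close> R). For K =
  0 the value would be the square of \<open>\<phi>\<close> b.\<close>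

lemma second_moment_integral:
  assumes b: "a < b" and K: "0 \<le> K"
    and start: "\<And>y. b \<le> y \<Longrightarrow> potential (inv_rate R y) y \<le> ennreal (K * \<phi> y)"
  shows "2 * potential (\<lambda>y. inv_rate R b y * potential (inv_rate R b) y) x \<le> ennreal ((\<phi> b)\<^sup>2 * (1 + K))"
proof -
  \<comment> \<open>The \<open>max\<close> makes the integrand continuous on the whole line, hence
    measurable; only its values beyond \<open>b\<close> are integrated.\<close>
  define f where "f y = 2 / \<gamma> * (1 / R (max b y)) * (\<phi> b - \<phi> (max b y) + K * \<phi> (max b y))" for y
  have [measurable]: "f \<in> borel_measurable borel"
  proof -
    have "R (max b y) \<noteq> 0" for y using R_pos[of "max b y"] a_pos b by (auto simp: max_def split: if_splits)
    then have "continuous_on UNIV f" unfolding f_def[abs_def]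
      using a_pos b gamma_pos
      by (intro continuous_intros continuous_on_compose2[OF R_cont] continuous_on_compose2[OF phi_cont[OF b]]) auto
    then show ?thesis by (rule borel_measurable_continuous_onI)
  qed
  have f: "f y = 2 / \<gamma> * (1 / R y) * (\<phi> b - \<phi> y + K * \<phi> y)" if "b \<le> y" for y
    using that by (simp add: f_def max_def)
  have f0: "0 \<le> f y" if y: "b \<le> y" for y
    unfolding f[OF y] using gamma_pos R_pos[of y] phi_antimono[of b y] phi_nonneg[of y] K a_pos b y
    by (intro mult_nonneg_nonneg add_nonneg_nonneg) auto
  have [measurable]: "inv_rate R b \<in> borel_measurable borel" using a_pos b by (intro measurable_inv_rate) auto
  have "2 * potential (\<lambda>y. inv_rate R b y * potential (inv_rate R b) y) x
      \<le> 2 * (ennreal (1 / \<gamma>) * (\<integral>\<^sup>+ y. inv_rate R b y * potential (inv_rate R b) y \<partial>lborel))"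
    by (intro mult_left_mono potential_le) auto
  also have "\<dots> = (\<integral>\<^sup>+ y. 2 * (ennreal (1 / \<gamma>) * (inv_rate R b y * potential (inv_rate R b) y)) \<partial>lborel)"
    by (simp add: nn_integral_cmult)
  also have "\<dots> \<le> (\<integral>\<^sup>+ y. ennreal (f y) * indicator {b..} y \<partial>lborel)"
  proof (rule nn_integral_mono)
    fix y
    show "2 * (ennreal (1 / \<gamma>) * (inv_rate R b y * potential (inv_rate R b) y)) \<le> ennreal (f y) * indicator {b..} y"
    proof (cases "b \<le> y")
      case True
      have p: "0 \<le> \<phi> b - \<phi> y" "0 \<le> \<phi> y" "0 < R y" using phi_antimono[of b y] phi_nonneg[of y] True b a_pos R_pos[of y] by auto
      have "potential (inv_rate R b) y \<le> ennreal (\<phi> b - \<phi> y) + ennreal (K * \<phi> y)"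
        using potential_rate_upper[of b y] start[OF True] True b by (meson add_left_mono less_imp_le order_trans)
      then have "2 * (ennreal (1 / \<gamma>) * (inv_rate R b y * potential (inv_rate R b) y))
        \<le> ennreal 2 * (ennreal (1 / \<gamma>) * (ennreal (1 / R y) * (ennreal (\<phi> b - \<phi> y) + ennreal (K * \<phi> y))))"
        using True p by (intro mult_mono) (auto simp: inv_rate_def inverse_ennreal inverse_eq_divide)
      also have "\<dots> = ennreal (f y)"
        unfolding f[OF True] using p gamma_pos K
        by (simp add: ennreal_mult[symmetric] ennreal_plus[symmetric] mult_ac del: ennreal_plus ennreal_numeral)
      finally show ?thesis using True by simp
    qed (simp add: inv_rate_def)
  qed
  also have "\<dots> = ennreal (0 - (- (2 * \<phi> b * \<phi> b) + (\<phi> b)\<^sup>2 - K * (\<phi> b)\<^sup>2))"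
  proof (rule nn_integral_FTC_atLeast[where F="\<lambda>y. - (2 * \<phi> b * \<phi> y) + (\<phi> y)\<^sup>2 - K * (\<phi> y)\<^sup>2"])
    fix y assume y: "b \<le> y"
    show "((\<lambda>y. - (2 * \<phi> b * \<phi> y) + (\<phi> y)\<^sup>2 - K * (\<phi> y)\<^sup>2) has_real_derivative f y) (at y)"
      unfolding f[OF y] using R_pos[of y] gamma_pos y b a_pos
      by (auto intro!: derivative_eq_intros phi_has_derivative simp: field_simps)
  next
    have "((\<lambda>y. - (2 * \<phi> b * \<phi> y) + (\<phi> y)\<^sup>2 - K * (\<phi> y)\<^sup>2) \<longlongrightarrow> - (2 * \<phi> b * 0) + 0\<^sup>2 - K * 0\<^sup>2) at_top"
      by (intro tendsto_intros phi_tendsto_0)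
    then show "((\<lambda>y. - (2 * \<phi> b * \<phi> y) + (\<phi> y)\<^sup>2 - K * (\<phi> y)\<^sup>2) \<longlongrightarrow> 0) at_top" by simp
  qed (auto intro: f0)
  also have "\<dots> = ennreal ((\<phi> b)\<^sup>2 * (1 + K))" by (simp add: power2_eq_square algebra_simps)
  finally show ?thesis .
qed

text \<open>The last bound expands the square: (1 + K) - 2 (1 - K) + 1 = 3 K. The hypothesis
  \<open>start\<close> is used at all y >= b for the second moment, and at \<open>b\<close> itself
  for the mean lost after the passage.\<close>

lemma passage_moments:
  assumes ent: "entrance_process M Z R N F Y" and b: "a < b" and K: "0 \<le> K"
    and start: "\<And>y. b \<le> y \<Longrightarrow> potential (inv_rate R y) y \<le> ennreal (K * \<phi> y)"
  shows "T_below Y b \<in> borel_measurable N" "integrable N (T_below Y b)"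
    "(\<integral>\<omega>. T_below Y b \<omega> \<partial>N) \<le> \<phi> b" "\<phi> b * (1 - K) \<le> (\<integral>\<omega>. T_below Y b \<omega> \<partial>N)"
    "AE \<omega> in N. {t. 0 \<le> t \<and> Y t \<omega> < ereal b} \<noteq> {}"
    "(\<integral>\<^sup>+ \<omega>. ennreal ((T_below Y b \<omega> / \<phi> b - 1)\<^sup>2) \<partial>N) \<le> ennreal (3 * K)"
proof -
  interpret E: entrance \<gamma> \<sigma> \<pi> M Z W R N F Y b
    using ent b a_pos by unfold_locales auto
  have rt_int: "(\<integral>\<^sup>+ y. inv_rate R b y \<partial>lborel) = ennreal (\<gamma> * \<phi> b)"
    unfolding inv_rate_def using b by (intro nn_integral_R_Ici) auto
  have fin: "(\<integral>\<^sup>+ y. inv_rate R b y \<partial>lborel) < \<infinity>" unfolding rt_int by simp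
  have phib: "0 < \<phi> b" using b by (intro phi_pos) auto
  note up = E.moment_upper_bounds[OF fin second_moment_integral[OF b K start]]
  have M1: "(\<integral>\<^sup>+ \<omega>. E.passage \<omega> \<partial>N) \<le> ennreal (\<phi> b)"
    using up(2) gamma_pos phib unfolding rt_int by (simp add: ennreal_mult[symmetric])
  have M2: "(\<integral>\<^sup>+ \<omega>. (E.passage \<omega>)\<^sup>2 \<partial>N) \<le> ennreal ((\<phi> b)\<^sup>2 * (1 + K))" using up(1) .
  \<comment> \<open>From a start beyond \<open>x0\<close> the full potential is at least
    \<open>\<phi>\<close> b - \<open>\<phi>\<close> x0, and what comes after the passage is at most
    K \<open>\<phi>\<close> b. This term is added to both sides and cancelled; a negative target is
    sent to 0 by \<open>ennreal\<close>. Later \<open>x0\<close> tends to infinity.\<close>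
  have low: "ennreal (\<phi> b - \<phi> x0 - K * \<phi> b) \<le> (\<integral>\<^sup>+ \<omega>. E.passage \<omega> \<partial>N)" if x0: "b \<le> x0" for x0
  proof (rule E.moment_lower_bound)
    fix x assume x: "x0 \<le> x"
    have "ennreal (\<phi> b - \<phi> x0 - K * \<phi> b) + ennreal (K * \<phi> b) \<le> (\<integral>\<^sup>+ \<omega>'. E.life x \<omega>' \<partial>M) + ennreal (K * \<phi> b)"
      if pos: "0 \<le> \<phi> b - \<phi> x0 - K * \<phi> b"
    proof -
      have "ennreal (\<phi> b - \<phi> x0 - K * \<phi> b) + ennreal (K * \<phi> b) = ennreal (\<phi> b - \<phi> x0)"
        using pos K phib by (simp add: ennreal_plus[symmetric] del: ennreal_plus)
      also have "\<dots> \<le> ennreal (\<phi> b - \<phi> x)" using phi_antimono[of x0 x] x x0 b by (intro ennreal_leI) auto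
      also have "\<dots> \<le> potential (inv_rate R b) x" using x x0 b by (intro potential_rate_lower) auto
      also have "\<dots> \<le> (\<integral>\<^sup>+ \<omega>'. E.life x \<omega>' \<partial>M) + potential (inv_rate R b) b"
        by (rule potential_le_killed_occ[OF E.measurable_rt fin])
      also have "\<dots> \<le> (\<integral>\<^sup>+ \<omega>'. E.life x \<omega>' \<partial>M) + ennreal (K * \<phi> b)" by (intro add_left_mono start) simp
      finally show ?thesis .
    qed
    then show "ennreal (\<phi> b - \<phi> x0 - K * \<phi> b) \<le> (\<integral>\<^sup>+ \<omega>'. E.life x \<omega>' \<partial>M)"
      by (cases "0 \<le> \<phi> b - \<phi> x0 - K * \<phi> b") (auto simp: ennreal_neg add.commute[of _ "ennreal (K * \<phi> b)"] ennreal_add_left_cancel_le)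
  qed
  have Pfin: "AE \<omega> in N. E.passage \<omega> \<noteq> \<infinity>"
    using M1 by (intro nn_integral_PInf_AE) (auto simp: top_unique)
  have ne_iff: "{t. 0 \<le> t \<and> Y t \<omega> < ereal b} \<noteq> {} \<longleftrightarrow> E.passage \<omega> \<noteq> \<infinity>" for \<omega>
  proof
    assume "{t. 0 \<le> t \<and> Y t \<omega> < ereal b} \<noteq> {}"
    then obtain t where "0 \<le> t" "Y t \<omega> < ereal b" by blast
    then have "E.passage \<omega> \<le> ennreal t" unfolding E.passage_def by (rule first_passage_le)
    then show "E.passage \<omega> \<noteq> \<infinity>" by (auto simp: top_unique)
  next
    assume "E.passage \<omega> \<noteq> \<infinity>"
    then show "{t. 0 \<le> t \<and> Y t \<omega> < ereal b} \<noteq> {}" unfolding E.passage_def first_passage_def by (metis Inf_empty image_is_empty infinity_ennreal_def)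
  qed
  \<comment> \<open>On the null set where \<open>b\<close> is never passed, \<open>T_below\<close> is the junk value \<open>Inf {}\<close>.\<close>
  have T_eq: "T_below Y b = (\<lambda>\<omega>. if E.passage \<omega> = \<infinity> then Inf {} else enn2real (E.passage \<omega>))"
  proof (rule ext)
    fix \<omega>
    show "T_below Y b \<omega> = (if E.passage \<omega> = \<infinity> then Inf {} else enn2real (E.passage \<omega>))"
    proof (cases "E.passage \<omega> = \<infinity>")
      case True
      then have "{t. 0 \<le> t \<and> Y t \<omega> < ereal b} = {}" using ne_iff by blast
      then show ?thesis using True by (simp only: T_below_def refl if_True)
    next
      case False
      then show ?thesis using T_below_eq[of Y \<omega> b] by (simp add: E.passage_def less_top)
    qed
  qed
  show mT [measurable]: "T_below Y b \<in> borel_measurable N"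
    unfolding T_eq by measurable
  have ennT: "AE \<omega> in N. ennreal (T_below Y b \<omega>) = E.passage \<omega> \<and> 0 \<le> T_below Y b \<omega>"
    using Pfin by eventually_elim (auto simp: T_eq less_top)
  have nnT: "(\<integral>\<^sup>+ \<omega>. ennreal (T_below Y b \<omega>) \<partial>N) = (\<integral>\<^sup>+ \<omega>. E.passage \<omega> \<partial>N)"
    by (rule nn_integral_cong_AE) (use ennT in eventually_elim, simp)
  have T0: "AE \<omega> in N. 0 \<le> T_below Y b \<omega>" using ennT by eventually_elim simp
  show iT: "integrable N (T_below Y b)"
  proof (rule integrableI_nonneg[OF mT T0])
    show "(\<integral>\<^sup>+ \<omega>. ennreal (T_below Y b \<omega>) \<partial>N) < \<infinity>" unfolding nnT using M1 by (rule le_less_trans) simp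
  qed
  have ET: "ennreal (\<integral>\<omega>. T_below Y b \<omega> \<partial>N) = (\<integral>\<^sup>+ \<omega>. E.passage \<omega> \<partial>N)"
    using nn_integral_eq_integral[OF iT T0] nnT by simp
  have ET0: "0 \<le> (\<integral>\<omega>. T_below Y b \<omega> \<partial>N)" using T0 by (rule integral_nonneg_AE)
  show "(\<integral>\<omega>. T_below Y b \<omega> \<partial>N) \<le> \<phi> b" using M1 phib unfolding ET[symmetric] by simp
  have lowT: "\<phi> b - \<phi> x0 - K * \<phi> b \<le> (\<integral>\<omega>. T_below Y b \<omega> \<partial>N)" if "b \<le> x0" for x0
    using low[OF that] ET0 unfolding ET[symmetric] by (simp add: ennreal_le_iff2) linarith
  have "\<phi> b - 0 - K * \<phi> b \<le> (\<integral>\<omega>. T_below Y b \<omega> \<partial>N)"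
  proof (rule tendsto_upperbound)
    show "((\<lambda>x0. \<phi> b - \<phi> x0 - K * \<phi> b) \<longlongrightarrow> \<phi> b - 0 - K * \<phi> b) at_top" by (intro tendsto_intros phi_tendsto_0)
    show "\<forall>\<^sub>F x0 in at_top. \<phi> b - \<phi> x0 - K * \<phi> b \<le> (\<integral>\<omega>. T_below Y b \<omega> \<partial>N)"
      using lowT by (rule eventually_at_top_linorderI)
  qed simp
  then show lowT': "\<phi> b * (1 - K) \<le> (\<integral>\<omega>. T_below Y b \<omega> \<partial>N)" by (simp add: algebra_simps)
  show "AE \<omega> in N. {t. 0 \<le> t \<and> Y t \<omega> < ereal b} \<noteq> {}" using Pfin ne_iff by simp
  have nnT2: "(\<integral>\<^sup>+ \<omega>. ennreal ((T_below Y b \<omega>)\<^sup>2) \<partial>N) = (\<integral>\<^sup>+ \<omega>. (E.passage \<omega>)\<^sup>2 \<partial>N)"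
  proof (rule nn_integral_cong_AE)
    show "AE \<omega> in N. ennreal ((T_below Y b \<omega>)\<^sup>2) = (E.passage \<omega>)\<^sup>2"
      using ennT
    proof eventually_elim
      fix \<omega> assume "ennreal (T_below Y b \<omega>) = E.passage \<omega> \<and> 0 \<le> T_below Y b \<omega>"
      then show "ennreal ((T_below Y b \<omega>)\<^sup>2) = (E.passage \<omega>)\<^sup>2" by (metis ennreal_power)
    qed
  qed
  have iT2: "integrable N (\<lambda>\<omega>. (T_below Y b \<omega>)\<^sup>2)"
  proof (rule integrableI_nonneg)
    show "(\<integral>\<^sup>+ \<omega>. ennreal ((T_below Y b \<omega>)\<^sup>2) \<partial>N) < \<infinity>" unfolding nnT2 using M2 by (rule le_less_trans) simp
  qed auto
  have "ennreal (\<integral>\<omega>. (T_below Y b \<omega>)\<^sup>2 \<partial>N) = (\<integral>\<^sup>+ \<omega>. (E.passage \<omega>)\<^sup>2 \<partial>N)"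
    using nn_integral_eq_integral[OF iT2] nnT2 by simp
  with M2 have ET2: "(\<integral>\<omega>. (T_below Y b \<omega>)\<^sup>2 \<partial>N) \<le> (\<phi> b)\<^sup>2 * (1 + K)"
    using K by (metis (no_types, lifting) add_nonneg_nonneg ennreal_le_iff mult_nonneg_nonneg zero_le_one zero_le_power2)
  have sq: "(T_below Y b \<omega> / \<phi> b - 1)\<^sup>2 = (T_below Y b \<omega>)\<^sup>2 / (\<phi> b)\<^sup>2 - 2 / \<phi> b * T_below Y b \<omega> + 1" for \<omega>
    using phib by (simp add: power2_diff power_divide)
  have isq: "integrable N (\<lambda>\<omega>. (T_below Y b \<omega> / \<phi> b - 1)\<^sup>2)" unfolding sq using iT iT2 by simp
  have "(\<integral>\<^sup>+ \<omega>. ennreal ((T_below Y b \<omega> / \<phi> b - 1)\<^sup>2) \<partial>N) = ennreal (\<integral>\<omega>. (T_below Y b \<omega> / \<phi> b - 1)\<^sup>2 \<partial>N)"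
    by (rule nn_integral_eq_integral[OF isq]) simp
  also have "(\<integral>\<omega>. (T_below Y b \<omega> / \<phi> b - 1)\<^sup>2 \<partial>N) = (\<integral>\<omega>. (T_below Y b \<omega>)\<^sup>2 \<partial>N) / (\<phi> b)\<^sup>2 - 2 / \<phi> b * (\<integral>\<omega>. T_below Y b \<omega> \<partial>N) + 1"
    unfolding sq using iT iT2 by (simp add: E.N.prob_space)
  also have "\<dots> \<le> (1 + K) - 2 * (1 - K) + 1"
  proof -
    have "(\<integral>\<omega>. (T_below Y b \<omega>)\<^sup>2 \<partial>N) / (\<phi> b)\<^sup>2 \<le> 1 + K" using ET2 phib by (simp add: divide_le_eq mult.commute)
    moreover have "2 * (1 - K) \<le> 2 / \<phi> b * (\<integral>\<omega>. T_below Y b \<omega> \<partial>N)" using lowT' phib by (simp add: field_simps)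
    ultimately show ?thesis by linarith
  qed
  finally show "(\<integral>\<^sup>+ \<omega>. ennreal ((T_below Y b \<omega> / \<phi> b - 1)\<^sup>2) \<partial>N) \<le> ennreal (3 * K)"
    by (simp add: ennreal_leI)
qed

end

section \<open>Almost sure convergence\<close>

text \<open>The initial value of \<open>f\<close> along the levels is left free, so the property
  survives dropping the first level.\<close>

definition geometric_levels :: "(real \<Rightarrow> real) \<Rightarrow> real \<Rightarrow> real \<Rightarrow> (nat \<Rightarrow> real) \<Rightarrow> bool" where
  "geometric_levels f B q b \<longleftrightarrow> (\<forall>k. B \<le> b k) \<and> mono b \<and> filterlim b at_top sequentially \<and>
     (\<forall>k. f (b (Suc k)) = q * f (b k))"

lemma geometric_levelsD:
  assumes "geometric_levels f B q b"
  shows "\<And>k. B \<le> b k" "mono b" "filterlim b at_top sequentially" "\<And>k. f (b (Suc k)) = q * f (b k)"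
  using assms by (auto simp: geometric_levels_def)

text \<open>For x between b_k and b_(k+1), monotonicity compares T x / f x with the quotients
  T(b_(k+1)) / f(b_k) and T(b_k) / f(b_(k+1)). The mismatch of one index costs a factor q, on top of
  the tolerances \<open>q\<close> and 2 - q along the levels.\<close>

lemma geometric_sandwich:
  fixes T f :: "real \<Rightarrow> real" and b :: "nat \<Rightarrow> real" and q :: real
  assumes q: "0 < q" "q < 1"
    and T: "\<And>x y. B \<le> x \<Longrightarrow> x \<le> y \<Longrightarrow> T y \<le> T x"
    and f: "\<And>x. B \<le> x \<Longrightarrow> 0 < f x" "\<And>x y. B \<le> x \<Longrightarrow> x \<le> y \<Longrightarrow> f y \<le> f x"
    and geo: "geometric_levels f B q b"
    and lim: "(\<lambda>k. T (b k) / f (b k)) \<longlonglongrightarrow> 1"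
  shows "\<forall>\<^sub>F x in at_top. q\<^sup>2 \<le> T x / f x \<and> T x / f x \<le> (2 - q) / q"
proof -
  note b = geometric_levelsD[OF geo]
  have "\<forall>\<^sub>F k in sequentially. q < T (b k) / f (b k) \<and> T (b k) / f (b k) < 2 - q"
    using order_tendstoD[OF lim] q by (intro eventually_conj) auto
  then obtain n where n: "\<And>k. n \<le> k \<Longrightarrow> q < T (b k) / f (b k) \<and> T (b k) / f (b k) < 2 - q"
    by (auto simp: eventually_sequentially)
  have n': "q * f (b k) \<le> T (b k)" "T (b k) \<le> (2 - q) * f (b k)" if "n \<le> k" for k
    using n[OF that] f(1)[OF b(1)[of k]] by (auto simp: field_simps)
  show ?thesis
  proof (rule eventually_at_top_linorderI)
    fix x assume x: "b n \<le> x"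
    obtain k1 where k1: "x < b k1"
      using filterlim_at_top_dense[THEN iffD1, OF b(3), rule_format, of x] unfolding eventually_sequentially by blast
    \<comment> \<open>The first level beyond \<open>x\<close>; its predecessor is the
      \<open>k\<close> sought, and x >= b n guarantees n <= k.\<close>
    define m where "m = (LEAST j. x < b j)"
    have m: "x < b m" unfolding m_def using k1 by (rule LeastI)
    have m': "b j \<le> x" if "j < m" for j
      using not_less_Least[of j "\<lambda>j. x < b j"] that by (simp add: m_def not_less)
    have nm: "n < m"
    proof (rule ccontr)
      assume "\<not> n < m"
      then have "b m \<le> b n" by (intro monoD[OF b(2)]) simp
      then show False using m x by simp
    qed
    then obtain k where k: "m = Suc k" "n \<le> k" by (cases m) auto
    have bk: "b k \<le> x" "x < b (Suc k)" using m m'[of k] k by auto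
    have xB: "B \<le> x" using b(1)[of k] bk by simp
    have fx: "0 < f x" using f(1)[OF xB] .
    have "T x \<le> (2 - q) * f (b k)" using T[OF b(1) bk(1)] n'(2)[OF k(2)] by simp
    also have "f (b k) = f (b (Suc k)) / q" using b(4)[of k] q by simp
    also have "(2 - q) * (f (b (Suc k)) / q) \<le> (2 - q) * (f x / q)"
      using f(2)[OF xB less_imp_le[OF bk(2)]] q by (intro mult_left_mono divide_right_mono) auto
    finally have "T x \<le> (2 - q) / q * f x" by simp
    moreover have "q\<^sup>2 * f x \<le> T x"
    proof -
      have "q\<^sup>2 * f x \<le> q * (q * f (b k))"
        using f(2)[OF b(1) bk(1)] q by (simp add: power2_eq_square mult.assoc)
      also have "\<dots> = q * f (b (Suc k))" using b(4)[of k] by simp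
      also have "\<dots> \<le> T (b (Suc k))" using n'(1)[of "Suc k"] k by simp
      also have "\<dots> \<le> T x" using T[OF xB less_imp_le[OF bk(2)]] .
      finally show ?thesis .
    qed
    ultimately show "q\<^sup>2 \<le> T x / f x \<and> T x / f x \<le> (2 - q) / q"
      using fx by (simp add: pos_le_divide_eq pos_divide_le_eq)
  qed
qed

text \<open>For x >= 1 the factor x \<open>\<Psi>\<close> (1/x) is at most a constant by
  \<open>Psi_le\<close>, so 1 / R is dominated by a multiple of the given integrand.\<close>

lemma (in levy_scale) inverse_rate_integrable:
  assumes "rate R" and cond: "\<exists>a>0. set_integrable lborel {a..} (\<lambda>x. 1 / (x * \<Psi> (1 / x) * R x))"
  shows "\<exists>a>0. set_integrable lborel {a..} (\<lambda>x. 1 / R x)"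
proof -
  interpret rate R by fact
  obtain a where a: "a > 0" "set_integrable lborel {a..} (\<lambda>x. 1 / (x * \<Psi> (1 / x) * R x))" using cond by blast
  obtain K where K: "\<And>l. 0 < l \<Longrightarrow> l \<le> 1 \<Longrightarrow> \<Psi> l \<le> K * l" using Psi_le by blast
  define a1 where "a1 = max a 1"
  have i: "integrable lborel (\<lambda>x. K * (indicator {a1..} x *\<^sub>R (1 / (x * \<Psi> (1 / x) * R x))))"
    using set_integrable_subset[OF a(2), of "{a1..}"] by (intro integrable_mult_right) (auto simp: set_integrable_def a1_def)
  have "integrable lborel (\<lambda>x. indicator {a1..} x *\<^sub>R (1 / R x))"
  proof (rule Bochner_Integration.integrable_bound[OF i])
    have "(\<lambda>x. indicator {a1..} x *\<^sub>R (1 / R x)) = (\<lambda>x. indicator {a1..} x *\<^sub>R (1 / R (max 0 x)))"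
      by (auto simp: fun_eq_iff indicator_def a1_def max_def)
    then show "(\<lambda>x. indicator {a1..} x *\<^sub>R (1 / R x)) \<in> borel_measurable lborel" by simp
    show "AE x in lborel. norm (indicator {a1..} x *\<^sub>R (1 / R x)) \<le> norm (K * (indicator {a1..} x *\<^sub>R (1 / (x * \<Psi> (1 / x) * R x))))"
    proof (intro AE_I2)
      fix x
      show "norm (indicator {a1..} x *\<^sub>R (1 / R x)) \<le> norm (K * (indicator {a1..} x *\<^sub>R (1 / (x * \<Psi> (1 / x) * R x))))"
      proof (cases "a1 \<le> x")
        case True
        then have x: "1 \<le> x" by (simp add: a1_def)
        define P where "P = x * \<Psi> (1 / x)"
        have P: "0 < P" "P \<le> K" unfolding P_def using x Psi_pos[of "1 / x"] K[of "1 / x"] by (auto simp: field_simps)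
        have r: "0 < R x" using x by (intro R_pos) auto
        have "1 / R x \<le> K * (1 / (P * R x))" using P r by (simp add: field_simps)
        moreover have "0 \<le> 1 / R x" using r by simp
        ultimately have "\<bar>1 / R x\<bar> \<le> \<bar>K * (1 / (P * R x))\<bar>" by linarith
        then show ?thesis using True unfolding P_def by simp
      qed simp
    qed
  qed
  then show ?thesis using a by (intro exI[of _ a1]) (auto simp: set_integrable_def a1_def)
qed

context levy_rate
begin

text \<open>With y = c z, (ii) says that g(y) / (\<open>\<phi>\<close> y R y) is integrable far out,
  where g(y) = Delta(h(y/c)) dominates Delta(h y). The measure dy / R y gives [b_k, b_(k+1)) the
  mass \<open>\<gamma>\<close> (1 - q) \<open>\<phi>\<close> b_k, so the sum of g(b_(k+1))
  converges. It bounds the sum of the mean squares of T/\<open>\<phi>\<close> - 1, and summable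
  means force almost sure convergence to 0.\<close>

lemma passage_ratio_tendsto:
  fixes h :: "real \<Rightarrow> real" and c C d zi :: real
  assumes ent: "entrance_process M Z R N F Y"
    and h0: "\<And>z. 0 \<le> z \<Longrightarrow> 0 \<le> h z" and hm: "\<And>x y. 0 \<le> x \<Longrightarrow> x \<le> y \<Longrightarrow> h x \<le> h y"
    and C: "0 \<le> C" and zi: "a < zi"
    and cond_i: "\<And>z. zi \<le> z \<Longrightarrow> \<phi> z - \<phi> (z + h z) \<le> C * (\<phi> z * Delta W (h z))"
    and c: "1 < c" and cond_ii: "set_integrable lborel {d..} (\<lambda>z. Delta W (h z) / (\<phi> (c * z) * R (c * z)))"
  shows "AE \<omega> in N. ((\<lambda>b. T_below Y b \<omega> / (\<integral>\<omega>'. T_below Y b \<omega>' \<partial>N)) \<longlongrightarrow> 1) at_top"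
proof -
  define g where "g b = Delta W (h (b / c))" for b
  have g0: "0 \<le> g b" for b unfolding g_def by (rule Delta_nonneg)
  \<comment> \<open>\<open>C\<close> comes from (i), \<open>\<gamma>\<close> from the far part in
    \<open>potential_rate_start\<close>.\<close>
  define K0 where "K0 = C + \<gamma>"
  have K0: "0 < K0" using C gamma_pos by (simp add: K0_def)
  define K where "K b = K0 * Delta W (h b)" for b
  have K: "0 \<le> K b" for b using K0 Delta_nonneg by (simp add: K_def)
  have Dg: "Delta W (h b) \<le> g b" if "0 \<le> b" for b
    unfolding g_def using that c by (intro Delta_antimono hm) (auto simp: divide_le_eq mult_left_le_one_le mult_le_cancel_left1)
  have start: "potential (inv_rate R y) y \<le> ennreal (K b * \<phi> y)" if "zi \<le> b" "b \<le> y" for b y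
  proof -
    have y: "zi \<le> y" "a \<le> y" "0 \<le> y" "0 \<le> b" using that zi a_pos by auto
    have "potential (inv_rate R y) y \<le> ennreal (\<phi> y - \<phi> (y + h y) + \<gamma> * Delta W (h y) * \<phi> y)"
      using y by (intro potential_rate_start h0) auto
    also have "\<dots> \<le> ennreal (K b * \<phi> y)"
    proof (rule ennreal_leI)
      have "\<phi> y - \<phi> (y + h y) + \<gamma> * Delta W (h y) * \<phi> y \<le> K0 * Delta W (h y) * \<phi> y"
        using cond_i[OF y(1)] by (simp add: K0_def algebra_simps)
      also have "\<dots> \<le> K b * \<phi> y"
        unfolding K_def using phi_nonneg[OF y(2)] K0 y that
        by (intro mult_right_mono mult_left_mono Delta_antimono hm) auto
      finally show "\<phi> y - \<phi> (y + h y) + \<gamma> * Delta W (h y) * \<phi> y \<le> K b * \<phi> y" .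
    qed
    finally show ?thesis .
  qed
  have mom: "T_below Y b \<in> borel_measurable N" "integrable N (T_below Y b)"
    "(\<integral>\<omega>. T_below Y b \<omega> \<partial>N) \<le> \<phi> b" "\<phi> b * (1 - K b) \<le> (\<integral>\<omega>. T_below Y b \<omega> \<partial>N)"
    "AE \<omega> in N. {t. 0 \<le> t \<and> Y t \<omega> < ereal b} \<noteq> {}"
    "(\<integral>\<^sup>+ \<omega>. ennreal ((T_below Y b \<omega> / \<phi> b - 1)\<^sup>2) \<partial>N) \<le> ennreal (3 * K b)" if "zi \<le> b" for b
    using passage_moments[OF ent _ K[of b] start[OF that]] zi that by auto
  \<comment> \<open>Beyond \<open>B\<close> the moment bounds apply, and z = y / c lies in the range
    of (ii) and is nonnegative.\<close>
  define B where "B = max zi (c * max d 0)"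
  have "c * d \<le> c * max d 0" using c by (intro mult_left_mono) auto
  then have B: "zi \<le> B" "a < B" "0 < B" "c * d \<le> B" using zi a_pos by (auto simp: B_def)
  have phiB: "0 < \<phi> x" if "B \<le> x" for x using that B by (intro phi_pos) auto
  have seq: "\<exists>b. geometric_levels \<phi> B q b"
    if q: "0 < q" "q < 1" for q
  proof -
    have "\<exists>x\<ge>B. \<phi> x = q ^ k * \<phi> B" for k
    proof -
      have v: "0 < q ^ k * \<phi> B" "q ^ k * \<phi> B \<le> \<phi> B"
        using q phiB[of B] by (auto simp: mult_left_le_one_le power_le_one)
      have "\<forall>\<^sub>F x in at_top. \<phi> x < q ^ k * \<phi> B \<and> B \<le> x"
        using order_tendstoD(2)[OF phi_tendsto_0 v(1)] eventually_ge_at_top[of B] by (rule eventually_conj)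
      then obtain x where x: "\<phi> x < q ^ k * \<phi> B" "B \<le> x" by (auto simp: eventually_at_top_linorder)
      have "continuous_on {B..x} \<phi>" by (rule continuous_on_subset[OF phi_cont[OF B(2)]]) auto
      then have "\<exists>y\<ge>B. y \<le> x \<and> \<phi> y = q ^ k * \<phi> B" using x v by (intro IVT2') auto
      then show ?thesis by blast
    qed
    then obtain b where b: "\<And>k. B \<le> b k" "\<And>k. \<phi> (b k) = q ^ k * \<phi> B" by metis
    have less: "b k < b (Suc k)" for k
    proof (rule ccontr)
      assume "\<not> b k < b (Suc k)"
      then have "\<phi> (b k) \<le> \<phi> (b (Suc k))" using b(1)[of "Suc k"] B by (intro phi_antimono) auto
      then have "1 * \<phi> (b k) \<le> q * \<phi> (b k)" by (simp add: b(2))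
      moreover have "q * \<phi> (b k) < 1 * \<phi> (b k)" using q phiB[OF b(1)] by (intro mult_strict_right_mono)
      ultimately show False by linarith
    qed
    have "filterlim b at_top sequentially"
      unfolding filterlim_at_top
    proof
      fix z
      define x where "x = max z B"
      have x: "0 < \<phi> x" using phiB by (simp add: x_def)
      have "(\<lambda>k. q ^ k * \<phi> B) \<longlonglongrightarrow> 0 * \<phi> B" using q by (intro tendsto_intros LIMSEQ_realpow_zero) auto
      then have "\<forall>\<^sub>F k in sequentially. q ^ k * \<phi> B < \<phi> x" using x by (intro order_tendstoD(2)) auto
      then show "\<forall>\<^sub>F k in sequentially. z \<le> b k"
      proof eventually_elim
        fix k assume k: "q ^ k * \<phi> B < \<phi> x"
        show "z \<le> b k"
        proof (rule ccontr)
          assume "\<not> z \<le> b k"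
          then have "\<phi> x \<le> \<phi> (b k)" using b(1)[of k] B by (intro phi_antimono) (auto simp: x_def)
          with k show False by (simp add: b(2))
        qed
      qed
    qed
    then show ?thesis using b less
      by (intro exI[of _ b]) (auto simp: geometric_levels_def mono_iff_le_Suc less_imp_le)
  qed
  have sum: "(\<Sum>k. ennreal (g (b (Suc k)))) < \<infinity>"
    if q: "0 < q" "q < 1" and geo: "geometric_levels \<phi> B q b" for q :: real and b :: "nat \<Rightarrow> real"
  proof -
    note b = geometric_levelsD(1,2,4)[OF geo]
    define r where "r k y = indicator {b k..<b (Suc k)} y * inverse (ennreal (R y))" for k y
    have [measurable]: "r k \<in> borel_measurable borel" for k
      unfolding r_def[abs_def] using b(1)[of k] B by (intro measurable_indicator_inverse_rate) auto
    \<comment> \<open>The integrand of (ii) on the block where c z lies in [b_k, b_(k+1)), with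
      \<open>g\<close> frozen at the right endpoint and \<open>\<phi>\<close> at the left one; both
      choices make it smaller.\<close>
    define L where "L k z = ennreal (g (b (Suc k)) / \<phi> (b k)) * r k (c * z)" for k z
    have [measurable]: "L k \<in> borel_measurable borel" for k unfolding L_def by measurable
    have bmono: "b k \<le> b (Suc k)" for k using b(2) by (simp add: mono_iff_le_Suc)
    have intL: "ennreal c * (\<integral>\<^sup>+ z. L k z \<partial>lborel) = ennreal (\<gamma> * (1 - q)) * ennreal (g (b (Suc k)))" for k
    proof -
      have "ennreal c * (\<integral>\<^sup>+ z. r k (c * z) \<partial>lborel) = (\<integral>\<^sup>+ y. r k y \<partial>lborel)"
        using c by (subst (2) nn_integral_real_affine[where c=c and t=0]) auto
      also have "\<dots> = ennreal (\<gamma> * (1 - q) * \<phi> (b k))"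
        unfolding r_def using b(1)[of k] B bmono[of k] by (subst nn_integral_R_Ico) (auto simp: b(3) algebra_simps)
      finally have "ennreal c * (\<integral>\<^sup>+ z. L k z \<partial>lborel) = ennreal (g (b (Suc k)) / \<phi> (b k)) * ennreal (\<gamma> * (1 - q) * \<phi> (b k))"
        unfolding L_def by (simp add: nn_integral_cmult mult.left_commute[of "ennreal c"])
      also have "\<dots> = ennreal (\<gamma> * (1 - q)) * ennreal (g (b (Suc k)))"
        using phiB[OF b(1)[of k]] g0 q gamma_pos by (simp add: ennreal_mult[symmetric])
      finally show ?thesis .
    qed
    let ?f = "\<lambda>z. indicator {d..} z *\<^sub>R (Delta W (h z) / (\<phi> (c * z) * R (c * z)))"
    \<comment> \<open>The blocks are disjoint, so at most one summand is nonzero at a given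
      \<open>z\<close>.\<close>
    have Lsum: "(\<Sum>k. L k z) \<le> ennreal (norm (?f z))" for z
    proof (cases "\<exists>k. c * z \<in> {b k..<b (Suc k)}")
      case False
      then have "L k z = 0" for k by (auto simp: L_def r_def indicator_def)
      then show ?thesis by simp
    next
      case True
      then obtain k where k: "b k \<le> c * z" "c * z < b (Suc k)" by auto
      have "L j z = 0" if "j \<notin> {k}" for j
      proof -
        have "j < k \<or> k < j" using that by auto
        then have "c * z \<notin> {b j..<b (Suc j)}"
          using k monoD[OF b(2), of "Suc j" k] monoD[OF b(2), of "Suc k" j] by auto
        then show ?thesis by (simp add: L_def r_def)
      qed
      then have "(\<Sum>k. L k z) = (\<Sum>k\<in>{k}. L k z)" by (intro suminf_finite) auto
      also have "\<dots> = ennreal (g (b (Suc k)) / \<phi> (b k)) * inverse (ennreal (R (c * z)))"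
        using k by (simp add: L_def r_def)
      also have "\<dots> = ennreal (g (b (Suc k)) / \<phi> (b k) * (1 / R (c * z)))"
      proof -
        have "0 < R (c * z)" using k b(1)[of k] B by (intro R_pos) auto
        then show ?thesis using g0 phiB[OF b(1)[of k]] by (simp add: inverse_ennreal inverse_eq_divide ennreal_mult[symmetric])
      qed
      also have "\<dots> \<le> ennreal (norm (?f z))"
      proof (rule ennreal_leI)
        have cz: "B \<le> c * z" using k b(1)[of k] by simp
        have "0 < c * z" "c * d \<le> c * z" using cz B by linarith+
        then have z: "d \<le> z" "0 \<le> z" using c by (auto simp: zero_less_mult_iff)
        have R: "0 < R (c * z)" using cz B by (intro R_pos) auto
        have "z \<le> b (Suc k) / c" using k c by (simp add: pos_le_divide_eq mult.commute)
        then have "g (b (Suc k)) \<le> Delta W (h z)" unfolding g_def using z by (intro Delta_antimono hm)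
        moreover have "\<phi> (c * z) \<le> \<phi> (b k)" using k b(1)[of k] B by (intro phi_antimono) auto
        ultimately have "g (b (Suc k)) / \<phi> (b k) \<le> Delta W (h z) / \<phi> (c * z)"
          using phiB[OF cz] Delta_nonneg by (intro frac_le) auto
        then have "g (b (Suc k)) / \<phi> (b k) * (1 / R (c * z)) \<le> Delta W (h z) / \<phi> (c * z) * (1 / R (c * z))"
          using R by (intro mult_right_mono) auto
        also have "\<dots> = ?f z" using z by simp
        also have "\<dots> \<le> norm (?f z)" by (simp only: real_norm_def abs_ge_self)
        finally show "g (b (Suc k)) / \<phi> (b k) * (1 / R (c * z)) \<le> norm (?f z)" .
      qed
      finally show ?thesis .
    qed
    have "ennreal (\<gamma> * (1 - q)) * (\<Sum>k. ennreal (g (b (Suc k)))) = (\<Sum>k. ennreal c * (\<integral>\<^sup>+ z. L k z \<partial>lborel))"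
      unfolding intL by simp
    also have "\<dots> = ennreal c * (\<integral>\<^sup>+ z. (\<Sum>k. L k z) \<partial>lborel)"
      by (simp add: nn_integral_suminf)
    also have "\<dots> \<le> ennreal c * (\<integral>\<^sup>+ z. ennreal (norm (?f z)) \<partial>lborel)"
      by (intro mult_left_mono nn_integral_mono Lsum) auto
    also have "\<dots> < \<infinity>"
      using cond_ii unfolding set_integrable_def integrable_iff_bounded by (auto simp: ennreal_mult_less_top)
    finally show ?thesis using q gamma_pos by (auto simp: ennreal_mult_less_top)
  qed
  have AE_q: "AE \<omega> in N. \<exists>b. geometric_levels \<phi> B q b
      \<and> (\<lambda>k. T_below Y (b k) \<omega> / \<phi> (b k)) \<longlonglongrightarrow> 1" if q: "0 < q" "q < 1" for q
  proof -
    obtain b where geo: "geometric_levels \<phi> B q b" using seq[OF q] by blast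
    note b = geometric_levelsD[OF geo]
    \<comment> \<open>\<open>sum\<close> controls \<open>g\<close> at the right endpoints of the
      blocks, hence the shifted levels.\<close>
    define b' where "b' k = b (Suc k)" for k
    have b'z: "zi \<le> b' k" for k using b(1)[of "Suc k"] B by (simp add: b'_def)
    define X where "X k \<omega> = (T_below Y (b' k) \<omega> / \<phi> (b' k) - 1)\<^sup>2" for k \<omega>
    have [measurable]: "T_below Y (b' k) \<in> borel_measurable N" for k by (rule mom(1)[OF b'z])
    have [measurable]: "X k \<in> borel_measurable N" for k unfolding X_def by measurable
    have "(\<integral>\<^sup>+ \<omega>. (\<Sum>k. ennreal (X k \<omega>)) \<partial>N) = (\<Sum>k. \<integral>\<^sup>+ \<omega>. ennreal (X k \<omega>) \<partial>N)"
      by (rule nn_integral_suminf) measurable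
    also have "\<dots> \<le> (\<Sum>k. ennreal (3 * K0) * ennreal (g (b (Suc k))))"
    proof (intro suminf_le summableI)
      fix k
      have "(\<integral>\<^sup>+ \<omega>. ennreal (X k \<omega>) \<partial>N) \<le> ennreal (3 * K (b' k))"
        unfolding X_def by (rule mom(6)[OF b'z])
      also have "\<dots> \<le> ennreal (3 * K0 * g (b' k))"
        unfolding K_def using K0 Dg[of "b' k"] b'z[of k] zi a_pos by (intro ennreal_leI) (simp add: mult_left_mono)
      also have "\<dots> = ennreal (3 * K0) * ennreal (g (b (Suc k)))" using K0 g0 by (simp add: ennreal_mult b'_def)
      finally show "(\<integral>\<^sup>+ \<omega>. ennreal (X k \<omega>) \<partial>N) \<le> ennreal (3 * K0) * ennreal (g (b (Suc k)))" .
    qed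
    also have "\<dots> < \<infinity>"
      using sum[OF q geo] by (simp add: ennreal_suminf_cmult ennreal_mult_less_top)
    finally have "AE \<omega> in N. (\<Sum>k. ennreal (X k \<omega>)) \<noteq> \<infinity>"
      by (intro nn_integral_PInf_AE) auto
    then show ?thesis
    proof eventually_elim
      fix \<omega> assume "(\<Sum>k. ennreal (X k \<omega>)) \<noteq> \<infinity>"
      then have "summable (\<lambda>k. X k \<omega>)" by (intro summable_suminf_not_top) (auto simp: X_def)
      then have "(\<lambda>k. X k \<omega>) \<longlonglongrightarrow> 0" by (rule summable_LIMSEQ_zero)
      then have "(\<lambda>k. sqrt (X k \<omega>)) \<longlonglongrightarrow> sqrt 0" by (intro tendsto_intros)
      then have "(\<lambda>k. \<bar>T_below Y (b' k) \<omega> / \<phi> (b' k) - 1\<bar>) \<longlonglongrightarrow> 0" by (simp add: X_def)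
      then have "(\<lambda>k. T_below Y (b' k) \<omega> / \<phi> (b' k) - 1) \<longlonglongrightarrow> 0" by (rule tendsto_rabs_zero_cancel)
      then have "(\<lambda>k. T_below Y (b' k) \<omega> / \<phi> (b' k)) \<longlonglongrightarrow> 1" by (simp add: LIM_zero_iff)
      moreover have "mono b'" using b(2) by (simp add: b'_def mono_iff_le_Suc)
      moreover have "filterlim b' at_top sequentially" unfolding b'_def using b(3) by (simp add: filterlim_sequentially_Suc)
      ultimately show "\<exists>b. geometric_levels \<phi> B q b
        \<and> (\<lambda>k. T_below Y (b k) \<omega> / \<phi> (b k)) \<longlonglongrightarrow> 1"
        using b by (intro exI[of _ b']) (auto simp: b'_def geometric_levels_def)
    qed
  qed
  \<comment> \<open>A countable family of ratios tending to 1, so that one exceptional null set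
    serves all of them; the double successor keeps q 0 positive.\<close>
  define q where "q m = 1 - 1 / real (Suc (Suc m))" for m
  have q: "0 < q m" "q m < 1" for m by (auto simp: q_def)
  have q_lim: "q \<longlonglongrightarrow> 1"
  proof -
    have "q \<longlonglongrightarrow> 1 - 0" unfolding q_def[abs_def] by (intro tendsto_intros LIMSEQ_Suc[OF inverse_Suc_sequence(1)])
    then show ?thesis by simp
  qed
  have "AE \<omega> in N. \<forall>m. \<exists>b. geometric_levels \<phi> B (q m) b
      \<and> (\<lambda>k. T_below Y (b k) \<omega> / \<phi> (b k)) \<longlonglongrightarrow> 1"
    unfolding AE_all_countable using AE_q q by blast
  \<comment> \<open>A path that goes below \<open>B\<close> goes below every higher level, so all
    the infima involved are over nonempty sets and T is antitone in the level.\<close>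
  moreover note mom(5)[OF B(1)]
  ultimately have lim: "AE \<omega> in N. ((\<lambda>b. T_below Y b \<omega> / \<phi> b) \<longlongrightarrow> 1) at_top"
  proof eventually_elim
    fix \<omega>
    assume ex: "\<forall>m. \<exists>b. geometric_levels \<phi> B (q m) b
      \<and> (\<lambda>k. T_below Y (b k) \<omega> / \<phi> (b k)) \<longlonglongrightarrow> 1"
      and ne: "{t. 0 \<le> t \<and> Y t \<omega> < ereal B} \<noteq> {}"
    have T_anti: "T_below Y y \<omega> \<le> T_below Y x \<omega>" if "B \<le> x" "x \<le> y" for x y
      unfolding T_below_def
    proof (rule cInf_superset_mono)
      obtain t where "0 \<le> t" "Y t \<omega> < ereal B" using ne by blast
      moreover have "ereal B \<le> ereal x" using that by simp
      ultimately show "{t. 0 \<le> t \<and> Y t \<omega> < ereal x} \<noteq> {}" by (metis (mono_tags, lifting) empty_iff mem_Collect_eq order_less_le_trans)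
      show "bdd_below {t. 0 \<le> t \<and> Y t \<omega> < ereal y}" by (rule bdd_belowI[of _ 0]) auto
      have "ereal x \<le> ereal y" using that by simp
      then show "{t. 0 \<le> t \<and> Y t \<omega> < ereal x} \<subseteq> {t. 0 \<le> t \<and> Y t \<omega> < ereal y}" by (auto intro: order_less_le_trans)
    qed
    have ev: "\<forall>\<^sub>F x in at_top. (q m)\<^sup>2 \<le> T_below Y x \<omega> / \<phi> x \<and> T_below Y x \<omega> / \<phi> x \<le> (2 - q m) / q m" for m
    proof -
      obtain b where geo: "geometric_levels \<phi> B (q m) b" and lim: "(\<lambda>k. T_below Y (b k) \<omega> / \<phi> (b k)) \<longlonglongrightarrow> 1"
        using ex by blast
      show ?thesis
        by (rule geometric_sandwich[where B=B and T="\<lambda>x. T_below Y x \<omega>", OF q T_anti phiB _ geo lim])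
          (use B in \<open>auto intro!: phi_antimono\<close>)
    qed
    show "((\<lambda>b. T_below Y b \<omega> / \<phi> b) \<longlongrightarrow> 1) at_top"
    proof (rule order_tendstoI)
      fix e :: real assume e: "e < 1"
      have "(\<lambda>m. (q m)\<^sup>2) \<longlonglongrightarrow> 1\<^sup>2" by (intro tendsto_intros q_lim)
      then have "\<forall>\<^sub>F m in sequentially. e < (q m)\<^sup>2" using e by (intro order_tendstoD(1)) auto
      then obtain m where "e < (q m)\<^sup>2" by (auto simp: eventually_sequentially)
      then show "\<forall>\<^sub>F b in at_top. e < T_below Y b \<omega> / \<phi> b" by (intro eventually_mono[OF ev[of m]]) auto
    next
      fix e :: real assume e: "1 < e"
      have "(\<lambda>m. (2 - q m) / q m) \<longlonglongrightarrow> (2 - 1) / 1" by (intro tendsto_intros q_lim) auto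
      then have "\<forall>\<^sub>F m in sequentially. (2 - q m) / q m < e" using e by (intro order_tendstoD(2)) auto
      then obtain m where "(2 - q m) / q m < e" by (auto simp: eventually_sequentially)
      then show "\<forall>\<^sub>F b in at_top. T_below Y b \<omega> / \<phi> b < e" by (intro eventually_mono[OF ev[of m]]) auto
    qed
  qed
  \<comment> \<open>That Delta(h b) vanishes is read off from the summability obtained from (ii):
    its values along one sequence of levels tend to 0, and it is antitone.\<close>
  have Delta_lim: "((\<lambda>b. Delta W (h b)) \<longlongrightarrow> 0) at_top"
  proof (rule order_tendstoI)
    fix e :: real assume "e < 0"
    then show "\<forall>\<^sub>F b in at_top. e < Delta W (h b)" using Delta_nonneg by (intro always_eventually allI) (meson less_le_trans)
  next
    fix e :: real assume e: "0 < e"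
    obtain b where geo: "geometric_levels \<phi> B (q 0) b" using seq[OF q(1,2)[of 0]] by blast
    note b = geometric_levelsD[OF geo]
    have "summable (\<lambda>k. g (b (Suc k)))" using sum[OF q(1,2)[of 0] geo] g0 by (intro summable_suminf_not_top) auto
    then have "(\<lambda>k. g (b (Suc k))) \<longlonglongrightarrow> 0" by (rule summable_LIMSEQ_zero)
    then have "\<forall>\<^sub>F k in sequentially. g (b (Suc k)) < e" using e by (rule order_tendstoD(2))
    then obtain k where k: "g (b (Suc k)) < e" by (auto simp: eventually_sequentially)
    have b0: "0 \<le> b (Suc k)" using b(1)[of "Suc k"] B by simp
    show "\<forall>\<^sub>F x in at_top. Delta W (h x) < e"
    proof (rule eventually_at_top_linorderI)
      fix x assume "b (Suc k) \<le> x"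
      then have "Delta W (h x) \<le> Delta W (h (b (Suc k)))" using b0 by (intro Delta_antimono hm)
      then show "Delta W (h x) < e" using Dg[OF b0] k by simp
    qed
  qed
  \<comment> \<open>The almost sure limit was shown for the denominator \<open>\<phi>\<close>; this
    exchanges it for the mean.\<close>
  have mean: "((\<lambda>b. (\<integral>\<omega>. T_below Y b \<omega> \<partial>N) / \<phi> b) \<longlongrightarrow> 1) at_top"
  proof (rule tendsto_sandwich)
    have "((\<lambda>b. 1 - K0 * Delta W (h b)) \<longlongrightarrow> 1 - K0 * 0) at_top" by (intro tendsto_intros Delta_lim)
    then show "((\<lambda>b. 1 - K b) \<longlongrightarrow> 1) at_top" by (simp add: K_def)
    show "\<forall>\<^sub>F b in at_top. 1 - K b \<le> (\<integral>\<omega>. T_below Y b \<omega> \<partial>N) / \<phi> b"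
      using mom(4) phiB B by (intro eventually_at_top_linorderI[of B]) (simp add: pos_le_divide_eq mult.commute)
    show "\<forall>\<^sub>F b in at_top. (\<integral>\<omega>. T_below Y b \<omega> \<partial>N) / \<phi> b \<le> 1"
      using mom(3) phiB B by (intro eventually_at_top_linorderI[of B]) (simp add: pos_divide_le_eq)
  qed simp
  show ?thesis
    using lim
  proof eventually_elim
    fix \<omega> assume "((\<lambda>b. T_below Y b \<omega> / \<phi> b) \<longlongrightarrow> 1) at_top"
    then have "((\<lambda>b. (T_below Y b \<omega> / \<phi> b) / ((\<integral>\<omega>. T_below Y b \<omega> \<partial>N) / \<phi> b)) \<longlongrightarrow> 1 / 1) at_top"
      by (intro tendsto_divide mean) auto
    moreover have "\<forall>\<^sub>F b in at_top. (T_below Y b \<omega> / \<phi> b) / ((\<integral>\<omega>. T_below Y b \<omega> \<partial>N) / \<phi> b) = T_below Y b \<omega> / (\<integral>\<omega>. T_below Y b \<omega> \<partial>N)"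
      using phiB by (intro eventually_at_top_linorderI[of B]) (force)
    ultimately show "((\<lambda>b. T_below Y b \<omega> / (\<integral>\<omega>'. T_below Y b \<omega>' \<partial>N)) \<longlongrightarrow> 1) at_top"
      using Lim_transform_eventually by force
  qed
qed

end

theorem theorem5p7:
  fixes \<gamma> \<sigma> :: real and \<pi> :: "real measure"
    and M :: "'a measure" and Z :: "real \<Rightarrow> 'a \<Rightarrow> real"
    and R W p :: "real \<Rightarrow> real"
    and N :: "'b measure" and F :: "real \<Rightarrow> 'b measure" and Y :: "real \<Rightarrow> 'b \<Rightarrow> ereal"
  assumes gamma_pos: "\<gamma> > 0"
    and sigma_nonneg: "\<sigma> \<ge> 0"
    and levy_pi: "levy_measure \<pi>"
    and levy_Z: "spec_pos_levy M Z (Psi \<gamma> \<sigma> \<pi>)"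
    and R_cont: "continuous_on {0..} R"
    and R_pos: "\<forall>x>0. R x > 0"
    and scale_W: "scale_function (Psi \<gamma> \<sigma> \<pi>) W"
    and entrance_cond: "\<exists>a>0. set_integrable lborel {a..} (\<lambda>x. 1 / (x * Psi \<gamma> \<sigma> \<pi> (1 / x) * R x))"
    and from_infty: "entrance_process M Z R N F Y"
    and p_nonneg: "\<forall>z\<ge>0. p z \<ge> 0"
    and p_mono: "mono_on {0..} (\<lambda>z. z * p z)"
    and p_lim: "(p \<longlongrightarrow> 0) at_top"
    and cond_i: "(\<lambda>z. phi \<gamma> R z - phi \<gamma> R (z + z * p z)) \<in> O(\<lambda>z. phi \<gamma> R z * Delta W (z * p z))"
    and cond_ii: "\<exists>c>1. \<exists>a. set_integrable lborel {a..}
                     (\<lambda>z. Delta W (z * p z) / (phi \<gamma> R (c * z) * R (c * z)))"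
    and cond_iii: "\<exists>C. \<forall>\<^sub>F z in at_top. V R z (p z) \<le> ereal (C * Delta W (z * p z))"
  shows "AE \<omega> in N. ((\<lambda>b. T_below Y b \<omega> / (\<integral>\<omega>'. T_below Y b \<omega>' \<partial>N)) \<longlongrightarrow> 1) at_top"
proof -
  interpret L: levy_scale \<gamma> \<sigma> \<pi> M Z W by unfold_locales fact+
  have rate: "rate R" by unfold_locales (use R_cont R_pos in auto)
  obtain a where a: "a > 0" "set_integrable lborel {a..} (\<lambda>x. 1 / R x)"
    using L.inverse_rate_integrable[OF rate entrance_cond] by blast
  interpret levy_rate \<gamma> \<sigma> \<pi> M Z W R a
    by (intro levy_rate.intro levy_rate_axioms.intro L.levy_scale_axioms rate a)
  obtain C where C: "C > 0" and ev: "\<forall>\<^sub>F z in at_top. norm (phi \<gamma> R z - phi \<gamma> R (z + z * p z)) \<le> C * norm (phi \<gamma> R z * Delta W (z * p z))"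
    using cond_i by (rule landau_o.bigE)
  obtain z1 where z1: "\<And>z. z1 \<le> z \<Longrightarrow> norm (phi \<gamma> R z - phi \<gamma> R (z + z * p z)) \<le> C * norm (phi \<gamma> R z * Delta W (z * p z))"
    using ev unfolding eventually_at_top_linorder by blast
  obtain c d where c: "1 < c" and ii: "set_integrable lborel {d..} (\<lambda>z. Delta W (z * p z) / (phi \<gamma> R (c * z) * R (c * z)))"
    using cond_ii by blast
  show ?thesis
  \<comment> \<open>\<open>z1\<close> is the threshold of the bound in (i); \<open>a + 1\<close>
    secures the strict inequality a < zi.\<close>
  proof (rule passage_ratio_tendsto[where h="\<lambda>z. z * p z" and C=C and zi="max z1 (a + 1)", OF from_infty _ _ _ _ _ c ii])
    show "0 \<le> z * p z" if "0 \<le> z" for z using that p_nonneg by simp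
    show "x * p x \<le> y * p y" if "0 \<le> x" "x \<le> y" for x y
      using mono_onD[OF p_mono, of x y] that by simp
    show "phi \<gamma> R z - phi \<gamma> R (z + z * p z) \<le> C * (phi \<gamma> R z * Delta W (z * p z))" if "max z1 (a + 1) \<le> z" for z
      using z1[of z] that phi_nonneg[of z] L.Delta_nonneg[of "z * p z"] by simp
  qed (use C in auto)
qed

end
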